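(* Let $\beta>2$ be fixed and let $X_1,X_2,\ldots$ be i.i.d. random variables with a normal distribution $\mathrm{N}(\mu,\sigma^2)$ for some $\mu\in\mathbb{R}$, $\sigma^2>0$. For $n\ge 2$ let $W_n(t)=\sqrt{n}\,(M_n(t)-M_0(t))$, $t\in\mathbb{R}$, where $M_n$ is the empirical moment generating function of the scaled residuals of $X_1,\ldots,X_n$ and $M_0(t)=e^{t^2/2}$, regarded as a random element of the Hilbert space $\mathcal{H}=L^2(\mathbb{R},\mathcal{B},e^{-\beta t^2}\,dt)$. Then there is a centred Gaussian random element $W$ of $\mathcal{H}$ having covariance kernel $$K(s,t)=e^{(t^2+s^2)/2}\left(e^{ts}-1-ts-\frac{t^2s^2}{2}\right),\quad s,t\in\mathbb{R},$$ such that $W_n$ converges in distribution to $W$ in $\mathcal{H}$ as $n\to\infty$.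
   Context: Put $\overline{X}_n=n^{-1}\sum_{j=1}^n X_j$, $S_n^2=n^{-1}\sum_{j=1}^n (X_j-\overline{X}_n)^2$, $S_n=\sqrt{S_n^2}$. The scaled residuals are $Y_{n,j}=(X_j-\overline{X}_n)/S_n$, $j=1,\ldots,n$ (defined almost surely for $n\ge2$), and $M_n(t)=\frac1n\sum_{j=1}^n \exp(tY_{n,j})$, $t\in\mathbb{R}$. $\mathcal{B}$ is the Borel $\sigma$-field on $\mathbb{R}$. $\mathcal{H}$ is the separable Hilbert space of (equivalence classes of) measurable functions $f:\mathbb{R}\to\mathbb{R}$ with $\int_{\mathbb{R}} f^2(t)e^{-\beta t^2}\,dt<\infty$, with inner product $\langle f,g\rangle=\int_{\mathbb{R}} f(t)g(t)e^{-\beta t^2}\,dt$. A centred Gaussian element $W$ of $\mathcal{H}$ has covariance kernel $K$ if, for all $f,g\in\mathcal{H}$, $\langle W,f\rangle$ is a centred (possibly degenerate) normal random variable and $\mathbb{E}[\langle W,f\rangle\langle W,g\rangle]=\int_{\mathbb{R}}\int_{\mathbb{R}}K(s,t)f(s)g(t)e^{-\beta s^2}e^{-\beta t^2}\,ds\,dt$. *)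

theory Defs
  imports "HOL-Probability.Probability"
begin

section \<open>Real $L^2$ spaces as sets of equivalence classes\<close>

definition sq_integrable :: "'a measure \<Rightarrow> ('a \<Rightarrow> real) set" where
  "sq_integrable M = {f \<in> borel_measurable M. integrable M (\<lambda>x. (f x)\<^sup>2)}"

definition ae_eq :: "'a measure \<Rightarrow> (('a \<Rightarrow> real) \<times> ('a \<Rightarrow> real)) set" where
  "ae_eq M = {(f, g). f \<in> sq_integrable M \<and> g \<in> sq_integrable M \<and> (AE x in M. f x = g x)}"

definition L2_space :: "'a measure \<Rightarrow> ('a \<Rightarrow> real) set set" where
  "L2_space M = sq_integrable M // ae_eq M"

definition L2_class :: "'a measure \<Rightarrow> ('a \<Rightarrow> real) \<Rightarrow> ('a \<Rightarrow> real) set" where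
  "L2_class M f = ae_eq M `` {f}"

definition L2_rep :: "('a \<Rightarrow> real) set \<Rightarrow> 'a \<Rightarrow> real" where
  "L2_rep A = (SOME f. f \<in> A)"

definition L2_inner :: "'a measure \<Rightarrow> ('a \<Rightarrow> real) set \<Rightarrow> ('a \<Rightarrow> real) set \<Rightarrow> real" where
  "L2_inner M A B = (\<integral>x. L2_rep A x * L2_rep B x \<partial>M)"

definition L2_dist :: "'a measure \<Rightarrow> ('a \<Rightarrow> real) set \<Rightarrow> ('a \<Rightarrow> real) set \<Rightarrow> real" where
  "L2_dist M A B = sqrt (\<integral>x. (L2_rep A x - L2_rep B x)\<^sup>2 \<partial>M)"

definition L2_topology :: "'a measure \<Rightarrow> ('a \<Rightarrow> real) set topology" where
  "L2_topology M = Metric_space.mtopology (L2_space M) (L2_dist M)"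

text \<open>
  The following facts show that the inner product and the distance do not depend on the
  chosen representatives, and that the distance is a metric on the set of classes.
\<close>

lemma sq_integrable_mult:
  assumes "f \<in> sq_integrable M" "g \<in> sq_integrable M"
  shows "integrable M (\<lambda>x. f x * g x)"
proof (rule Bochner_Integration.integrable_bound)
  show "integrable M (\<lambda>x. (f x)\<^sup>2 + (g x)\<^sup>2)"
    using assms by (auto simp: sq_integrable_def)
  show "(\<lambda>x. f x * g x) \<in> borel_measurable M"
    using assms by (auto simp: sq_integrable_def)
  have "\<bar>a * b\<bar> \<le> a\<^sup>2 + b\<^sup>2" for a b :: real
  proof -
    have "2 * \<bar>a\<bar> * \<bar>b\<bar> \<le> a\<^sup>2 + b\<^sup>2"
      using sum_squares_bound[of "\<bar>a\<bar>" "\<bar>b\<bar>"] by simp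
    moreover have "0 \<le> \<bar>a\<bar> * \<bar>b\<bar>" by simp
    ultimately show ?thesis unfolding abs_mult by linarith
  qed
  then show "AE x in M. norm (f x * g x) \<le> norm ((f x)\<^sup>2 + (g x)\<^sup>2)"
    by simp
qed

lemma sq_integrable_diff:
  assumes "f \<in> sq_integrable M" "g \<in> sq_integrable M"
  shows "(\<lambda>x. f x - g x) \<in> sq_integrable M"
proof -
  have "integrable M (\<lambda>x. (f x)\<^sup>2 + (g x)\<^sup>2 - 2 * (f x * g x))"
    using assms sq_integrable_mult[OF assms] by (auto simp: sq_integrable_def)
  then show ?thesis
    using assms by (auto simp: sq_integrable_def power2_diff mult.assoc)
qed

lemma equiv_ae_eq: "equiv (sq_integrable M) (ae_eq M)"
proof (rule equivI)
  show "ae_eq M \<subseteq> sq_integrable M \<times> sq_integrable M"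
    by (auto simp: ae_eq_def)
  show "refl_on (sq_integrable M) (ae_eq M)"
    by (auto simp: refl_on_def ae_eq_def)
  show "sym (ae_eq M)"
    by (auto simp: sym_def ae_eq_def)
  show "trans (ae_eq M)"
    by (auto simp: trans_def ae_eq_def)
qed

lemma L2_class_in_space: "f \<in> sq_integrable M \<Longrightarrow> L2_class M f \<in> L2_space M"
  unfolding L2_class_def L2_space_def by (rule quotientI)

lemma L2_rep_class:
  assumes "f \<in> sq_integrable M"
  shows "L2_rep (L2_class M f) \<in> sq_integrable M" "AE x in M. L2_rep (L2_class M f) x = f x"
proof -
  have "f \<in> L2_class M f"
    using assms by (auto simp: L2_class_def ae_eq_def)
  then have "L2_rep (L2_class M f) \<in> L2_class M f"
    unfolding L2_rep_def by (metis someI)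
  then show "L2_rep (L2_class M f) \<in> sq_integrable M" "AE x in M. L2_rep (L2_class M f) x = f x"
    by (auto simp: L2_class_def ae_eq_def)
qed

lemma L2_rep_space:
  assumes "A \<in> L2_space M"
  shows "L2_rep A \<in> sq_integrable M" "L2_class M (L2_rep A) = A"
proof -
  obtain f where f: "f \<in> sq_integrable M" "A = L2_class M f"
    using assms by (auto simp: L2_space_def L2_class_def elim: quotientE)
  show r: "L2_rep A \<in> sq_integrable M" using f L2_rep_class by blast
  have "(L2_rep A, f) \<in> ae_eq M"
    using f r L2_rep_class[OF f(1)] by (simp add: ae_eq_def)
  then show "L2_class M (L2_rep A) = A"
    unfolding f(2) L2_class_def by (metis equiv_ae_eq equiv_class_eq)
qed

lemma L2_class_eq_iff:
  assumes "f \<in> sq_integrable M" "g \<in> sq_integrable M"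
  shows "L2_class M f = L2_class M g \<longleftrightarrow> (AE x in M. f x = g x)"
  unfolding L2_class_def using assms
  by (auto simp: equiv_class_eq_iff[OF equiv_ae_eq] eq_equiv_class_iff[OF equiv_ae_eq] ae_eq_def)

lemma L2_inner_class:
  assumes "f \<in> sq_integrable M" "g \<in> sq_integrable M"
  shows "L2_inner M (L2_class M f) (L2_class M g) = (\<integral>x. f x * g x \<partial>M)"
  unfolding L2_inner_def
proof (rule integral_cong_AE)
  show "AE x in M. L2_rep (L2_class M f) x * L2_rep (L2_class M g) x = f x * g x"
    using L2_rep_class(2)[OF assms(1)] L2_rep_class(2)[OF assms(2)] by eventually_elim simp
  show "(\<lambda>x. L2_rep (L2_class M f) x * L2_rep (L2_class M g) x) \<in> borel_measurable M"
    using L2_rep_class(1)[OF assms(1)] L2_rep_class(1)[OF assms(2)] by (auto simp: sq_integrable_def)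
  show "(\<lambda>x. f x * g x) \<in> borel_measurable M"
    using assms by (auto simp: sq_integrable_def)
qed

lemma L2_dist_class:
  assumes "f \<in> sq_integrable M" "g \<in> sq_integrable M"
  shows "L2_dist M (L2_class M f) (L2_class M g) = sqrt (\<integral>x. (f x - g x)\<^sup>2 \<partial>M)"
  unfolding L2_dist_def
proof (rule arg_cong[where f = sqrt], rule integral_cong_AE)
  show "AE x in M. (L2_rep (L2_class M f) x - L2_rep (L2_class M g) x)\<^sup>2 = (f x - g x)\<^sup>2"
    using L2_rep_class(2)[OF assms(1)] L2_rep_class(2)[OF assms(2)] by eventually_elim simp
  show "(\<lambda>x. (L2_rep (L2_class M f) x - L2_rep (L2_class M g) x)\<^sup>2) \<in> borel_measurable M"
    using sq_integrable_diff[OF L2_rep_class(1)[OF assms(1)] L2_rep_class(1)[OF assms(2)]]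
    by (auto simp: sq_integrable_def)
  show "(\<lambda>x. (f x - g x)\<^sup>2) \<in> borel_measurable M"
    using sq_integrable_diff[OF assms] by (auto simp: sq_integrable_def)
qed

lemma sq_integrable_eq_0:
  assumes "f \<in> sq_integrable M" "(\<integral>x. (f x)\<^sup>2 \<partial>M) = 0"
  shows "AE x in M. f x = 0"
  using assms integral_nonneg_eq_0_iff_AE[of M "\<lambda>x. (f x)\<^sup>2"]
  by (auto simp: sq_integrable_def)

lemma sq_integrable_Cauchy_Schwarz:
  assumes f: "f \<in> sq_integrable M" and g: "g \<in> sq_integrable M"
  shows "(\<integral>x. f x * g x \<partial>M) \<le> sqrt (\<integral>x. (f x)\<^sup>2 \<partial>M) * sqrt (\<integral>x. (g x)\<^sup>2 \<partial>M)"
proof -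
  define a where "a = sqrt (\<integral>x. (f x)\<^sup>2 \<partial>M)"
  define b where "b = sqrt (\<integral>x. (g x)\<^sup>2 \<partial>M)"
  have a2: "(\<integral>x. (f x)\<^sup>2 \<partial>M) = a\<^sup>2" and b2: "(\<integral>x. (g x)\<^sup>2 \<partial>M) = b\<^sup>2"
    by (simp_all add: a_def b_def)
  have ab: "a \<ge> 0" "b \<ge> 0" by (simp_all add: a_def b_def)
  have int: "integrable M (\<lambda>x. (f x)\<^sup>2)" "integrable M (\<lambda>x. (g x)\<^sup>2)"
    "integrable M (\<lambda>x. f x * g x)"
    using f g sq_integrable_mult[OF f g] by (auto simp: sq_integrable_def)
  consider "a = 0" | "b = 0" | "a * b > 0"
    using ab by (cases "a = 0"; cases "b = 0") (auto simp: mult_pos_pos)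
  then have "(\<integral>x. f x * g x \<partial>M) \<le> a * b"
  proof cases
    case 1
    then have "AE x in M. f x = 0" using f a2 sq_integrable_eq_0 by auto
    then have "AE x in M. f x * g x = 0" by eventually_elim simp
    then have "(\<integral>x. f x * g x \<partial>M) = 0" by (rule integral_eq_zero_AE)
    with 1 show ?thesis by simp
  next
    case 2
    then have "AE x in M. g x = 0" using g b2 sq_integrable_eq_0 by auto
    then have "AE x in M. f x * g x = 0" by eventually_elim simp
    then have "(\<integral>x. f x * g x \<partial>M) = 0" by (rule integral_eq_zero_AE)
    with 2 show ?thesis by simp
  next
    case 3
    have "0 \<le> (\<integral>x. (b * f x - a * g x)\<^sup>2 \<partial>M)" by simp
    also have "\<dots> = (\<integral>x. (b\<^sup>2 * (f x)\<^sup>2 + a\<^sup>2 * (g x)\<^sup>2) - (2 * (a * b)) * (f x * g x) \<partial>M)"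
      by (rule Bochner_Integration.integral_cong) (simp_all add: power2_eq_square algebra_simps)
    also have "\<dots> = b\<^sup>2 * a\<^sup>2 + a\<^sup>2 * b\<^sup>2 - (2 * (a * b)) * (\<integral>x. f x * g x \<partial>M)"
      using int by (simp add: a2 b2)
    finally have "(2 * (a * b)) * (\<integral>x. f x * g x \<partial>M) \<le> (2 * (a * b)) * (a * b)"
      by (simp add: power2_eq_square algebra_simps)
    then show ?thesis using 3 by (simp add: mult_le_cancel_left_pos)
  qed
  then show ?thesis by (simp add: a_def b_def)
qed

lemma Metric_space_L2: "Metric_space (L2_space M) (L2_dist M)"
proof
  show "0 \<le> L2_dist M A B" for A B
    by (simp add: L2_dist_def)
  show "L2_dist M A B = L2_dist M B A" for A B
    by (simp add: L2_dist_def power2_commute)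
  show "L2_dist M A B = 0 \<longleftrightarrow> A = B" if AB: "A \<in> L2_space M" "B \<in> L2_space M" for A B
  proof
    assume "L2_dist M A B = 0"
    then have "AE x in M. L2_rep A x - L2_rep B x = 0"
      using AB[THEN L2_rep_space(1)]
      by (intro sq_integrable_eq_0[OF sq_integrable_diff]) (auto simp: L2_dist_def)
    then have "L2_class M (L2_rep A) = L2_class M (L2_rep B)"
      using AB[THEN L2_rep_space(1)] by (simp add: L2_class_eq_iff)
    then show "A = B" using AB by (simp add: L2_rep_space(2))
  qed (simp add: L2_dist_def)
  show "L2_dist M A C \<le> L2_dist M A B + L2_dist M B C"
    if ABC: "A \<in> L2_space M" "B \<in> L2_space M" "C \<in> L2_space M" for A B C
  proof -
    define u where "u = (\<lambda>x. L2_rep A x - L2_rep B x)"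
    define v where "v = (\<lambda>x. L2_rep B x - L2_rep C x)"
    have uv: "u \<in> sq_integrable M" "v \<in> sq_integrable M"
      unfolding u_def v_def using ABC[THEN L2_rep_space(1)] by (auto intro: sq_integrable_diff)
    define a where "a = L2_dist M A B"
    define b where "b = L2_dist M B C"
    have ab: "a = sqrt (\<integral>x. (u x)\<^sup>2 \<partial>M)" "b = sqrt (\<integral>x. (v x)\<^sup>2 \<partial>M)"
      by (simp_all add: a_def b_def u_def v_def L2_dist_def)
    have "(\<integral>x. (L2_rep A x - L2_rep C x)\<^sup>2 \<partial>M) = (\<integral>x. (u x)\<^sup>2 + (v x)\<^sup>2 + 2 * (u x * v x) \<partial>M)"
      by (rule Bochner_Integration.integral_cong)
         (simp_all add: u_def v_def power2_eq_square algebra_simps)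
    also have "\<dots> = a\<^sup>2 + b\<^sup>2 + 2 * (\<integral>x. u x * v x \<partial>M)"
      using uv sq_integrable_mult[OF uv] by (simp add: ab sq_integrable_def)
    also have "\<dots> \<le> (a + b)\<^sup>2"
      using sq_integrable_Cauchy_Schwarz[OF uv] by (simp add: ab power2_sum)
    finally have "L2_dist M A C \<le> sqrt ((a + b)\<^sup>2)"
      unfolding L2_dist_def by (rule real_sqrt_le_mono)
    also have "\<dots> = a + b" by (simp add: ab)
    finally show ?thesis by (simp add: a_def b_def)
  qed
qed


section \<open>Random elements, convergence in distribution, Gaussian elements\<close>

definition borel_of_topology :: "'a topology \<Rightarrow> 'a measure" where
  "borel_of_topology T = sigma (topspace T) {U. openin T U}"

text \<open>The random elements may live on different probability spaces.\<close>

definition converges_in_distribution ::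
    "'b topology \<Rightarrow> 'w measure \<Rightarrow> (nat \<Rightarrow> 'w \<Rightarrow> 'b) \<Rightarrow> 'v measure \<Rightarrow> ('v \<Rightarrow> 'b) \<Rightarrow> bool" where
  "converges_in_distribution T P Z Q W \<longleftrightarrow>
     (\<forall>F. continuous_map T euclideanreal F \<and> bounded (F ` topspace T) \<longrightarrow>
        (\<lambda>n. \<integral>\<omega>. F (Z n \<omega>) \<partial>P) \<longlonglongrightarrow> (\<integral>\<omega>. F (W \<omega>) \<partial>Q))"

text \<open>The second disjunct is the degenerate case of variance zero.\<close>

definition centred_normal :: "'v measure \<Rightarrow> ('v \<Rightarrow> real) \<Rightarrow> bool" where
  "centred_normal Q Z \<longleftrightarrow> Z \<in> borel_measurable Q \<and>
     ((\<exists>\<tau>>0. distributed Q lborel Z (\<lambda>x. ennreal (normal_density 0 \<tau> x))) \<or> (AE \<omega> in Q. Z \<omega> = 0))"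

definition centred_gaussian_element ::
    "'v measure \<Rightarrow> 'a measure \<Rightarrow> ('v \<Rightarrow> ('a \<Rightarrow> real) set) \<Rightarrow> bool" where
  "centred_gaussian_element Q M W \<longleftrightarrow>
     W \<in> Q \<rightarrow>\<^sub>M borel_of_topology (L2_topology M) \<and>
     (\<forall>A\<in>L2_space M. centred_normal Q (\<lambda>\<omega>. L2_inner M (W \<omega>) A))"

text \<open>
  Integrability on the product space is required so that the iterated integral is a genuine
  double integral and never the default value of the integral of a non-integrable function.
\<close>

definition has_covariance_kernel ::
    "'v measure \<Rightarrow> 'a measure \<Rightarrow> ('v \<Rightarrow> ('a \<Rightarrow> real) set) \<Rightarrow> ('a \<Rightarrow> 'a \<Rightarrow> real) \<Rightarrow> bool" where
  "has_covariance_kernel Q M W K \<longleftrightarrow>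
     (\<forall>f\<in>sq_integrable M. \<forall>g\<in>sq_integrable M.
        integrable (M \<Otimes>\<^sub>M M) (\<lambda>(s, t). K s t * f s * g t) \<and>
        (\<integral>\<omega>. L2_inner M (W \<omega>) (L2_class M f) * L2_inner M (W \<omega>) (L2_class M g) \<partial>Q) =
        (\<integral>s. (\<integral>t. K s t * f s * g t \<partial>M) \<partial>M))"


section \<open>The empirical moment generating function process\<close>

text \<open>The sample is \<open>X 1, \<dots>, X n\<close>; the value \<open>X 0\<close> is never used.\<close>

definition sample_mean :: "(nat \<Rightarrow> 'w \<Rightarrow> real) \<Rightarrow> nat \<Rightarrow> 'w \<Rightarrow> real" where
  "sample_mean X n \<omega> = (\<Sum>j=1..n. X j \<omega>) / real n"

definition sample_sd :: "(nat \<Rightarrow> 'w \<Rightarrow> real) \<Rightarrow> nat \<Rightarrow> 'w \<Rightarrow> real" where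
  "sample_sd X n \<omega> = sqrt ((\<Sum>j=1..n. (X j \<omega> - sample_mean X n \<omega>)\<^sup>2) / real n)"

text \<open>
  On the event that the sample standard deviation vanishes (a null event for \<open>n \<ge> 2\<close>)
  the residuals are \<open>0\<close> by the convention for division by zero.
\<close>

definition scaled_residual :: "(nat \<Rightarrow> 'w \<Rightarrow> real) \<Rightarrow> nat \<Rightarrow> nat \<Rightarrow> 'w \<Rightarrow> real" where
  "scaled_residual X n j \<omega> = (X j \<omega> - sample_mean X n \<omega>) / sample_sd X n \<omega>"

definition empirical_mgf :: "(nat \<Rightarrow> 'w \<Rightarrow> real) \<Rightarrow> nat \<Rightarrow> 'w \<Rightarrow> real \<Rightarrow> real" where
  "empirical_mgf X n \<omega> t = (\<Sum>j=1..n. exp (t * scaled_residual X n j \<omega>)) / real n"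

definition mgf_process :: "(nat \<Rightarrow> 'w \<Rightarrow> real) \<Rightarrow> nat \<Rightarrow> 'w \<Rightarrow> real \<Rightarrow> real" where
  "mgf_process X n \<omega> t = sqrt (real n) * (empirical_mgf X n \<omega> t - exp (t\<^sup>2 / 2))"

definition weighted_lborel :: "real \<Rightarrow> real measure" where
  "weighted_lborel \<beta> = density lborel (\<lambda>t. ennreal (exp (- \<beta> * t\<^sup>2)))"

definition limit_kernel :: "real \<Rightarrow> real \<Rightarrow> real" where
  "limit_kernel s t = exp ((t\<^sup>2 + s\<^sup>2) / 2) * (exp (t * s) - 1 - t * s - t\<^sup>2 * s\<^sup>2 / 2)"

end

theory Submission
  imports Defs
begin

text \<open>
  Standardize the sample to \<open>Z\<^sub>j = (X\<^sub>j - \<mu>) / \<sigma>\<close> and write \<open>h\<^sub>i = He\<^sub>i / sqrt (i!)\<close> for the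
  orthonormal Hermite polynomials. Their generating function turns the centred empirical moment
  generating function of the \<open>Z\<^sub>j\<close> into the series \<open>\<Sum>\<^sub>i \<xi>\<^sub>n\<^sub>i \<phi>\<^sub>i\<close>, where \<open>\<xi>\<^sub>n\<^sub>i = (\<Sum>\<^sub>j h\<^sub>i(Z\<^sub>j)) / sqrt n\<close>
  and \<open>\<phi>\<^sub>i(t) = exp (t\<^sup>2 / 2) t\<^sup>i / sqrt (i!)\<close>. Replacing the \<open>Z\<^sub>j\<close> by the residuals removes the terms
  \<open>i = 1, 2\<close> up to an error of order \<open>1 / sqrt n\<close>, and the limit is \<open>W = \<Sum>i\<ge>3. x\<^sub>i \<phi>\<^sub>i\<close> with independent
  standard normal \<open>x\<^sub>i\<close>; indeed the kernel is \<open>\<Sum>i\<ge>3. \<phi>\<^sub>i(s) \<phi>\<^sub>i(t)\<close>.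

  All estimates are pointwise in \<open>t\<close> and deterministic on the event \<open>\<Sum>\<^sub>i \<lambda>\<^sup>-\<^sup>i \<xi>\<^sub>n\<^sub>i\<^sup>2 \<le> M\<close>, whose
  complement has probability \<open>O(1/M)\<close> uniformly in \<open>n\<close>: by the Cauchy-Schwarz inequality tails of
  the series and the effect of estimating mean and variance are small multiples of
  \<open>exp (\<rho> t\<^sup>2 / 2)\<close> with \<open>2 < \<rho> < \<beta>\<close>, which lies in the weighted space. This is where
  \<open>\<beta> > 2\<close> is used, with \<open>\<lambda> > 1\<close> close to \<open>1\<close>. What is left is the central limit theorem
  for finitely many of the \<open>\<xi>\<^sub>n\<^sub>i\<close>.
\<close>

section \<open>Convergence in distribution in metric spaces\<close>

text \<open>Residuals are dependent, so no limit theorem applies to them directly. Dependence is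
  removed by algebra: they are an affine image of the \<open>Z j\<close>, so their process at
  \<open>t\<close> is the process of the independent sample at a rescaled argument
  \<open>t * b\<close>, plus a term that sees the sample only through its mean and variance. The
  linearization of that term is exactly minus the contributions of the indices 1 and 2, which is why
  these vanish from the kernel. The price is that rescaling multiplies the summand with index
  \<open>i\<close> by \<open>b ^ i\<close>, a distortion that is not small uniformly in
  \<open>i\<close>; geometric weights absorb it, at the cost of an exponent that tends to 2 as
  \<open>lam\<close> tends to 1. The passage to the limit in infinite dimension uses no tightness
  theorem: it suffices to test with Lipschitz functionals, and for these a truncation that is close
  in distance outside an event of small probability changes expectations little. The truncated
  functional is a continuous function of finitely many coefficients.\<close>

lemma space_borel_of_topology [simp]: "space (borel_of_topology T) = topspace T"
  unfolding borel_of_topology_def by (rule space_measure_of) (auto dest: openin_subset)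

lemma sets_borel_of_topology_openin: "openin T U \<Longrightarrow> U \<in> sets (borel_of_topology T)"
  unfolding borel_of_topology_def by (subst sets_measure_of) (auto dest: openin_subset)

lemma measurable_borel_of_topologyI:
  assumes "\<And>x. x \<in> space N \<Longrightarrow> f x \<in> topspace T"
    and "\<And>U. openin T U \<Longrightarrow> f -` U \<inter> space N \<in> sets N"
  shows "f \<in> N \<rightarrow>\<^sub>M borel_of_topology T"
  unfolding borel_of_topology_def
  by (rule measurable_measure_of) (use assms in \<open>auto dest: openin_subset\<close>)

lemma borel_measurable_continuous_map:
  fixes F :: "'b \<Rightarrow> real"
  assumes "f \<in> N \<rightarrow>\<^sub>M borel_of_topology T" "continuous_map T euclideanreal F"
  shows "(\<lambda>x. F (f x)) \<in> borel_measurable N"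
proof (rule borel_measurableI)
  fix S :: "real set" assume "open S"
  then have "openin T {x \<in> topspace T. F x \<in> S}"
    using assms(2) by (simp add: continuous_map_def)
  then have "f -` {x \<in> topspace T. F x \<in> S} \<inter> space N \<in> sets N"
    using assms(1) sets_borel_of_topology_openin by (blast intro: measurable_sets)
  moreover have "f -` {x \<in> topspace T. F x \<in> S} \<inter> space N = (\<lambda>x. F (f x)) -` S \<inter> space N"
    using measurable_space[OF assms(1)] by auto
  ultimately show "(\<lambda>x. F (f x)) -` S \<inter> space N \<in> sets N" by simp
qed

lemma measurable_continuous_map_borel:
  fixes g :: "'b::topological_space \<Rightarrow> 'c"
  assumes "f \<in> borel_measurable N" "continuous_map euclidean T g"
  shows "(\<lambda>x. g (f x)) \<in> N \<rightarrow>\<^sub>M borel_of_topology T"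
proof (rule measurable_borel_of_topologyI)
  show "g (f x) \<in> topspace T" for x
    using assms(2) by (auto simp: continuous_map_def)
  fix U assume "openin T U"
  then have "openin euclidean {y \<in> topspace euclidean. g y \<in> U}"
    using assms(2) unfolding continuous_map_def by blast
  then have "open {y. g y \<in> U}" by simp
  then have "f -` {y. g y \<in> U} \<inter> space N \<in> sets N"
    using measurable_sets[OF assms(1), of "{y. g y \<in> U}"] by simp
  then show "(\<lambda>x. g (f x)) -` U \<inter> space N \<in> sets N"
    by (simp add: vimage_def)
qed

section \<open>Lipschitz test functions and measurability of limits\<close>

context Metric_space begin

lemma continuous_map_lipschitz:
  assumes "\<And>x y. x \<in> M \<Longrightarrow> y \<in> M \<Longrightarrow> \<bar>F x - F y\<bar> \<le> L * d x y"
  shows "continuous_map mtopology euclideanreal F"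
  unfolding continuous_map_from_metric
proof (intro conjI ballI allI impI)
  fix a U assume a: "a \<in> M" and U: "openin euclideanreal U \<and> F a \<in> U"
  then obtain e where e: "e > 0" "ball (F a) e \<subseteq> U"
    using open_contains_ball[of U] by auto
  show "\<exists>r>0. \<forall>x. x \<in> M \<and> d a x < r \<longrightarrow> F x \<in> U"
  \<comment> \<open>Adding 1 keeps the radius well defined when \<open>L = 0\<close>; the absolute
    value covers negative \<open>L\<close>.\<close>
  proof (intro exI[of _ "e / (\<bar>L\<bar> + 1)"] conjI allI impI)
    show "0 < e / (\<bar>L\<bar> + 1)" using e by simp
    fix x assume x: "x \<in> M \<and> d a x < e / (\<bar>L\<bar> + 1)"
    have "\<bar>F a - F x\<bar> \<le> L * d a x" using assms a x by blast
    also have "\<dots> \<le> (\<bar>L\<bar> + 1) * d a x" by (intro mult_right_mono) auto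
    also have "\<dots> < e" using x by (simp add: field_simps)
    finally show "F x \<in> U" using e(2) by (auto simp: dist_real_def)
  qed
qed simp

text \<open>The infimal convolution of \<open>F\<close> with \<open>real k * d\<close>: for
  \<open>F\<close> bounded below it is the largest \<open>k\<close>-Lipschitz function below
  \<open>F\<close>.\<close>

definition lipschitz_minorant :: "('a \<Rightarrow> real) \<Rightarrow> nat \<Rightarrow> 'a \<Rightarrow> real" where
  "lipschitz_minorant F k x = (INF y\<in>M. F y + real k * d x y)"

text \<open>By the triangle inequality an infimum of \<open>k\<close>-Lipschitz functions is taken;
  nonnegativity of \<open>F\<close> keeps the infima bounded below.\<close>

lemma lipschitz_minorant:
  assumes F0: "\<forall>x\<in>M. 0 \<le> F x" and x: "x \<in> M"
  shows "0 \<le> lipschitz_minorant F k x" "lipschitz_minorant F k x \<le> F x"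
    and "y \<in> M \<Longrightarrow> \<bar>lipschitz_minorant F k x - lipschitz_minorant F k y\<bar> \<le> real k * d x y"
proof -
  have bdd: "bdd_below ((\<lambda>y. F y + real k * d x y) ` M)" for x
    using F0 by (intro bdd_belowI2[where m = 0]) auto
  show "0 \<le> lipschitz_minorant F k x"
    unfolding lipschitz_minorant_def using x F0 by (intro cINF_greatest) auto
  show "lipschitz_minorant F k x \<le> F x"
    unfolding lipschitz_minorant_def using x by (intro cINF_lower2[OF bdd, of x]) auto
  have le: "lipschitz_minorant F k x - real k * d x y \<le> lipschitz_minorant F k y"
    if "x \<in> M" "y \<in> M" for x y
    unfolding lipschitz_minorant_def[of _ _ y]
  proof (rule cINF_greatest)
    show "M \<noteq> {}" using x by auto
    fix z assume z: "z \<in> M"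
    have "lipschitz_minorant F k x \<le> F z + real k * d x z"
      unfolding lipschitz_minorant_def using z by (intro cINF_lower[OF bdd])
    also have "\<dots> \<le> F z + real k * (d x y + d y z)"
      using triangle[of x y z] that z by (intro add_left_mono mult_left_mono) auto
    finally show "lipschitz_minorant F k x - real k * d x y \<le> F z + real k * d y z"
      by (simp add: algebra_simps)
  qed
  show "\<bar>lipschitz_minorant F k x - lipschitz_minorant F k y\<bar> \<le> real k * d x y" if "y \<in> M"
    using le[OF x that] le[OF that x] commute[of x y] by auto
qed

text \<open>Beyond distance \<open>F x / real k\<close> the penalty alone exceeds
  \<open>F x\<close>, so the infimum is decided within that shrinking radius, where continuity at
  \<open>x\<close> applies.\<close>

lemma lipschitz_minorant_tendsto:
  assumes F0: "\<forall>x\<in>M. 0 \<le> F x" and F: "continuous_map mtopology euclideanreal F"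
    and x: "x \<in> M"
  shows "(\<lambda>k. lipschitz_minorant F k x) \<longlonglongrightarrow> F x"
proof (rule tendsto_sandwich[OF _ _ _ tendsto_const])
  define e where "e k = F x / real k" for k
  show "\<forall>\<^sub>F k in sequentially. lipschitz_minorant F k x \<le> F x"
    using lipschitz_minorant(2)[where F = F, OF F0 x] by simp
  \<comment> \<open>The minimum with \<open>F x\<close> accounts for the points outside the
    radius.\<close>
  define L where "L k = min (F x) (INF y\<in>{y\<in>M. d x y \<le> e k}. F y)" for k
  have bdd: "bdd_below (F ` {y\<in>M. d x y \<le> r})" for r
    using F0 by (intro bdd_belowI2[where m = 0]) auto
  show "\<forall>\<^sub>F k in sequentially. L k \<le> lipschitz_minorant F k x"
    using eventually_gt_at_top[of 0]
  proof eventually_elim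
    case (elim k)
    show ?case unfolding lipschitz_minorant_def
    proof (rule cINF_greatest)
      show "M \<noteq> {}" using x by auto
      fix y assume y: "y \<in> M"
      show "L k \<le> F y + real k * d x y"
      proof (cases "d x y \<le> e k")
        case True
        then have "(INF y\<in>{y\<in>M. d x y \<le> e k}. F y) \<le> F y"
          using y by (intro cINF_lower[OF bdd]) auto
        then have "L k \<le> F y" by (simp add: L_def)
        moreover have "0 \<le> real k * d x y" by simp
        ultimately show ?thesis by linarith
      next
        case False
        then have "F x \<le> real k * d x y" using elim by (simp add: e_def field_simps)
        then have "F x \<le> F y + real k * d x y" using F0 y by force
        moreover have "L k \<le> F x" by (simp add: L_def)
        ultimately show ?thesis by linarith
      qed
    qed
  qed
  show "L \<longlonglongrightarrow> F x"
  proof (rule LIMSEQ_I)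
    fix r :: real assume r: "r > 0"
    have "openin euclideanreal (ball (F x) (r/2)) \<and> F x \<in> ball (F x) (r/2)" using r by simp
    moreover have "\<forall>U. openin euclideanreal U \<and> F x \<in> U \<longrightarrow> (\<exists>s>0. \<forall>y. y \<in> M \<and> d x y < s \<longrightarrow> F y \<in> U)"
      using F x unfolding continuous_map_from_metric by auto
    ultimately obtain s where s: "s > 0" "\<And>y. y \<in> M \<Longrightarrow> d x y < s \<Longrightarrow> F y \<in> ball (F x) (r/2)"
      by meson
    have "e \<longlonglongrightarrow> 0" unfolding e_def by (rule lim_const_over_n)
    then have "\<forall>\<^sub>F k in sequentially. e k < s" using s(1) by (rule order_tendstoD)
    then obtain K where K: "\<And>k. k \<ge> K \<Longrightarrow> e k < s" by (auto simp: eventually_sequentially)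
    show "\<exists>no. \<forall>n\<ge>no. norm (L n - F x) < r"
    proof (intro exI[of _ K] allI impI)
      fix k assume k: "k \<ge> K"
      have e0: "0 \<le> e k" using F0 x by (simp add: e_def)
      have "F x - r/2 \<le> (INF y\<in>{y\<in>M. d x y \<le> e k}. F y)"
      proof (rule cINF_greatest)
        show "{y\<in>M. d x y \<le> e k} \<noteq> {}" using x e0 by auto
        fix y assume "y \<in> {y\<in>M. d x y \<le> e k}"
        then have "F y \<in> ball (F x) (r/2)" using s(2) K[OF k] by force
        then have "\<bar>F x - F y\<bar> < r/2" unfolding mem_ball dist_real_def .
        then show "F x - r/2 \<le> F y" by linarith
      qed
      then have "F x - r/2 \<le> L k" using r by (simp add: L_def)
      moreover have "L k \<le> F x" by (simp add: L_def)
      ultimately show "norm (L k - F x) < r" using r by (simp add: abs_if)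
    qed
  qed
qed

text \<open>The Portmanteau argument: a nonnegative continuous function is the increasing limit of
  its Lipschitz minorants, which yields one inequality; the other one comes from \<open>B - F\<close>.\<close>

lemma converges_in_distribution_lipschitz:
  assumes "prob_space P" "prob_space Q"
    and Z: "\<And>n. n \<ge> n0 \<Longrightarrow> Z n \<in> P \<rightarrow>\<^sub>M borel_of_topology mtopology"
    and W: "W \<in> Q \<rightarrow>\<^sub>M borel_of_topology mtopology"
    and lip: "\<And>F L B. \<lbrakk>\<And>x. x \<in> M \<Longrightarrow> 0 \<le> F x \<and> F x \<le> B;
         \<And>x y. x \<in> M \<Longrightarrow> y \<in> M \<Longrightarrow> \<bar>F x - F y\<bar> \<le> L * d x y; L \<ge> 0\<rbrakk> \<Longrightarrow>
         (\<lambda>n. \<integral>\<omega>. F (Z n \<omega>) \<partial>P) \<longlonglongrightarrow> (\<integral>\<omega>. F (W \<omega>) \<partial>Q)"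
  shows "converges_in_distribution mtopology P Z Q W"
  unfolding converges_in_distribution_def
proof (intro allI impI, elim conjE)
  interpret P: prob_space P by fact
  interpret Q: prob_space Q by fact
  have Zs: "Z n \<omega> \<in> M" if "\<omega> \<in> space P" "n \<ge> n0" for n \<omega>
    using measurable_space[OF Z that(1)] that by simp
  have Ws: "W \<omega> \<in> M" if "\<omega> \<in> space Q" for \<omega>
    using measurable_space[OF W that] by simp
  have intP: "integrable P (\<lambda>\<omega>. F (Z n \<omega>))"
    if "n \<ge> n0" "continuous_map mtopology euclideanreal F" "\<And>x. x \<in> M \<Longrightarrow> \<bar>F x\<bar> \<le> B" for F B n
    using that Zs
    by (intro P.integrable_const_bound[where B = B] borel_measurable_continuous_map[OF Z])
       auto
  have intQ: "integrable Q (\<lambda>\<omega>. F (W \<omega>))"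
    if "continuous_map mtopology euclideanreal F" "\<And>x. x \<in> M \<Longrightarrow> \<bar>F x\<bar> \<le> B" for F B
    using that Ws
    by (intro Q.integrable_const_bound[where B = B] borel_measurable_continuous_map[OF W])
       auto
  \<comment> \<open>The lower half for nonnegative \<open>F\<close>: dominated convergence under
    \<open>W\<close> yields a minorant with loss below \<open>e\<close>, and \<open>lip\<close>
    applies to that minorant.\<close>
  have lower: "\<forall>\<^sub>F n in sequentially. (\<integral>\<omega>. F (W \<omega>) \<partial>Q) - e < (\<integral>\<omega>. F (Z n \<omega>) \<partial>P)"
    if F: "continuous_map mtopology euclideanreal F"
      and F0: "\<And>x. x \<in> M \<Longrightarrow> 0 \<le> F x \<and> F x \<le> B" and e: "e > 0" for F B e
  proof -
    let ?G = "lipschitz_minorant F"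
    have F0': "\<forall>x\<in>M. 0 \<le> F x" using F0 by auto
    note G = lipschitz_minorant[where F = F, OF F0']
    have Gc: "continuous_map mtopology euclideanreal (?G k)" for k
      using G(3) by (intro continuous_map_lipschitz)
    have Gb: "\<bar>?G k x\<bar> \<le> B" if "x \<in> M" for k x
      using G(1)[OF that, of k] G(2)[OF that, of k] F0[OF that] by linarith
    have "(\<lambda>k. \<integral>\<omega>. ?G k (W \<omega>) \<partial>Q) \<longlonglongrightarrow> (\<integral>\<omega>. F (W \<omega>) \<partial>Q)"
    proof (rule integral_dominated_convergence[where w = "\<lambda>_. B"])
      show "AE \<omega> in Q. (\<lambda>k. ?G k (W \<omega>)) \<longlonglongrightarrow> F (W \<omega>)"
        using lipschitz_minorant_tendsto[where F = F, OF F0' F Ws] by simp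
      show "AE \<omega> in Q. norm (?G k (W \<omega>)) \<le> B" for k
        using Gb Ws by simp
    qed (auto intro: borel_measurable_continuous_map[OF W] F Gc)
    then have "\<forall>\<^sub>F k in sequentially. (\<integral>\<omega>. F (W \<omega>) \<partial>Q) - e < (\<integral>\<omega>. ?G k (W \<omega>) \<partial>Q)"
      using e by (intro order_tendstoD(1)) auto
    then obtain k where k: "(\<integral>\<omega>. F (W \<omega>) \<partial>Q) - e < (\<integral>\<omega>. ?G k (W \<omega>) \<partial>Q)"
      by (auto simp: eventually_sequentially)
    have "(\<lambda>n. \<integral>\<omega>. ?G k (Z n \<omega>) \<partial>P) \<longlonglongrightarrow> (\<integral>\<omega>. ?G k (W \<omega>) \<partial>Q)"
    proof (rule lip)
      show "0 \<le> ?G k x \<and> ?G k x \<le> B" if "x \<in> M" for x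
        using G(1)[OF that, of k] Gb[OF that, of k] by linarith
    qed (use G(3) in auto)
    then have "\<forall>\<^sub>F n in sequentially. (\<integral>\<omega>. F (W \<omega>) \<partial>Q) - e < (\<integral>\<omega>. ?G k (Z n \<omega>) \<partial>P)"
      using k by (rule order_tendstoD(1))
    then show ?thesis using eventually_ge_at_top[of n0]
    proof eventually_elim
      case (elim n)
      have "(\<integral>\<omega>. ?G k (Z n \<omega>) \<partial>P) \<le> (\<integral>\<omega>. F (Z n \<omega>) \<partial>P)"
      proof (rule integral_mono)
        show "integrable P (\<lambda>\<omega>. ?G k (Z n \<omega>))"
          by (rule intP[OF elim(2) Gc]) (rule Gb)
        show "integrable P (\<lambda>\<omega>. F (Z n \<omega>))"
          by (rule intP[OF elim(2) F, of B]) (use F0 in fastforce)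
      qed (use elim(2) G(2) Zs in auto)
      with elim show ?case by simp
    qed
  qed
  fix F assume F: "continuous_map mtopology euclideanreal F" and "bounded (F ` topspace mtopology)"
  then obtain B where B: "\<And>x. x \<in> M \<Longrightarrow> \<bar>F x\<bar> \<le> B"
    by (auto simp: bounded_iff)
  let ?I = "\<lambda>n. \<integral>\<omega>. F (Z n \<omega>) \<partial>P" and ?J = "\<integral>\<omega>. F (W \<omega>) \<partial>Q"
  \<comment> \<open>Adding \<open>B\<close> makes the function nonnegative; the shift cancels at the
    end because both measures have mass 1.\<close>
  have lo: "\<forall>\<^sub>F n in sequentially. (\<integral>\<omega>. B + F (W \<omega>) \<partial>Q) - e < (\<integral>\<omega>. B + F (Z n \<omega>) \<partial>P)"
    if "e > 0" for e
  proof (rule lower[of "\<lambda>x. B + F x" "2 * B" e])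
    show "0 < e" by (rule that)
    show "0 \<le> B + F x \<and> B + F x \<le> 2 * B" if "x \<in> M" for x
      using B[OF that] by linarith
  qed (intro continuous_intros F)
  have up: "\<forall>\<^sub>F n in sequentially. (\<integral>\<omega>. B - F (W \<omega>) \<partial>Q) - e < (\<integral>\<omega>. B - F (Z n \<omega>) \<partial>P)"
    if "e > 0" for e
  proof (rule lower[of "\<lambda>x. B - F x" "2 * B" e])
    show "0 < e" by (rule that)
    show "0 \<le> B - F x \<and> B - F x \<le> 2 * B" if "x \<in> M" for x
      using B[OF that] by linarith
  qed (intro continuous_intros F)
  show "?I \<longlonglongrightarrow> ?J"
  proof (rule tendstoI)
    fix e :: real assume e: "e > 0"
    show "\<forall>\<^sub>F n in sequentially. dist (?I n) ?J < e"
      using lo[OF e] up[OF e] eventually_ge_at_top[of n0]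
    proof eventually_elim
      case (elim n)
      have int: "integrable Q (\<lambda>\<omega>. F (W \<omega>))" "integrable P (\<lambda>\<omega>. F (Z n \<omega>))"
        using intQ[of F B] intP[of n F B] F B elim(3) by blast+
      have "(\<integral>\<omega>. B + F (W \<omega>) \<partial>Q) = B + ?J" "(\<integral>\<omega>. B - F (W \<omega>) \<partial>Q) = B - ?J"
        using int(1) by (simp_all add: Q.prob_space)
      moreover have "(\<integral>\<omega>. B + F (Z n \<omega>) \<partial>P) = B + ?I n" "(\<integral>\<omega>. B - F (Z n \<omega>) \<partial>P) = B - ?I n"
        using int(2) by (simp_all add: P.prob_space)
      ultimately have "?J - e < ?I n" "?I n < ?J + e" using elim(1,2) by linarith+
      then show ?case unfolding dist_real_def by linarith
    qed
  qed
qed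

text \<open>A proper open set \<open>U\<close> is where the distance to its complement is nonzero.
  This distance is a 1-Lipschitz real function, so its composition with \<open>g\<close> is a
  pointwise limit of measurable real functions.\<close>

lemma measurable_limit:
  assumes f: "\<And>m. f m \<in> N \<rightarrow>\<^sub>M borel_of_topology mtopology"
    and g: "\<And>x. x \<in> space N \<Longrightarrow> g x \<in> M"
    and lim: "\<And>x. x \<in> space N \<Longrightarrow> (\<lambda>m. d (f m x) (g x)) \<longlonglongrightarrow> 0"
  shows "g \<in> N \<rightarrow>\<^sub>M borel_of_topology mtopology"
proof (rule measurable_borel_of_topologyI)
  show "g x \<in> topspace mtopology" if "x \<in> space N" for x using g that by simp
  fix U assume U: "openin mtopology U"
  have fM: "f m x \<in> M" if "x \<in> space N" for m x
    using measurable_space[OF f that] by simp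
  show "g -` U \<inter> space N \<in> sets N"
  \<comment> \<open>For \<open>U = M\<close> the infimum in \<open>D\<close> would range over the
    empty set.\<close>
  proof (cases "U = M")
    case True
    then have "g -` U \<inter> space N = space N" using g by auto
    then show ?thesis by simp
  next
    case False
    have UM: "U \<subseteq> M" using openin_subset[OF U] by simp
    define D where "D x = (INF y\<in>M - U. d x y)" for x
    have ne: "M - U \<noteq> {}" using False UM by auto
    have bdd: "bdd_below (d x ` (M - U))" for x by (intro bdd_belowI2[where m = 0]) auto
    have D1: "D x \<le> d x y + D y" if "x \<in> M" "y \<in> M" for x y
    proof -
      have "D x - d x y \<le> D y" unfolding D_def[of y]
      proof (rule cINF_greatest[OF ne])
        fix z assume z: "z \<in> M - U"
        have "D x \<le> d x z" unfolding D_def using z by (intro cINF_lower[OF bdd])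
        then show "D x - d x y \<le> d y z" using triangle[of x y z] that z by auto
      qed
      then show ?thesis by simp
    qed
    have D_lip: "\<bar>D x - D y\<bar> \<le> 1 * d x y" if "x \<in> M" "y \<in> M" for x y
      using D1[OF that] D1[OF that(2,1)] commute[of x y] by (simp add: abs_le_iff)
    have "(\<lambda>x. D (g x)) \<in> borel_measurable N"
    proof (rule borel_measurable_LIMSEQ_real)
      show "(\<lambda>x. D (f m x)) \<in> borel_measurable N" for m
        by (intro borel_measurable_continuous_map[OF f] continuous_map_lipschitz[OF D_lip])
      fix x assume x: "x \<in> space N"
      have "(\<lambda>m. D (f m x) - D (g x)) \<longlonglongrightarrow> 0"
        by (rule Lim_null_comparison[OF _ lim[OF x]])
           (use D_lip[OF fM[OF x] g[OF x]] in auto)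
      then show "(\<lambda>m. D (f m x)) \<longlonglongrightarrow> D (g x)" by (rule LIM_zero_cancel)
    qed
    then have "{x \<in> space N. D (g x) \<noteq> 0} \<in> sets N" by measurable
    moreover have "D y \<noteq> 0 \<longleftrightarrow> y \<in> U" if y: "y \<in> M" for y
    proof
      assume "D y \<noteq> 0"
      show "y \<in> U"
      proof (rule ccontr)
        assume "y \<notin> U"
        then have "D y \<le> d y y" unfolding D_def using y by (intro cINF_lower[OF bdd]) auto
        moreover have "0 \<le> D y" unfolding D_def by (rule cINF_greatest[OF ne]) auto
        ultimately show False using \<open>D y \<noteq> 0\<close> y by simp
      qed
    next
      assume "y \<in> U"
      then obtain r where r: "r > 0" "mball y r \<subseteq> U"
        using U unfolding openin_mtopology by blast
      have "r \<le> D y" unfolding D_def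
      proof (rule cINF_greatest[OF ne])
        fix z assume "z \<in> M - U"
        then show "r \<le> d y z" using r y by (force simp: subset_iff)
      qed
      then show "D y \<noteq> 0" using r by simp
    qed
    then have "{x \<in> space N. D (g x) \<noteq> 0} = g -` U \<inter> space N" using g by auto
    ultimately show ?thesis by simp
  qed
qed

end

section \<open>Hermite polynomials\<close>

text \<open>The coefficients of the power series of \<open>exp (- t\<^sup>2 / 2)\<close>.\<close>

fun hcoef :: "nat \<Rightarrow> real" where
  "hcoef 0 = 1"
| "hcoef (Suc 0) = 0"
| "hcoef (Suc (Suc n)) = - hcoef n / (real n + 2)"

text \<open>This is \<open>He\<^sub>n / n!\<close>, obtained as a Cauchy product.\<close>

definition herm :: "nat \<Rightarrow> real poly" where
  "herm n = (\<Sum>k\<le>n. monom (hcoef (n - k) / fact k) k)"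

lemma coeff_herm: "coeff (herm n) k = (if k \<le> n then hcoef (n - k) / fact k else 0)"
  by (simp add: herm_def coeff_sum)

lemma poly_herm: "poly (herm n) x = (\<Sum>k\<le>n. hcoef (n - k) / fact k * x ^ k)"
  by (simp add: herm_def poly_sum poly_monom)

lemma herm_0: "herm 0 = 1"
  by (simp add: herm_def monom_0 one_pCons)

lemma herm_1: "herm (Suc 0) = [:0, 1:]"
  by (simp add: herm_def monom_Suc monom_0)

text \<open>The rule that the derivative of He_(n+1) is (n + 1) He_n; dividing by the factorial
  removes the factor.\<close>

lemma pderiv_herm: "pderiv (herm (Suc n)) = herm n"
  by (rule poly_eqI) (simp add: coeff_pderiv coeff_herm divide_simps del: of_nat_Suc)

text \<open>The three-term recurrence He_(n+2) = x He_(n+1) - (n + 1) He_n, divided by (n + 1)!.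
  Coefficientwise it reduces to the recursion of \<open>hcoef\<close>.\<close>

lemma herm_Suc_Suc: "smult (real n + 2) (herm (Suc (Suc n))) = pCons 0 (herm (Suc n)) - herm n"
proof (rule poly_eqI)
  fix k
  have rec: "(real j + 2) * hcoef (Suc (Suc j)) = - hcoef j" for j
    by simp
  consider "k = 0" | l where "k = Suc l" "l < n" | "k = Suc n" | "k = Suc (Suc n)" | "k > Suc (Suc n)"
    by (cases k) force+
  then show "coeff (smult (real n + 2) (herm (Suc (Suc n)))) k = coeff (pCons 0 (herm (Suc n)) - herm n) k"
  proof cases
    case 1
    then show ?thesis by (simp add: coeff_herm)
  next
    case 2
    define j where "j = n - k"
    have j: "n = j + Suc l" using 2 by (simp add: j_def)
    have "(real j + real l + 3) * hcoef (Suc (Suc j)) = (real l + 1) * hcoef (Suc (Suc j)) - hcoef j"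
      using rec[of j] by (simp add: algebra_simps del: hcoef.simps)
    then have "(real j + real l + 3) * hcoef (Suc (Suc j)) / ((real l + 1) * fact l) =
        ((real l + 1) * hcoef (Suc (Suc j)) - hcoef j) / ((real l + 1) * fact l)"
      by (simp only:)
    also have "\<dots> = hcoef (Suc (Suc j)) / fact l - hcoef j / ((real l + 1) * fact l)"
      by (simp add: diff_divide_distrib del: hcoef.simps)
    finally show ?thesis using 2
      by (simp add: coeff_herm j Suc_diff_le add_ac del: hcoef.simps)
  next
    case 3
    then show ?thesis by (simp add: coeff_herm)
  next
    case 4
    then show ?thesis by (simp add: coeff_herm divide_simps)
  next
    case 5
    then obtain l where "k = Suc l" by (cases k) auto
    with 5 show ?thesis by (simp add: coeff_herm)
  qed
qed

text \<open>An exponential series with interleaved zeros. The general \<open>f\<close> serves both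
  the signed series and the series of absolute values.\<close>

lemma hcoef_sums_aux:
  fixes c :: real
  assumes "\<And>l. f (2 * l) = c ^ l / fact l" "\<And>l. f (Suc (2 * l)) = 0"
  shows "f sums exp c"
proof -
  have "(\<lambda>l. c ^ l / fact l) sums exp c"
    using exp_converges[of c] by (simp add: divide_inverse_commute)
  from sums_if[OF sums_zero this]
  have "(\<lambda>n. if even n then c ^ (n div 2) / fact (n div 2) else 0) sums exp c" by simp
  moreover have "f n = (if even n then c ^ (n div 2) / fact (n div 2) else 0)" for n
    using assms(1)[of "n div 2"] assms(2)[of "n div 2"] by (cases "even n") auto
  ultimately show ?thesis by presburger
qed

lemma hcoef_even_odd: "hcoef (2 * l) = (- 1 / 2) ^ l / fact l" "hcoef (Suc (2 * l)) = 0"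
proof (induction l)
  case (Suc l)
  {
    case 1
    have "hcoef (2 * Suc l) = - ((- 1 / 2) ^ l / fact l) / (2 * (real l + 1))"
      using Suc.IH(1) by simp
    also have "\<dots> = (- 1 / 2) ^ Suc l / fact (Suc l)"
      by (simp add: divide_simps)
    finally show ?case .
  next
    case 2
    show ?case using Suc.IH(2) by simp
  }
qed simp_all

lemma hcoef_sums: "(\<lambda>j. hcoef j * t ^ j) sums exp (- t\<^sup>2 / 2)"
proof (rule hcoef_sums_aux)
  show "hcoef (2 * l) * t ^ (2 * l) = (- t\<^sup>2 / 2) ^ l / fact l" for l
  proof -
    have "(- t\<^sup>2 / 2) ^ l = (- 1 / 2) ^ l * (t\<^sup>2) ^ l"
      by (subst power_mult_distrib [symmetric]) simp
    then show ?thesis by (simp add: hcoef_even_odd power_mult)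
  qed
qed (simp add: hcoef_even_odd)

text \<open>Supplies the absolute convergence that the Cauchy product in
  \<open>herm_generating\<close> requires.\<close>

lemma hcoef_abs_sums: "(\<lambda>j. \<bar>hcoef j * t ^ j\<bar>) sums exp (t\<^sup>2 / 2)"
proof (rule hcoef_sums_aux)
  show "\<bar>hcoef (2 * l) * t ^ (2 * l)\<bar> = (t\<^sup>2 / 2) ^ l / fact l" for l
    by (simp add: hcoef_even_odd power_mult abs_mult power_abs power_divide)
qed (simp add: hcoef_even_odd)

lemma herm_generating: "(\<lambda>n. poly (herm n) x * t ^ n) sums exp (t * x - t\<^sup>2 / 2)"
proof -
  have exp: "(\<lambda>i. (t * x) ^ i / fact i) sums exp (t * x)"
    using exp_converges[of "t * x"] by (simp add: divide_inverse_commute)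
  have "summable (\<lambda>i. norm ((t * x) ^ i / fact i))"
    using summable_norm_exp[of "t * x"] by (simp add: divide_inverse_commute)
  from Cauchy_product_sums[OF this, of "\<lambda>j. hcoef j * t ^ j"]
  have "(\<lambda>n. \<Sum>i\<le>n. (t * x) ^ i / fact i * (hcoef (n - i) * t ^ (n - i))) sums
      (exp (t * x) * exp (- t\<^sup>2 / 2))"
    using hcoef_abs_sums[of t] exp hcoef_sums[of t] by (simp add: sums_iff)
  moreover have "(\<Sum>i\<le>n. (t * x) ^ i / fact i * (hcoef (n - i) * t ^ (n - i))) =
      poly (herm n) x * t ^ n" for n
    unfolding poly_herm sum_distrib_right
  proof (rule sum.cong)
    fix i assume "i \<in> {..n}"
    then have "t ^ n = t ^ i * t ^ (n - i)" by (simp flip: power_add)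
    then show "(t * x) ^ i / fact i * (hcoef (n - i) * t ^ (n - i)) =
        hcoef (n - i) / fact i * x ^ i * t ^ n"
      by (simp add: power_mult_distrib)
  qed simp
  moreover have "exp (t * x) * exp (- t\<^sup>2 / 2) = exp (t * x - t\<^sup>2 / 2)"
    by (simp flip: exp_add)
  ultimately show ?thesis by simp
qed

section \<open>Gaussian moments, Stein's identity and orthogonality\<close>

definition gexp :: "(real \<Rightarrow> real) \<Rightarrow> real" where
  "gexp f = (\<integral>x. std_normal_density x * f x \<partial>lborel)"

text \<open>The recursion is Gaussian integration by parts for monomials, read off from the closed
  forms of the even and odd moments.\<close>

lemma std_normal_moment:
  "integrable lborel (\<lambda>x. std_normal_density x * x ^ k)"
  "gexp (\<lambda>x. x ^ (k + 2)) = real (k + 1) * gexp (\<lambda>x. x ^ k)"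
proof -
  have even: "has_bochner_integral lborel (\<lambda>x. std_normal_density x * x ^ (2 * l)) (fact (2 * l) / (2 ^ l * fact l))" for l
    by (rule std_normal_moment_even)
  have odd: "has_bochner_integral lborel (\<lambda>x. std_normal_density x * x ^ (2 * l + 1)) 0" for l
    by (rule std_normal_moment_odd)
  show "integrable lborel (\<lambda>x. std_normal_density x * x ^ k)"
    using even[of "k div 2"] odd[of "k div 2"] by (cases "even k") (auto simp: has_bochner_integral_iff)
  show "gexp (\<lambda>x. x ^ (k + 2)) = real (k + 1) * gexp (\<lambda>x. x ^ k)"
  proof (cases "even k")
    case True
    then obtain l where l: "k = 2 * l" by (elim evenE)
    have "gexp (\<lambda>x. x ^ (2 * Suc l)) = fact (2 * Suc l) / (2 ^ Suc l * fact (Suc l))"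
      unfolding gexp_def using even[of "Suc l"] by (simp only: has_bochner_integral_iff)
    moreover have "gexp (\<lambda>x. x ^ (2 * l)) = fact (2 * l) / (2 ^ l * fact l)"
      unfolding gexp_def using even[of l] by (simp only: has_bochner_integral_iff)
    moreover have "(fact (2 * Suc l) / (2 ^ Suc l * fact (Suc l)) :: real) =
        (2 * real l + 1) * (fact (2 * l) / (2 ^ l * fact l))"
      by (simp add: divide_simps)
    ultimately show ?thesis unfolding l by (simp add: add_ac)
  next
    case False
    then obtain l where l: "k = 2 * l + 1" by (elim oddE)
    have "gexp (\<lambda>x. x ^ (2 * Suc l + 1)) = 0" "gexp (\<lambda>x. x ^ (2 * l + 1)) = 0"
      unfolding gexp_def using odd[of l] odd[of "Suc l"] by (simp_all only: has_bochner_integral_iff)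
    then show ?thesis unfolding l by simp
  qed
qed

lemma gexp_poly_integrable: "integrable lborel (\<lambda>x. std_normal_density x * poly p x)"
proof -
  have "integrable lborel (\<lambda>x. \<Sum>i\<le>degree p. coeff p i * (std_normal_density x * x ^ i))"
    by (intro Bochner_Integration.integrable_sum integrable_mult_right std_normal_moment)
  then show ?thesis by (simp add: poly_altdef sum_distrib_left mult_ac)
qed

lemma gexp_poly_add: "gexp (poly (p + q)) = gexp (poly p) + gexp (poly q)"
  unfolding gexp_def
  by (subst Bochner_Integration.integral_add [symmetric])
     (simp_all add: gexp_poly_integrable distrib_left)

lemma gexp_poly_smult: "gexp (poly (smult c p)) = c * gexp (poly p)"
  unfolding gexp_def by (simp add: mult.left_commute)

lemma gexp_poly_diff: "gexp (poly (p - q)) = gexp (poly p) - gexp (poly q)"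
  using gexp_poly_add[of p "smult (-1) q"] gexp_poly_smult[of "-1" q] by simp

lemma gexp_poly_sum: "gexp (poly (\<Sum>i\<in>A. f i)) = (\<Sum>i\<in>A. gexp (poly (f i)))"
proof (induction A rule: infinite_finite_induct)
  case (insert x F)
  then show ?case by (simp add: gexp_poly_add del: poly_add)
qed (auto simp: gexp_def)

lemma gexp_1: "gexp (poly 1) = 1"
  using std_normal_moment_even[of 0] by (simp add: gexp_def has_bochner_integral_iff)

lemma gexp_stein_monom: "gexp (poly (pCons 0 (monom c k))) = gexp (poly (pderiv (monom c k)))"
proof (cases k)
  case 0
  have "gexp (\<lambda>x. x) = 0"
    using std_normal_moment_odd[of 0] by (simp add: gexp_def has_bochner_integral_iff)
  then show ?thesis using gexp_poly_smult[of c "[:0, 1:]"] 0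
    by (simp add: gexp_def monom_0 mult_ac)
next
  case (Suc l)
  have pm: "poly (monom (1::real) n) = (\<lambda>x. x ^ n)" for n :: nat
    by (simp add: fun_eq_iff poly_monom)
  have "pCons 0 (monom c k) = smult c (monom 1 (l + 2))"
    by (simp add: Suc monom_Suc smult_monom)
  then have "gexp (poly (pCons 0 (monom c k))) = c * gexp (\<lambda>x. x ^ (l + 2))"
    by (simp only: gexp_poly_smult pm)
  also have "\<dots> = c * real (Suc l) * gexp (\<lambda>x. x ^ l)"
    unfolding std_normal_moment(2) by simp
  also have "\<dots> = gexp (poly (pderiv (monom c k)))"
    using gexp_poly_smult[of "c * real (Suc l)" "monom 1 l"] unfolding pm
    by (simp add: Suc pderiv_monom smult_monom mult.commute del: poly_smult)
  finally show ?thesis .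
qed

text \<open>Stein's identity: both sides are linear in \<open>p\<close>, and on monomials it is the
  moment recursion.\<close>

lemma gexp_stein: "gexp (poly (pCons 0 p)) = gexp (poly (pderiv p))"
proof -
  have p: "p = (\<Sum>i\<le>degree p. monom (coeff p i) i)" by (simp add: poly_as_sum_of_monoms)
  have pc: "pCons 0 (\<Sum>i\<in>A. f i) = (\<Sum>i\<in>A. pCons 0 (f i))" for A and f :: "nat \<Rightarrow> real poly"
    by (rule poly_eqI) (simp add: coeff_pCons coeff_sum split: nat.split)
  have pd: "pderiv (\<Sum>i\<in>A. f i) = (\<Sum>i\<in>A. pderiv (f i))" for A and f :: "nat \<Rightarrow> real poly"
    by (induction A rule: infinite_finite_induct) (auto simp: pderiv_add)
  show ?thesis
    by (subst (1 2) p) (simp only: pc pd gexp_poly_sum gexp_stein_monom)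
qed

text \<open>Raising the Hermite index is adjoint to differentiation. The recurrence gives
  \<open>x\<close> times \<open>herm n\<close> minus the preceding polynomial; Stein's identity
  applied to \<open>herm n * p\<close> produces that preceding polynomial again, and the two
  cancel.\<close>

lemma gexp_herm_Suc: "real (Suc n) * gexp (poly (herm (Suc n) * p)) = gexp (poly (herm n * pderiv p))"
proof (cases n)
  case 0
  then show ?thesis using gexp_stein[of p] by (simp add: herm_0 herm_1 del: poly_pCons)
next
  case (Suc m)
  have "real (Suc n) * gexp (poly (herm (Suc n) * p)) = gexp (poly (smult (real m + 2) (herm (Suc (Suc m))) * p))"
    unfolding mult_smult_left gexp_poly_smult Suc by (simp add: add_ac)
  also have "\<dots> = gexp (poly (pCons 0 (herm n * p))) - gexp (poly (herm m * p))"
    unfolding herm_Suc_Suc gexp_poly_diff [symmetric]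
    by (rule arg_cong[where f = "\<lambda>p. gexp (poly p)"]) (simp add: Suc algebra_simps)
  also have "\<dots> = gexp (poly (herm n * pderiv p))"
    unfolding gexp_stein pderiv_mult gexp_poly_add Suc pderiv_herm by (simp add: mult.commute)
  finally show ?thesis .
qed

lemma gexp_herm: "gexp (poly (herm n)) = (if n = 0 then 1 else 0)"
proof (cases n)
  case (Suc m)
  then show ?thesis using gexp_herm_Suc[of m 1] by (simp add: gexp_def pderiv_1)
qed (simp add: herm_0 gexp_1 del: poly_1)

text \<open>Adjointness lowers both indices at once, until one of them is 0.\<close>

lemma herm_orthogonal: "gexp (poly (herm i * herm j)) = (if i = j then 1 / fact i else 0)"
proof (induction i arbitrary: j)
  case 0
  then show ?case using gexp_herm[of j] by (simp add: herm_0 del: poly_mult)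
next
  case (Suc i)
  show ?case
  proof (cases j)
    case 0
    then show ?thesis using gexp_herm[of "Suc i"] by (simp add: herm_0 del: poly_mult)
  next
    case (Suc k)
    have "real (Suc i) * gexp (poly (herm (Suc i) * herm j)) = (if i = k then 1 / fact i else 0)"
      unfolding gexp_herm_Suc Suc pderiv_herm Suc.IH ..
    then show ?thesis using Suc by (auto simp: divide_simps mult_ac simp del: of_nat_Suc poly_mult)
  qed
qed

text \<open>The constant function \<open>h\<^sub>0 = 1\<close> is replaced by \<open>0\<close>, so that all \<open>hfun i\<close> are centred.\<close>

definition hfun :: "nat \<Rightarrow> real \<Rightarrow> real" where
  "hfun i x = (if i = 0 then 0 else sqrt (fact i) * poly (herm i) x)"

definition phi :: "nat \<Rightarrow> real \<Rightarrow> real" where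
  "phi i t = exp (t\<^sup>2 / 2) * t ^ i / sqrt (fact i)"

lemma hfun_1: "hfun (Suc 0) x = x"
  by (simp add: hfun_def herm_1)

lemma hfun_2: "hfun 2 x = (x\<^sup>2 - 1) / sqrt 2"
proof -
  have "hfun 2 x = sqrt 2 * ((x\<^sup>2 - 1) / 2)"
    by (simp add: hfun_def poly_herm numeral_2_eq_2 power2_eq_square)
  also have "\<dots> = (x\<^sup>2 - 1) * (sqrt 2 / 2)" by simp
  also have "\<dots> = (x\<^sup>2 - 1) / sqrt 2"
    by (subst sqrt_divide_self_eq) (simp_all add: divide_inverse)
  finally show ?thesis .
qed

lemma hfun_measurable [measurable]: "hfun i \<in> borel_measurable borel"
  unfolding hfun_def poly_herm by measurable

lemma phi_measurable [measurable]: "phi i \<in> borel_measurable borel"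
  unfolding phi_def by measurable

text \<open>The term of index 0 would be \<open>exp (t\<^sup>2 / 2)\<close>, the mean of
  \<open>exp (t * x)\<close> under the standard normal law. Since \<open>hfun 0\<close> is zero, the
  series is already centred.\<close>

lemma hfun_generating: "(\<lambda>i. hfun i x * phi i t) sums (exp (t * x) - exp (t\<^sup>2 / 2))"
proof -
  have "(\<lambda>i. exp (t\<^sup>2 / 2) * (poly (herm i) x * t ^ i)) sums (exp (t\<^sup>2 / 2) * exp (t * x - t\<^sup>2 / 2))"
    by (intro sums_mult herm_generating)
  moreover have "exp (t\<^sup>2 / 2) * exp (t * x - t\<^sup>2 / 2) = exp (t * x)"
    by (simp flip: exp_add)
  ultimately have "(\<lambda>i. exp (t\<^sup>2 / 2) * (poly (herm i) x * t ^ i)) sums exp (t * x)" by simp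
  from sums_diff[OF this sums_single[of 0 "\<lambda>_. exp (t\<^sup>2 / 2)"]]
  have "(\<lambda>i. exp (t\<^sup>2 / 2) * (poly (herm i) x * t ^ i) - (if i = 0 then exp (t\<^sup>2 / 2) else 0)) sums
      (exp (t * x) - exp (t\<^sup>2 / 2))" .
  moreover have "exp (t\<^sup>2 / 2) * (poly (herm i) x * t ^ i) - (if i = 0 then exp (t\<^sup>2 / 2) else 0) =
      hfun i x * phi i t" for i
    by (simp add: hfun_def phi_def herm_0)
  ultimately show ?thesis by simp
qed

lemma hfun_poly: "\<exists>p. hfun i = poly p"
  by (cases "i = 0") (auto simp: hfun_def fun_eq_iff intro: exI[of _ 0] exI[of _ "smult (sqrt (fact i)) (herm i)"])

lemma hfun_integrable: "integrable lborel (\<lambda>x. std_normal_density x * hfun i x)"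
  using hfun_poly[of i] gexp_poly_integrable by auto

lemma hfun_mult_integrable: "integrable lborel (\<lambda>x. std_normal_density x * (hfun i x * hfun j x))"
proof -
  obtain p q where "hfun i = poly p" "hfun j = poly q" using hfun_poly by metis
  then show ?thesis using gexp_poly_integrable[of "p * q"] by simp
qed

lemma gexp_hfun: "gexp (hfun i) = 0"
proof (cases "i = 0")
  case False
  then have "hfun i = poly (smult (sqrt (fact i)) (herm i))" by (auto simp: hfun_def)
  then show ?thesis using False by (simp only: gexp_poly_smult gexp_herm) simp
qed (simp add: hfun_def gexp_def)

lemma gexp_hfun_mult: "gexp (\<lambda>x. hfun i x * hfun j x) = (if i = j \<and> i > 0 then 1 else 0)"
proof (cases "i = 0 \<or> j = 0")
  case False
  then have "(\<lambda>x. hfun i x * hfun j x) = poly (smult (sqrt (fact i) * sqrt (fact j)) (herm i * herm j))"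
    by (auto simp: hfun_def)
  then show ?thesis using False by (simp only: gexp_poly_smult herm_orthogonal) auto
qed (auto simp: hfun_def gexp_def)

section \<open>Central limit theorem for the Hermite coefficients\<close>

definition gauss_seq :: "(nat \<Rightarrow> real) measure" where
  "gauss_seq = Pi\<^sub>M UNIV (\<lambda>_. std_normal_distribution)"

lemma prob_space_gauss_seq: "prob_space gauss_seq"
  unfolding gauss_seq_def by (intro prob_space_PiM prob_space_normal_density) auto

text \<open>Identifies the product \<sigma>-algebra with the Borel sets of the product topology, so
  that continuous functions of the whole sequence are measurable.\<close>

lemma sets_gauss_seq: "sets gauss_seq = sets (borel :: (nat \<Rightarrow> real) measure)"
proof -
  have "sets gauss_seq = sets (Pi\<^sub>M UNIV (\<lambda>_::nat. borel :: real measure))"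
    unfolding gauss_seq_def by (intro sets_PiM_cong) auto
  then show ?thesis by (simp add: sets_PiM_equal_borel)
qed

lemma measurable_gauss_seq: "borel_measurable gauss_seq = (borel_measurable borel :: ((nat \<Rightarrow> real) \<Rightarrow> 'b::topological_space) set)"
  by (rule measurable_cong_sets[OF sets_gauss_seq refl])

lemma space_gauss_seq [simp]: "space gauss_seq = UNIV"
  using sets_eq_imp_space_eq[OF sets_gauss_seq] by simp

lemma component_borel_measurable: "(\<lambda>x::nat \<Rightarrow> real. x i) \<in> borel_measurable borel"
  by (intro borel_measurable_continuous_onI continuous_on_product_coordinates)

lemma component_gauss_seq [measurable]: "(\<lambda>x. x i) \<in> borel_measurable gauss_seq"
  unfolding measurable_gauss_seq by (rule component_borel_measurable)

lemma distr_component_gauss_seq: "distr gauss_seq borel (\<lambda>x. x i) = std_normal_distribution"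
proof -
  have "distr gauss_seq borel (\<lambda>x. x i) = distr gauss_seq std_normal_distribution (\<lambda>x. x i)"
    by (rule distr_cong) auto
  also have "\<dots> = std_normal_distribution"
    unfolding gauss_seq_def by (rule distr_PiM_component) (auto intro: prob_space_normal_density)
  finally show ?thesis .
qed

lemma distributed_component_gauss_seq:
  "distributed gauss_seq lborel (\<lambda>x. x i) (\<lambda>x. ennreal (std_normal_density x))"
  unfolding distributed_def
proof (intro conjI)
  have "distr gauss_seq lborel (\<lambda>x. x i) = distr gauss_seq borel (\<lambda>x. x i)"
    by (rule distr_cong) auto
  then show "distr gauss_seq lborel (\<lambda>x. x i) = density lborel (\<lambda>x. ennreal (std_normal_density x))"
    using distr_component_gauss_seq by simp
qed (auto simp: measurable_lborel1)

text \<open>The joint law of the coordinates is \<open>gauss_seq\<close> itself, hence the product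
  of the marginals.\<close>

lemma indep_vars_gauss_seq: "prob_space.indep_vars gauss_seq (\<lambda>_. borel) (\<lambda>i x. x i) UNIV"
proof -
  interpret prob_space gauss_seq by (rule prob_space_gauss_seq)
  have "distr gauss_seq (\<Pi>\<^sub>M i\<in>UNIV. borel) (\<lambda>x. \<lambda>i\<in>UNIV. x i) = distr gauss_seq gauss_seq (\<lambda>x. x)"
    by (rule distr_cong) (auto simp: sets_gauss_seq sets_PiM_equal_borel)
  also have "\<dots> = (\<Pi>\<^sub>M i\<in>UNIV. distr gauss_seq borel (\<lambda>x. x i))"
    unfolding distr_id distr_component_gauss_seq by (simp add: gauss_seq_def)
  finally show ?thesis
    by (subst indep_vars_iff_distr_eq_PiM') auto
qed

lemma gauss_seq_sum_distributed:
  assumes I: "finite I" and v: "(\<Sum>i\<in>I. (u i)\<^sup>2) > 0"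
  shows "distributed gauss_seq lborel (\<lambda>x. \<Sum>i\<in>I. u i * x i)
    (\<lambda>y. ennreal (normal_density 0 (sqrt (\<Sum>i\<in>I. (u i)\<^sup>2)) y))"
proof -
  interpret prob_space gauss_seq by (rule prob_space_gauss_seq)
  \<comment> \<open>The addition theorem for normal variables needs positive variances, so vanishing
    coefficients are dropped.\<close>
  define J where "J = {i\<in>I. u i \<noteq> 0}"
  have "\<not> (\<forall>i\<in>I. u i = 0)" using v by force
  then have J: "finite J" "J \<noteq> {}" using I by (auto simp: J_def)
  have "distributed gauss_seq lborel (\<lambda>x. \<Sum>i\<in>J. u i * x i)
      (\<lambda>y. ennreal (normal_density (\<Sum>i\<in>J. 0) (sqrt (\<Sum>i\<in>J. \<bar>u i\<bar>\<^sup>2)) y))"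
  proof (rule sum_indep_normal[OF J])
    have "indep_vars (\<lambda>_. borel) (\<lambda>i x. x i) J"
      by (rule indep_vars_subset[OF indep_vars_gauss_seq]) simp
    then show "indep_vars (\<lambda>_. borel) (\<lambda>i x. u i * x i) J"
      by (rule indep_vars_compose2) auto
    show "0 < \<bar>u i\<bar>" if "i \<in> J" for i using that by (simp add: J_def)
    show "distributed gauss_seq lborel (\<lambda>x. u i * x i) (\<lambda>y. ennreal (normal_density 0 \<bar>u i\<bar> y))" if "i \<in> J" for i
      using normal_density_affine[OF distributed_component_gauss_seq[of i], of "u i" 0] that
      by (simp add: J_def)
  qed
  moreover have "(\<Sum>i\<in>J. u i * x i) = (\<Sum>i\<in>I. u i * x i)" for x
    unfolding J_def using I by (intro sum.mono_neutral_left) auto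
  moreover have "(\<Sum>i\<in>J. \<bar>u i\<bar>\<^sup>2) = (\<Sum>i\<in>I. (u i)\<^sup>2)"
    unfolding J_def using I by (auto intro!: sum.mono_neutral_cong_left)
  ultimately show ?thesis by simp
qed

lemma distributed_scaled_std_normal:
  assumes "a > 0"
  shows "distr std_normal_distribution lborel (\<lambda>y. a * y) = density lborel (\<lambda>y. ennreal (normal_density 0 a y))"
proof -
  interpret prob_space std_normal_distribution by (rule prob_space_normal_density) simp
  have "distr std_normal_distribution lborel (\<lambda>y. y) = distr std_normal_distribution std_normal_distribution (\<lambda>y. y)"
    by (rule distr_cong) auto
  then have "distributed std_normal_distribution lborel (\<lambda>y. y) (\<lambda>y. ennreal (std_normal_density y))"
    by (simp add: distributed_def distr_id)
  from normal_density_affine[OF this, of a 0] assms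
  show ?thesis by (simp add: distributed_def)
qed

text \<open>An image of the standard normal law under scaling, rather than a density, includes the
  degenerate case of variance 0.\<close>

lemma distr_gauss_seq_linear:
  assumes I: "finite I"
  shows "distr gauss_seq borel (\<lambda>x. \<Sum>i\<in>I. u i * x i) =
    distr std_normal_distribution borel (\<lambda>y. sqrt (\<Sum>i\<in>I. (u i)\<^sup>2) * y)"
proof (cases "(\<Sum>i\<in>I. (u i)\<^sup>2) > 0")
  case True
  have "distr gauss_seq borel (\<lambda>x. \<Sum>i\<in>I. u i * x i) = distr gauss_seq lborel (\<lambda>x. \<Sum>i\<in>I. u i * x i)"
    by (rule distr_cong) auto
  also have "\<dots> = distr std_normal_distribution lborel (\<lambda>y. sqrt (\<Sum>i\<in>I. (u i)\<^sup>2) * y)"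
    using gauss_seq_sum_distributed[OF I True] distributed_scaled_std_normal True
    by (simp add: distributed_def)
  also have "\<dots> = distr std_normal_distribution borel (\<lambda>y. sqrt (\<Sum>i\<in>I. (u i)\<^sup>2) * y)"
    by (rule distr_cong) auto
  finally show ?thesis .
next
  case False
  then have v: "(\<Sum>i\<in>I. (u i)\<^sup>2) = 0" by (smt (verit) sum_nonneg zero_le_power2)
  then have "u i = 0" if "i \<in> I" for i
    using that I by (simp add: sum_nonneg_eq_0_iff)
  then have "(\<Sum>i\<in>I. u i * x i) = 0" for x by simp
  then show ?thesis
    unfolding v using prob_space_gauss_seq prob_space_normal_density[of 1 0]
    by (simp add: prob_space.distr_const)
qed

lemma gauss_seq_expectation_linear:
  fixes g :: "real \<Rightarrow> 'b::{banach, second_countable_topology}"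
  assumes "finite I" "g \<in> borel_measurable borel"
  shows "(\<integral>x. g (\<Sum>i\<in>I. u i * x i) \<partial>gauss_seq) =
    (\<integral>y. g (sqrt (\<Sum>i\<in>I. (u i)\<^sup>2) * y) \<partial>std_normal_distribution)"
proof -
  have "(\<integral>x. g (\<Sum>i\<in>I. u i * x i) \<partial>gauss_seq) = integral\<^sup>L (distr gauss_seq borel (\<lambda>x. \<Sum>i\<in>I. u i * x i)) g"
    using assms(2) by (subst integral_distr) auto
  also have "\<dots> = (\<integral>y. g (sqrt (\<Sum>i\<in>I. (u i)\<^sup>2) * y) \<partial>std_normal_distribution)"
    unfolding distr_gauss_seq_linear[OF assms(1)] using assms(2) by (subst integral_distr) auto
  finally show ?thesis .
qed

section \<open>Hermite coefficients of a standard normal sample, indexed from 0\<close>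

locale normal_sample = prob_space P for P :: "'w measure" +
  fixes Z :: "nat \<Rightarrow> 'w \<Rightarrow> real"
  assumes indep: "indep_vars (\<lambda>_. borel) Z UNIV"
    and normal: "distributed P lborel (Z j) (\<lambda>x. ennreal (std_normal_density x))"
begin

lemma Z_measurable [measurable]: "Z j \<in> borel_measurable P"
  using indep by (auto simp: indep_vars_def)

lemma Z_integral: "g \<in> borel_measurable borel \<Longrightarrow> (\<integral>\<omega>. g (Z j \<omega>) \<partial>P) = gexp g"
  unfolding gexp_def by (subst distributed_integral[OF normal]) auto

lemma Z_integrable:
  fixes g :: "real \<Rightarrow> real"
  shows "g \<in> borel_measurable borel \<Longrightarrow> integrable lborel (\<lambda>x. std_normal_density x * g x) \<Longrightarrow> integrable P (\<lambda>\<omega>. g (Z j \<omega>))"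
  by (subst distributed_integrable[OF normal, symmetric]) auto

definition xi :: "nat \<Rightarrow> 'w \<Rightarrow> nat \<Rightarrow> real" where
  "xi n \<omega> i = (\<Sum>j<n. hfun i (Z j \<omega>)) / sqrt (real n)"

lemma xi_measurable [measurable]: "(\<lambda>\<omega>. xi n \<omega> i) \<in> borel_measurable P"
  unfolding xi_def by measurable

lemma xi_measurable_seq: "xi n \<in> borel_measurable P"
proof -
  have "xi n \<in> P \<rightarrow>\<^sub>M Pi\<^sub>M UNIV (\<lambda>_. borel)"
    by (rule measurable_PiM_single') auto
  then show ?thesis
    using measurable_cong_sets[OF refl sets_PiM_equal_borel] by blast
qed

context
  fixes I :: "nat set" and u :: "nat \<Rightarrow> real"
  assumes I: "finite I" "0 \<notin> I"
begin

text \<open>By orthonormality only the diagonal of the expanded square survives. The condition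
  \<open>0 \<notin> I\<close> matters: \<open>hfun 0\<close> is zero and has second moment 0 instead
  of 1.\<close>

lemma lin_moments:
  "indep_vars (\<lambda>_. borel) (\<lambda>j \<omega>. \<Sum>i\<in>I. u i * hfun i (Z j \<omega>)) UNIV"
  "integrable P (\<lambda>\<omega>. \<Sum>i\<in>I. u i * hfun i (Z j \<omega>))"
  "(\<integral>\<omega>. (\<Sum>i\<in>I. u i * hfun i (Z j \<omega>)) \<partial>P) = 0"
  "integrable P (\<lambda>\<omega>. (\<Sum>i\<in>I. u i * hfun i (Z j \<omega>))\<^sup>2)"
  "(\<integral>\<omega>. (\<Sum>i\<in>I. u i * hfun i (Z j \<omega>))\<^sup>2 \<partial>P) = (\<Sum>i\<in>I. (u i)\<^sup>2)"
proof -
  show "indep_vars (\<lambda>_. borel) (\<lambda>j \<omega>. \<Sum>i\<in>I. u i * hfun i (Z j \<omega>)) UNIV"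
    by (rule indep_vars_compose2[OF indep]) measurable
  have h: "integrable P (\<lambda>\<omega>. hfun i (Z j \<omega>))" for i
    by (intro Z_integrable hfun_integrable) measurable
  have hh: "integrable P (\<lambda>\<omega>. hfun i (Z j \<omega>) * hfun k (Z j \<omega>))" for i k
    by (rule Z_integrable[of "\<lambda>x. hfun i x * hfun k x"]) (measurable, rule hfun_mult_integrable)
  have Eh: "(\<integral>\<omega>. hfun i (Z j \<omega>) \<partial>P) = 0" for i
    by (subst Z_integral) (auto simp: gexp_hfun)
  have Ehh: "(\<integral>\<omega>. hfun i (Z j \<omega>) * hfun k (Z j \<omega>) \<partial>P) = (if i = k \<and> i > 0 then 1 else 0)" for i k
    by (subst Z_integral[of "\<lambda>x. hfun i x * hfun k x"]) (measurable, rule gexp_hfun_mult)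
  show "integrable P (\<lambda>\<omega>. \<Sum>i\<in>I. u i * hfun i (Z j \<omega>))"
    using h by auto
  show "(\<integral>\<omega>. (\<Sum>i\<in>I. u i * hfun i (Z j \<omega>)) \<partial>P) = 0"
    using h Eh by (subst Bochner_Integration.integral_sum) auto
  have sq: "(\<Sum>i\<in>I. u i * hfun i x)\<^sup>2 = (\<Sum>i\<in>I. \<Sum>k\<in>I. u i * u k * (hfun i x * hfun k x))" for x
    by (simp add: power2_eq_square sum_product mult_ac)
  show "integrable P (\<lambda>\<omega>. (\<Sum>i\<in>I. u i * hfun i (Z j \<omega>))\<^sup>2)"
    unfolding sq using hh by (intro Bochner_Integration.integrable_sum integrable_mult_right) auto
  have "(\<integral>\<omega>. (\<Sum>i\<in>I. u i * hfun i (Z j \<omega>))\<^sup>2 \<partial>P) =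
      (\<Sum>i\<in>I. \<Sum>k\<in>I. u i * u k * (\<integral>\<omega>. hfun i (Z j \<omega>) * hfun k (Z j \<omega>) \<partial>P))"
    unfolding sq using hh
    by (subst Bochner_Integration.integral_sum, intro Bochner_Integration.integrable_sum integrable_mult_right)
       (auto intro!: sum.cong simp: Bochner_Integration.integral_sum)
  also have "\<dots> = (\<Sum>i\<in>I. \<Sum>k\<in>I. if i = k then (u i)\<^sup>2 else 0)"
    using I(2) unfolding Ehh by (intro sum.cong refl) (auto simp: power2_eq_square intro: gr0I)
  also have "\<dots> = (\<Sum>i\<in>I. (u i)\<^sup>2)"
    using I(1) by simp
  finally show "(\<integral>\<omega>. (\<Sum>i\<in>I. u i * hfun i (Z j \<omega>))\<^sup>2 \<partial>P) = (\<Sum>i\<in>I. (u i)\<^sup>2)" .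
qed

lemma xi_linear: "(\<Sum>i\<in>I. u i * xi n \<omega> i) = (\<Sum>j<n. \<Sum>i\<in>I. u i * hfun i (Z j \<omega>)) / sqrt (real n)"
  by (subst sum.swap) (simp add: xi_def sum_distrib_left sum_divide_distrib)

text \<open>The Cramer-Wold device: a linear combination of coefficients is a normalized sum of
  i.i.d. variables, to which the scalar central limit theorem applies unless its variance is 0. The
  phase \<open>c\<close> makes cosines cover sines as well.\<close>

lemma clt_cos:
  "(\<lambda>n. \<integral>\<omega>. cos (c + (\<Sum>i\<in>I. u i * xi n \<omega> i)) \<partial>P) \<longlonglongrightarrow>
     (\<integral>x. cos (c + (\<Sum>i\<in>I. u i * x i)) \<partial>gauss_seq)"
proof -
  define v where "v = (\<Sum>i\<in>I. (u i)\<^sup>2)"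
  define Y where "Y j \<omega> = (\<Sum>i\<in>I. u i * hfun i (Z j \<omega>))" for j \<omega>
  have Ym [measurable]: "Y j \<in> borel_measurable P" for j unfolding Y_def by measurable
  consider "v = 0" | "v > 0" unfolding v_def by (metis less_eq_real_def sum_nonneg zero_le_power2)
  then show ?thesis
  proof cases
    case 1
    then have "u i = 0" if "i \<in> I" for i
      using that I(1) by (simp add: v_def sum_nonneg_eq_0_iff)
    then have "(\<Sum>i\<in>I. u i * x i) = 0" for x by simp
    then show ?thesis using prob_space.prob_space[OF prob_space_gauss_seq] by (simp add: prob_space)
  next
    case 2
    have distr: "distr P borel (Y n) = distr (density lborel (\<lambda>x. ennreal (std_normal_density x))) borel (\<lambda>x. \<Sum>i\<in>I. u i * hfun i x)" for n
    proof -
      have "distr P borel (Y n) = distr (distr P lborel (Z n)) borel (\<lambda>x. \<Sum>i\<in>I. u i * hfun i x)"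
        by (subst distr_distr) (auto simp: Y_def[abs_def] comp_def)
      then show ?thesis using distributed_distr_eq_density[OF normal] by simp
    qed
    have "weak_conv_m (\<lambda>n. distr P borel (\<lambda>\<omega>. (\<Sum>j<n. Y j \<omega>) / sqrt (real n * (sqrt v)\<^sup>2))) std_normal_distribution"
    proof (rule central_limit_theorem_zero_mean[OF _ _ _ _ _ distr])
      show "indep_vars (\<lambda>i. borel) Y UNIV"
        unfolding Y_def using lin_moments(1) .
      show "expectation (Y n) = 0" for n unfolding Y_def by (rule lin_moments)
      then show "variance (Y n) = (sqrt v)\<^sup>2" for n
        using 2 lin_moments(5) by (simp add: Y_def v_def)
      show "integrable P (\<lambda>\<omega>. (Y n \<omega>)\<^sup>2)" for n unfolding Y_def by (rule lin_moments)
    qed (use 2 in simp)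
    then have "(\<lambda>n. \<integral>x. cos (c + sqrt v * x) \<partial>distr P borel (\<lambda>\<omega>. (\<Sum>j<n. Y j \<omega>) / sqrt (real n * (sqrt v)\<^sup>2))) \<longlonglongrightarrow>
        (\<integral>x. cos (c + sqrt v * x) \<partial>std_normal_distribution)"
      by (intro weak_conv_imp_integral_bdd_continuous_conv[where B = 1])
         (auto intro!: real_distribution_distr real_dist_normal_dist)
    moreover have "(\<integral>x. cos (c + sqrt v * x) \<partial>distr P borel (\<lambda>\<omega>. (\<Sum>j<n. Y j \<omega>) / sqrt (real n * (sqrt v)\<^sup>2))) =
        (\<integral>\<omega>. cos (c + (\<Sum>i\<in>I. u i * xi n \<omega> i)) \<partial>P)" for n
      using 2 by (subst integral_distr) (auto simp: xi_linear Y_def real_sqrt_mult)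
    moreover have "(\<integral>x. cos (c + (\<Sum>i\<in>I. u i * x i)) \<partial>gauss_seq) = (\<integral>x. cos (c + sqrt v * x) \<partial>std_normal_distribution)"
      unfolding v_def by (rule gauss_seq_expectation_linear[OF I(1)]) measurable
    ultimately show ?thesis by simp
  qed
qed

end

text \<open>Independence and centring remove the products with \<open>j \<noteq> k\<close>. The
  value does not depend on \<open>n\<close>, which yields all later bounds that are uniform in
  \<open>n\<close>.\<close>

lemma xi_second_moment:
  assumes "i > 0" "n > 0"
  shows "integrable P (\<lambda>\<omega>. (xi n \<omega> i)\<^sup>2)" "(\<integral>\<omega>. (xi n \<omega> i)\<^sup>2 \<partial>P) = 1"
proof -
  define Y where "Y j \<omega> = hfun i (Z j \<omega>)" for j \<omega>
  have i: "finite {i}" "0 \<notin> {i}" using assms by auto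
  note m = lin_moments[OF i, of "\<lambda>_. 1", simplified, folded Y_def]
  have YY: "integrable P (\<lambda>\<omega>. Y j \<omega> * Y k \<omega>) \<and> (\<integral>\<omega>. Y j \<omega> * Y k \<omega> \<partial>P) = (if j = k then 1 else 0)" for j k
  proof (cases "j = k")
    case True
    then show ?thesis using m(4,5) by (simp add: power2_eq_square)
  next
    case False
    have "indep_vars (\<lambda>_. borel) Y {j, k}"
      by (rule indep_vars_subset[OF m(1)[folded Y_def]]) simp
    from indep_vars_lebesgue_integral[OF _ this] indep_vars_integrable[OF _ this]
    show ?thesis using False m(2,3) by simp
  qed
  have sq: "(xi n \<omega> i)\<^sup>2 = (\<Sum>j<n. \<Sum>k<n. Y j \<omega> * Y k \<omega>) / real n" for \<omega>
    by (simp add: xi_def Y_def power_divide power2_eq_square sum_product)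
  show "integrable P (\<lambda>\<omega>. (xi n \<omega> i)\<^sup>2)"
    unfolding sq using YY by auto
  have "(\<integral>\<omega>. (xi n \<omega> i)\<^sup>2 \<partial>P) = (\<Sum>j<n. \<Sum>k<n. \<integral>\<omega>. Y j \<omega> * Y k \<omega> \<partial>P) / real n"
    unfolding sq using YY by (simp add: Bochner_Integration.integral_sum)
  also have "\<dots> = 1" using YY assms by simp
  finally show "(\<integral>\<omega>. (xi n \<omega> i)\<^sup>2 \<partial>P) = 1" .
qed

lemma xi_0: "xi n \<omega> 0 = 0"
  by (simp add: xi_def hfun_def)

end

lemma gauss_seq_second_moment:
  "integrable gauss_seq (\<lambda>x. (x i)\<^sup>2)" "(\<integral>x. (x i)\<^sup>2 \<partial>gauss_seq) = 1"
proof -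
  have b: "has_bochner_integral lborel (\<lambda>x. std_normal_density x * x\<^sup>2) 1"
    using std_normal_moment_even[of 1] by simp
  show "integrable gauss_seq (\<lambda>x. (x i)\<^sup>2)"
    using b by (subst distributed_integrable[OF distributed_component_gauss_seq, symmetric])
      (auto simp: has_bochner_integral_iff)
  show "(\<integral>x. (x i)\<^sup>2 \<partial>gauss_seq) = 1"
    using b by (subst distributed_integral[OF distributed_component_gauss_seq, symmetric])
      (auto simp: has_bochner_integral_iff)
qed

subsection \<open>From characteristic functions to bounded continuous functions\<close>

text \<open>Real trigonometric polynomials in the coordinates from \<open>I\<close>. The phase form
  keeps everything real, and the product-to-sum formula makes the class closed under
  multiplication.\<close>

inductive trig :: "nat set \<Rightarrow> ((nat \<Rightarrow> real) \<Rightarrow> real) \<Rightarrow> bool" for I where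
  trig_cos: "trig I (\<lambda>x. cos (c + (\<Sum>i\<in>I. u i * x i)))"
| trig_add: "trig I f \<Longrightarrow> trig I g \<Longrightarrow> trig I (\<lambda>x. f x + g x)"
| trig_scale: "trig I f \<Longrightarrow> trig I (\<lambda>x. a * f x)"

lemma trig_const: "trig I (\<lambda>_. a)"
  using trig_scale[OF trig_cos[of I 0 "\<lambda>_. 0"], of a] by simp

lemma trig_mult_cos:
  assumes "trig I g"
  shows "trig I (\<lambda>x. cos (c + (\<Sum>i\<in>I. u i * x i)) * g x)"
  using assms
proof induction
  case (trig_cos d v)
  have eq: "cos (c + (\<Sum>i\<in>I. u i * x i)) * cos (d + (\<Sum>i\<in>I. v i * x i)) =
    (1/2) * (cos ((c - d) + (\<Sum>i\<in>I. (u i - v i) * x i)) + cos ((c + d) + (\<Sum>i\<in>I. (u i + v i) * x i)))" for x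
    unfolding cos_times_cos by (simp add: sum.distrib sum_subtractf algebra_simps)
  show ?case unfolding eq by (intro trig.intros)
next
  case (trig_add f g)
  then show ?case using trig.trig_add by (simp add: distrib_left)
next
  case (trig_scale f a)
  then show ?case using trig.trig_scale by (simp add: mult.left_commute)
qed

lemma trig_mult:
  assumes "trig I f" "trig I g"
  shows "trig I (\<lambda>x. f x * g x)"
  using assms(1)
proof induction
  case (trig_add f h)
  then show ?case using trig.trig_add by (simp add: distrib_right)
next
  case (trig_scale f a)
  then show ?case using trig.trig_scale by (simp add: mult.assoc)
qed (rule trig_mult_cos[OF assms(2)])

lemma trig_bounded:
  assumes "trig I f"
  shows "\<exists>B. \<forall>x. \<bar>f x\<bar> \<le> B"
  using assms
proof induction
  case (trig_cos c u)
  then show ?case by (intro exI[of _ 1]) auto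
next
  case (trig_add f g)
  then obtain A B where "\<bar>f x\<bar> \<le> A" "\<bar>g x\<bar> \<le> B" for x by blast
  then have "\<bar>f x + g x\<bar> \<le> A + B" for x
    by (meson abs_triangle_ineq add_mono order_trans)
  then show ?case by blast
next
  case (trig_scale f a)
  then obtain A where "\<bar>f x\<bar> \<le> A" for x by blast
  then have "\<bar>a * f x\<bar> \<le> \<bar>a\<bar> * A" for x
    by (simp add: abs_mult mult_left_mono)
  then show ?case by blast
qed

lemma trig_measurable:
  assumes "trig I f"
  shows "f \<in> borel_measurable borel"
  using assms
proof induction
  case (trig_cos c u)
  have [measurable]: "(\<lambda>x::nat \<Rightarrow> real. x i) \<in> borel_measurable borel" for i
    by (rule component_borel_measurable)
  show ?case by measurable
qed auto

text \<open>Stone-Weierstrass is applied on a cube to \<open>f\<close> in the coordinates \<open>y\<^sub>i = sin (x\<^sub>i / L)\<close>: the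
  approximation is then bounded on the whole space, and the quadratic term absorbs the points
  where some \<open>\<bar>x\<^sub>i\<bar>\<close> exceeds \<open>L\<close>.\<close>

lemma trig_approx:
  fixes f :: "(nat \<Rightarrow> real) \<Rightarrow> real"
  assumes I: "finite I" and f: "continuous_on UNIV f" and B: "\<And>x. \<bar>f x\<bar> \<le> B"
    and dep: "\<And>x y. (\<forall>i\<in>I. x i = y i) \<Longrightarrow> f x = f y" and e: "e > 0" and L: "L > 0"
  shows "\<exists>g. trig I g \<and> (\<forall>x. \<bar>f x - g x\<bar> \<le> e + (2 * B + e) * (\<Sum>i\<in>I. (x i / L)\<^sup>2))"
proof -
  \<comment> \<open>Freezing the coordinates outside \<open>I\<close> at 0 lets those in
    \<open>I\<close> separate the points of the cube.\<close>
  define S :: "(nat \<Rightarrow> real) set" where "S = PiE UNIV (\<lambda>k. if k \<in> I then {-1..1} else {0})"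
  define s :: "(nat \<Rightarrow> real) \<Rightarrow> nat \<Rightarrow> real" where "s x k = (if k \<in> I then sin (x k / L) else 0)" for x k
  \<comment> \<open>The algebra for Stone-Weierstrass records that the pullback along
    \<open>s\<close> is a trigonometric polynomial, so that the approximant comes with this
    property.\<close>
  define R where "R = {h. continuous_on S h \<and> trig I (\<lambda>x. h (s x))}"
  have sS: "s x \<in> S" for x by (auto simp: S_def s_def PiE_iff)
  have cS: "compact S"
  proof -
    have "compactin (product_topology (\<lambda>_. euclideanreal) UNIV) S"
      unfolding S_def by (subst compactin_PiE) auto
    then show ?thesis by (simp add: euclidean_product_topology)
  qed
  interpret function_ring_on R S
  proof
    show "compact S" by (rule cS)
    show "continuous_on S f" if "f \<in> R" for f using that by (simp add: R_def)
    show "(\<lambda>x. f x + g x) \<in> R" if "f \<in> R" "g \<in> R" for f g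
      using that by (auto simp: R_def intro!: continuous_intros trig_add)
    show "(\<lambda>x. f x * g x) \<in> R" if "f \<in> R" "g \<in> R" for f g
      using that by (auto simp: R_def intro!: continuous_intros trig_mult)
    show "(\<lambda>_. c) \<in> R" for c by (simp add: R_def trig_const)
    fix x y assume xy: "x \<in> S" "y \<in> S" "x \<noteq> y"
    then obtain k where k: "x k \<noteq> y k" by auto
    have kI: "k \<in> I"
    proof (rule ccontr)
      assume "k \<notin> I"
      then have "x k = 0" "y k = 0" using xy by (auto simp: S_def PiE_iff split: if_splits)
      then show False using k by simp
    qed
    have "sin (x k / L) = cos (- (pi/2) + (\<Sum>i\<in>I. (if i = k then 1 / L else 0) * x i))" for x :: "nat \<Rightarrow> real"
    proof -
      have "(\<Sum>i\<in>I. (if i = k then 1 / L else 0) * x i) = (\<Sum>i\<in>I. if i = k then x k / L else 0)"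
        by (intro sum.cong) auto
      then have "(\<Sum>i\<in>I. (if i = k then 1 / L else 0) * x i) = x k / L"
        using I kI by simp
      then show ?thesis by (simp add: cos_diff)
    qed
    then have "trig I (\<lambda>x. sin (x k / L))" by (simp only:) (rule trig_cos)
    then have "(\<lambda>y. y k) \<in> R"
      using kI by (auto simp: R_def s_def intro: continuous_on_product_coordinates continuous_on_subset)
    then show "\<exists>f\<in>R. f x \<noteq> f y" using k by (intro bexI[of _ "\<lambda>y. y k"])
  qed
  have "continuous_on S (\<lambda>y. f (\<lambda>k. L * arcsin (y k)))"
  proof (rule continuous_on_compose2[OF f])
    show "continuous_on S (\<lambda>y k. L * arcsin (y k))"
    proof (rule continuous_on_coordinatewise_then_product)
      fix k
      have "continuous_on S (\<lambda>y. y k)"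
        by (rule continuous_on_subset[OF continuous_on_product_coordinates]) simp
      moreover have "\<forall>y\<in>S. -1 \<le> y k \<and> y k \<le> 1"
        by (cases "k \<in> I") (auto simp: S_def PiE_iff dest!: spec[of _ k])
      ultimately show "continuous_on S (\<lambda>y. L * arcsin (y k))"
        by (intro continuous_intros)
    qed
  qed simp
  then obtain h where h: "h \<in> R" "\<And>y. y \<in> S \<Longrightarrow> \<bar>f (\<lambda>k. L * arcsin (y k)) - h y\<bar> < e"
    using Stone_Weierstrass_basic[OF _ e] by blast
  have B0: "0 \<le> B" using B[of "\<lambda>_. 0"] by linarith
  have "\<bar>f x - h (s x)\<bar> \<le> e + (2 * B + e) * (\<Sum>i\<in>I. (x i / L)\<^sup>2)" for x
  proof (cases "\<forall>i\<in>I. \<bar>x i\<bar> \<le> L")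
    case True
    have "L * arcsin (s x i) = x i" if "i \<in> I" for i
    proof -
      \<comment> \<open>Since \<open>1 \<le> pi / 2\<close>, the points of the cube lie where
        \<open>arcsin\<close> inverts \<open>sin\<close>.\<close>
      have "\<bar>x i / L\<bar> \<le> 1" using True that L by (simp add: field_simps)
      then have "- (pi/2) \<le> x i / L" "x i / L \<le> pi / 2"
        using pi_ge_two by linarith+
      then show ?thesis using that L by (simp add: s_def arcsin_sin)
    qed
    then have "f (\<lambda>k. L * arcsin (s x k)) = f x" by (intro dep) auto
    then have "\<bar>f x - h (s x)\<bar> \<le> e" using h(2)[OF sS[of x]] by simp
    moreover have "0 \<le> (2 * B + e) * (\<Sum>i\<in>I. (x i / L)\<^sup>2)"
      using B0 e by (intro mult_nonneg_nonneg sum_nonneg) auto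
    ultimately show ?thesis by linarith
  next
    case False
    then obtain i where i: "i \<in> I" "L < \<bar>x i\<bar>" by auto
    have "1\<^sup>2 \<le> \<bar>x i / L\<bar>\<^sup>2" using i(2) L by (intro power_mono) (auto simp: field_simps)
    then have "1 \<le> (x i / L)\<^sup>2" unfolding power2_abs by simp
    also have "\<dots> \<le> (\<Sum>i\<in>I. (x i / L)\<^sup>2)"
      using I i(1) by (intro member_le_sum) auto
    finally have "(2 * B + e) * 1 \<le> (2 * B + e) * (\<Sum>i\<in>I. (x i / L)\<^sup>2)"
      using B0 e by (intro mult_left_mono) auto
    \<comment> \<open>Everywhere \<open>h (s x)\<close> is within \<open>e\<close> of some value of
      \<open>f\<close>, hence bounded by \<open>B + e\<close>.\<close>
    moreover have "\<bar>f x - h (s x)\<bar> \<le> 2 * B + e"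
      using h(2)[OF sS[of x]] B[of x] B[of "\<lambda>k. L * arcsin (s x k)"] by linarith
    ultimately have "\<bar>f x - h (s x)\<bar> \<le> (2 * B + e) * (\<Sum>i\<in>I. (x i / L)\<^sup>2)" by simp
    then show ?thesis using e by (intro add_increasing) simp_all
  qed
  moreover have "trig I (\<lambda>x. h (s x))" using h(1) by (simp add: R_def)
  ultimately show ?thesis by blast
qed

text \<open>The uniform second moment bound takes the role of tightness: it controls in expectation
  the quadratic error of replacing \<open>f\<close> by a trigonometric polynomial, for which
  convergence follows from \<open>cos\<close> by linearity.\<close>

lemma convergence_from_cos:
  fixes X :: "nat \<Rightarrow> 'w \<Rightarrow> nat \<Rightarrow> real" and V :: "'v \<Rightarrow> nat \<Rightarrow> real"
    and f :: "(nat \<Rightarrow> real) \<Rightarrow> real"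
  assumes P: "prob_space P" and Q: "prob_space Q"
    and X: "\<And>n. X n \<in> borel_measurable P" and V: "V \<in> borel_measurable Q"
    and I: "finite I"
    and cos: "\<And>c u. (\<lambda>n. \<integral>\<omega>. cos (c + (\<Sum>i\<in>I. u i * X n \<omega> i)) \<partial>P) \<longlonglongrightarrow> (\<integral>\<omega>. cos (c + (\<Sum>i\<in>I. u i * V \<omega> i)) \<partial>Q)"
    and X2: "\<And>n i. n > 0 \<Longrightarrow> i \<in> I \<Longrightarrow> integrable P (\<lambda>\<omega>. (X n \<omega> i)\<^sup>2) \<and> (\<integral>\<omega>. (X n \<omega> i)\<^sup>2 \<partial>P) \<le> 1"
    and V2: "\<And>i. i \<in> I \<Longrightarrow> integrable Q (\<lambda>\<omega>. (V \<omega> i)\<^sup>2) \<and> (\<integral>\<omega>. (V \<omega> i)\<^sup>2 \<partial>Q) \<le> 1"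
    and f: "continuous_on UNIV f" and B: "\<And>x. \<bar>f x\<bar> \<le> B"
    and dep: "\<And>x y. (\<forall>i\<in>I. x i = y i) \<Longrightarrow> f x = f y"
  shows "(\<lambda>n. \<integral>\<omega>. f (X n \<omega>) \<partial>P) \<longlonglongrightarrow> (\<integral>\<omega>. f (V \<omega>) \<partial>Q)"
proof (rule LIMSEQ_I)
  interpret P: prob_space P by fact
  interpret Q: prob_space Q by fact
  have B0: "0 \<le> B" using B[of "\<lambda>_. 0"] by linarith
  have fm: "f \<in> borel_measurable borel" using f by (rule borel_measurable_continuous_onI)
  have trig_conv: "(\<lambda>n. \<integral>\<omega>. g (X n \<omega>) \<partial>P) \<longlonglongrightarrow> (\<integral>\<omega>. g (V \<omega>) \<partial>Q)"
    and trig_int: "integrable P (\<lambda>\<omega>. g (X n \<omega>))" "integrable Q (\<lambda>\<omega>. g (V \<omega>))" if "trig I g" for g n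
  proof -
    have int: "integrable P (\<lambda>\<omega>. g (X n \<omega>)) \<and> integrable Q (\<lambda>\<omega>. g (V \<omega>))" if "trig I g" for g n
    proof -
      obtain A where A: "\<And>x. \<bar>g x\<bar> \<le> A" using trig_bounded[OF \<open>trig I g\<close>] by blast
      show ?thesis
        using A measurable_compose[OF X trig_measurable[OF that]] measurable_compose[OF V trig_measurable[OF that]]
        by (auto intro!: P.integrable_const_bound[where B = A] Q.integrable_const_bound[where B = A])
    qed
    show "integrable P (\<lambda>\<omega>. g (X n \<omega>))" "integrable Q (\<lambda>\<omega>. g (V \<omega>))" using int[OF that] by auto
    show "(\<lambda>n. \<integral>\<omega>. g (X n \<omega>) \<partial>P) \<longlonglongrightarrow> (\<integral>\<omega>. g (V \<omega>) \<partial>Q)"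
      using that
    proof induction
      case (trig_cos c u)
      show ?case by (rule cos)
    next
      case (trig_add f g)
      then show ?case using int by (auto intro!: tendsto_add)
    next
      case (trig_scale f a)
      then show ?case by (auto intro!: tendsto_mult_left)
    qed
  qed
  fix r :: real assume r: "r > 0"
  \<comment> \<open>With this \<open>L\<close> the quadratic term contributes at most
    \<open>e\<close>; \<open>card I + 1\<close> keeps \<open>L\<close> positive for empty
    \<open>I\<close>. Two approximation errors of \<open>2 * e\<close> and one convergence error
    \<open>e\<close> stay below \<open>r\<close>.\<close>
  define e where "e = r / 8"
  define L where "L = sqrt ((2 * B + e) * real (card I + 1) / e)"
  have e: "e > 0" using r by (simp add: e_def)
  have L: "L > 0" "L\<^sup>2 = (2 * B + e) * real (card I + 1) / e"
    using B0 e by (auto simp: L_def intro!: divide_pos_pos mult_pos_pos add_nonneg_pos)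
  obtain g where g: "trig I g" "\<And>x. \<bar>f x - g x\<bar> \<le> e + (2 * B + e) * (\<Sum>i\<in>I. (x i / L)\<^sup>2)"
    using trig_approx[OF I f B dep e L(1)] by blast
  have approx: "\<bar>(\<integral>\<omega>. f (Y \<omega>) \<partial>M) - (\<integral>\<omega>. g (Y \<omega>) \<partial>M)\<bar> \<le> 2 * e"
    if M: "prob_space M" and Y: "Y \<in> borel_measurable M" and gY: "integrable M (\<lambda>\<omega>. g (Y \<omega>))"
      and Y2: "\<And>i. i \<in> I \<Longrightarrow> integrable M (\<lambda>\<omega>. (Y \<omega> i)\<^sup>2) \<and> (\<integral>\<omega>. (Y \<omega> i)\<^sup>2 \<partial>M) \<le> 1"
    for M :: "'z measure" and Y
  proof -
    interpret M: prob_space M by fact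
    have fY: "integrable M (\<lambda>\<omega>. f (Y \<omega>))"
      using measurable_compose[OF Y fm] B by (intro M.integrable_const_bound[where B = B]) auto
    have int: "integrable M (\<lambda>\<omega>. e + (2 * B + e) * (\<Sum>i\<in>I. (Y \<omega> i / L)\<^sup>2))"
      using Y2 by (auto simp: power_divide)
    have "\<bar>(\<integral>\<omega>. f (Y \<omega>) \<partial>M) - (\<integral>\<omega>. g (Y \<omega>) \<partial>M)\<bar> = \<bar>\<integral>\<omega>. f (Y \<omega>) - g (Y \<omega>) \<partial>M\<bar>"
      using fY gY by simp
    also have "\<dots> \<le> (\<integral>\<omega>. e + (2 * B + e) * (\<Sum>i\<in>I. (Y \<omega> i / L)\<^sup>2) \<partial>M)"
    proof -
      have "\<bar>\<integral>\<omega>. f (Y \<omega>) - g (Y \<omega>) \<partial>M\<bar> \<le> (\<integral>\<omega>. \<bar>f (Y \<omega>) - g (Y \<omega>)\<bar> \<partial>M)"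
        by (rule integral_abs_bound)
      also have "\<dots> \<le> (\<integral>\<omega>. e + (2 * B + e) * (\<Sum>i\<in>I. (Y \<omega> i / L)\<^sup>2) \<partial>M)"
        using fY gY int g(2) by (intro integral_mono) auto
      finally show ?thesis .
    qed
    also have "\<dots> = e + (2 * B + e) * (\<Sum>i\<in>I. (\<integral>\<omega>. (Y \<omega> i)\<^sup>2 \<partial>M) / L\<^sup>2)"
      using Y2 by (simp add: power_divide M.prob_space)
    also have "\<dots> \<le> e + (2 * B + e) * (\<Sum>i\<in>I. 1 / L\<^sup>2)"
      using Y2 B0 e by (intro add_left_mono mult_left_mono sum_mono divide_right_mono) auto
    also have "(2 * B + e) * (\<Sum>i\<in>I. 1 / L\<^sup>2) = e * (real (card I) / real (card I + 1))"
      using B0 e by (simp add: L(2))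
    also have "\<dots> \<le> e * 1" using e by (intro mult_left_mono) auto
    finally show ?thesis by simp
  qed
  obtain N where N: "\<And>n. n \<ge> N \<Longrightarrow> norm ((\<integral>\<omega>. g (X n \<omega>) \<partial>P) - (\<integral>\<omega>. g (V \<omega>) \<partial>Q)) < e"
    using LIMSEQ_D[OF trig_conv[OF g(1)] e] by blast
  show "\<exists>no. \<forall>n\<ge>no. norm ((\<integral>\<omega>. f (X n \<omega>) \<partial>P) - (\<integral>\<omega>. f (V \<omega>) \<partial>Q)) < r"
  proof (intro exI[of _ "max N 1"] allI impI)
    fix n assume n: "n \<ge> max N 1"
    have 1: "\<bar>(\<integral>\<omega>. f (X n \<omega>) \<partial>P) - (\<integral>\<omega>. g (X n \<omega>) \<partial>P)\<bar> \<le> 2 * e"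
      by (rule approx[OF P X trig_int(1)[OF g(1)] X2]) (use n in auto)
    have 2: "\<bar>(\<integral>\<omega>. f (V \<omega>) \<partial>Q) - (\<integral>\<omega>. g (V \<omega>) \<partial>Q)\<bar> \<le> 2 * e"
      by (rule approx[OF Q V trig_int(2)[OF g(1)] V2])
    show "norm ((\<integral>\<omega>. f (X n \<omega>) \<partial>P) - (\<integral>\<omega>. f (V \<omega>) \<partial>Q)) < r"
      using 1 2 N[of n] n r unfolding e_def real_norm_def by linarith
  qed
qed

lemma (in normal_sample) xi_convergence:
  fixes f :: "(nat \<Rightarrow> real) \<Rightarrow> real"
  assumes "finite I" "0 \<notin> I" "continuous_on UNIV f" "\<And>x. \<bar>f x\<bar> \<le> B"
    and "\<And>x y. (\<forall>i\<in>I. x i = y i) \<Longrightarrow> f x = f y"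
  shows "(\<lambda>n. \<integral>\<omega>. f (xi n \<omega>) \<partial>P) \<longlonglongrightarrow> (\<integral>x. f x \<partial>gauss_seq)"
proof (rule convergence_from_cos[OF prob_space_axioms prob_space_gauss_seq xi_measurable_seq _ assms(1) clt_cos[OF assms(1,2)]])
  show "(\<lambda>x. x) \<in> borel_measurable gauss_seq" unfolding measurable_gauss_seq by simp
  show "integrable P (\<lambda>\<omega>. (xi n \<omega> i)\<^sup>2) \<and> (\<integral>\<omega>. (xi n \<omega> i)\<^sup>2 \<partial>P) \<le> 1" if "n > 0" "i \<in> I" for n i
    using xi_second_moment[of i n] that assms(2) by (cases i) auto
  show "integrable gauss_seq (\<lambda>x. (x i)\<^sup>2) \<and> (\<integral>x. (x i)\<^sup>2 \<partial>gauss_seq) \<le> 1" for i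
    using gauss_seq_second_moment by simp
qed (use assms in auto)

section \<open>Hermite series in the weighted space\<close>

lemma bounded_partial_sums_mult:
  fixes a b :: "nat \<Rightarrow> real"
  assumes a: "\<And>n. (\<Sum>i<n. (a i)\<^sup>2) \<le> A" and b: "\<And>n. (\<Sum>i<n. (b i)\<^sup>2) \<le> B"
  shows "summable (\<lambda>i. a i * b i)" "\<bar>\<Sum>i. a i * b i\<bar> \<le> sqrt A * sqrt B"
proof -
  have "0 \<le> A" "0 \<le> B" using a[of 0] b[of 0] by simp_all
  have part: "(\<Sum>i<n. \<bar>a i * b i\<bar>) \<le> sqrt A * sqrt B" for n
  proof -
    have "(\<Sum>i<n. \<bar>a i\<bar> * \<bar>b i\<bar>) \<le> L2_set a {..<n} * L2_set b {..<n}"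
      by (rule L2_set_mult_ineq)
    also have "\<dots> \<le> sqrt A * sqrt B"
      unfolding L2_set_def using a b using \<open>0 \<le> A\<close> by (intro mult_mono real_sqrt_le_mono) (auto intro: sum_nonneg)
    finally show ?thesis by (simp add: abs_mult)
  qed
  then have s: "summable (\<lambda>i. \<bar>a i * b i\<bar>)"
    by (intro summableI_nonneg_bounded[where x = "sqrt A * sqrt B"]) auto
  then show "summable (\<lambda>i. a i * b i)" by (rule summable_rabs_cancel)
  have "\<bar>\<Sum>i. a i * b i\<bar> \<le> (\<Sum>i. \<bar>a i * b i\<bar>)" by (rule summable_rabs[OF s])
  also have "\<dots> \<le> sqrt A * sqrt B" by (rule suminf_le_const[OF s part])
  finally show "\<bar>\<Sum>i. a i * b i\<bar> \<le> sqrt A * sqrt B" .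
qed

text \<open>An exponential series in \<open>c * t\<^sup>2\<close>. The choice
  \<open>c = lam\<^sup>2\<close> is the source of the exponent
  \<open>1 + lam\<^sup>2\<close>.\<close>

lemma phi_square_sums: "(\<lambda>i. c ^ i * (phi i t)\<^sup>2) sums exp (t\<^sup>2 + c * t\<^sup>2)"
proof -
  have "(\<lambda>i. exp (t\<^sup>2) * ((c * t\<^sup>2) ^ i / fact i)) sums (exp (t\<^sup>2) * exp (c * t\<^sup>2))"
    using exp_converges[of "c * t\<^sup>2"] by (intro sums_mult) (simp add: divide_inverse_commute)
  moreover have "exp (t\<^sup>2) * ((c * t\<^sup>2) ^ i / fact i) = c ^ i * (phi i t)\<^sup>2" for i
  proof -
    have "exp (t\<^sup>2) = (exp (t\<^sup>2 / 2))\<^sup>2"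
      by (simp add: power2_eq_square flip: exp_add)
    then show ?thesis
      by (simp add: phi_def power_divide power_mult_distrib mult_ac flip: power_mult)
  qed
  ultimately show ?thesis by (simp add: exp_add)
qed

lemma phi_square_partial_sum: "0 \<le> c \<Longrightarrow> (\<Sum>i<n. c ^ i * (phi i t)\<^sup>2) \<le> exp (t\<^sup>2 + c * t\<^sup>2)"
  using phi_square_sums[of c t] by (intro sum_le_suminf[where I = "{..<n}", THEN order_trans]) (auto simp: sums_iff)

text \<open>The product of two \<open>phi i\<close> is a common Gaussian factor times the
  exponential series in \<open>t * s\<close>; its first three terms are those subtracted in the
  kernel.\<close>

lemma limit_kernel_sums: "(\<lambda>i. if i < 3 then 0 else phi i s * phi i t) sums limit_kernel s t"
proof -
  have eq: "phi i s * phi i t = exp ((t\<^sup>2 + s\<^sup>2) / 2) * ((t * s) ^ i / fact i)" for i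
    by (simp add: phi_def power_mult_distrib add_divide_distrib exp_add)
  have "(\<lambda>i. (t * s) ^ i / fact i) sums exp (t * s)"
    using exp_converges[of "t * s"] by (simp add: divide_inverse_commute)
  from sums_diff[OF this sums_If_finite_set[of "{..<3}" "\<lambda>i. (t * s) ^ i / fact i"]]
  have "(\<lambda>i. (t * s) ^ i / fact i - (if i < 3 then (t * s) ^ i / fact i else 0)) sums
      (exp (t * s) - (\<Sum>i<3. (t * s) ^ i / fact i))" by simp
  moreover have "(\<Sum>i<3. (t * s) ^ i / fact i) = 1 + t * s + t\<^sup>2 * s\<^sup>2 / 2"
    by (simp add: eval_nat_numeral)
  ultimately have "(\<lambda>i. exp ((t\<^sup>2 + s\<^sup>2) / 2) * ((t * s) ^ i / fact i - (if i < 3 then (t * s) ^ i / fact i else 0))) sums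
      limit_kernel s t" unfolding limit_kernel_def by (intro sums_mult) (simp add: diff_diff_eq)
  then show ?thesis unfolding eq by (rule sums_cong[THEN iffD1, rotated]) auto
qed

text \<open>A majorant uniform in \<open>n\<close> and factorized in \<open>s\<close> and
  \<open>t\<close>, for integrating the expansion term by term.\<close>

lemma limit_kernel_abs_partial_sum:
  "(\<Sum>i<n. \<bar>if i < 3 then 0 else phi i s * phi i t\<bar>) \<le> exp (s\<^sup>2) * exp (t\<^sup>2)"
proof -
  have "(\<Sum>i<n. \<bar>if i < 3 then 0 else phi i s * phi i t\<bar>) \<le> (\<Sum>i<n. \<bar>phi i s\<bar> * \<bar>phi i t\<bar>)"
    by (intro sum_mono) (auto simp: abs_mult)
  also have "\<dots> \<le> L2_set (\<lambda>i. phi i s) {..<n} * L2_set (\<lambda>i. phi i t) {..<n}"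
    by (rule L2_set_mult_ineq)
  also have "\<dots> \<le> exp (s\<^sup>2) * exp (t\<^sup>2)"
  proof -
    have "L2_set (\<lambda>i. phi i t) {..<n} \<le> exp (t\<^sup>2)" for t
    proof -
      have "(\<Sum>i<n. (phi i t)\<^sup>2) \<le> (exp (t\<^sup>2))\<^sup>2"
        using phi_square_partial_sum[where c = 1 and n = n and t = t] by (simp add: power2_eq_square flip: exp_add)
      then show ?thesis unfolding L2_set_def by (intro real_le_lsqrt) auto
    qed
    then show ?thesis by (intro mult_mono) (auto simp: L2_set_nonneg)
  qed
  finally show ?thesis .
qed

section \<open>The weighted measure, its Gaussian envelope and weighted coefficient
  sequences\<close>

lemma sets_weighted_lborel [measurable_cong]: "sets (weighted_lborel \<beta>) = sets borel"
  by (simp add: weighted_lborel_def)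

lemma space_weighted_lborel [simp]: "space (weighted_lborel \<beta>) = UNIV"
  by (simp add: weighted_lborel_def)

lemma measurable_weighted_lborel [simp]:
  "borel_measurable (weighted_lborel \<beta>) = (borel_measurable borel :: (real \<Rightarrow> 'b::topological_space) set)"
  by (rule measurable_cong_sets[OF sets_weighted_lborel refl])

lemma integrable_exp_neg_square:
  assumes "c > 0"
  shows "integrable lborel (\<lambda>t::real. exp (- c * t\<^sup>2))"
proof -
  define s where "s = sqrt (1 / (2 * c))"
  have s: "s\<^sup>2 = 1 / (2 * c)" "s > 0" using assms by (auto simp: s_def)
  have "integrable lborel (\<lambda>t. sqrt (2 * pi * s\<^sup>2) * normal_density 0 s t)"
    by (intro integrable_mult_right integrable_normal_density s(2))
  moreover have "sqrt (2 * pi * s\<^sup>2) * normal_density 0 s t = exp (- c * t\<^sup>2)" for t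
  proof -
    have "sqrt (2 * pi * s\<^sup>2) > 0" using s(2) by simp
    then have "sqrt (2 * pi * s\<^sup>2) * normal_density 0 s t = exp (- (t - 0)\<^sup>2 / (2 * s\<^sup>2))"
      using s(2) unfolding normal_density_def by simp
    then show ?thesis using assms by (simp add: s(1) field_simps)
  qed
  ultimately show ?thesis by simp
qed

text \<open>The weighted sums of \<open>(lam\<^sup>2) ^ i * (phi i t)\<^sup>2\<close> cost the
  exponent \<open>1 + lam\<^sup>2\<close>, and perturbing mean and scale costs
  \<open>2 * ln lam\<close>. At \<open>lam = 1\<close> the sum of these is 2, so a suitable
  \<open>lam\<close> exists whenever \<beta> > 2.\<close>

locale growth =
  fixes \<beta> lam :: real
  assumes lam: "lam > 1" and growth: "1 + 2 * ln lam + lam\<^sup>2 < \<beta>"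
begin

definition "\<rho> = 1 + 2 * ln lam + lam\<^sup>2"

abbreviation "H \<equiv> weighted_lborel \<beta>"

definition "KH = (\<integral>t. (exp (\<rho> * t\<^sup>2 / 2))\<^sup>2 \<partial>H)"

lemma rho: "2 \<le> \<rho>" "\<rho> < \<beta>" "1 + lam\<^sup>2 \<le> \<rho>"
proof -
  have "0 < ln lam" using lam by simp
  moreover have "1 \<le> lam\<^sup>2" using lam by (intro one_le_power) simp
  ultimately show "2 \<le> \<rho>" "1 + lam\<^sup>2 \<le> \<rho>" by (auto simp: \<rho>_def)
  show "\<rho> < \<beta>" using growth by (simp add: \<rho>_def)
qed

lemma exp_rho_sq_integrable: "(\<lambda>t. exp (\<rho> * t\<^sup>2 / 2)) \<in> sq_integrable H"
proof -
  have "integrable lborel (\<lambda>t. exp (- (\<beta> - \<rho>) * t\<^sup>2))"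
    using rho by (intro integrable_exp_neg_square) simp
  moreover have "exp (- (\<beta> - \<rho>) * t\<^sup>2) = exp (- \<beta> * t\<^sup>2) *\<^sub>R (exp (\<rho> * t\<^sup>2 / 2))\<^sup>2" for t
    by (simp add: power2_eq_square algebra_simps flip: exp_add)
  ultimately have "integrable H (\<lambda>t. (exp (\<rho> * t\<^sup>2 / 2))\<^sup>2)"
    unfolding weighted_lborel_def by (subst integrable_density) auto
  then show ?thesis by (simp add: sq_integrable_def)
qed

lemma sq_integrable_bound:
  assumes "f \<in> borel_measurable borel" "\<And>t. \<bar>f t\<bar> \<le> c * exp (\<rho> * t\<^sup>2 / 2)"
  shows "f \<in> sq_integrable H" "(\<integral>t. (f t)\<^sup>2 \<partial>H) \<le> c\<^sup>2 * KH"
proof -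
  have int: "integrable H (\<lambda>t. c\<^sup>2 * (exp (\<rho> * t\<^sup>2 / 2))\<^sup>2)"
    using exp_rho_sq_integrable by (simp add: sq_integrable_def)
  have le: "(f t)\<^sup>2 \<le> c\<^sup>2 * (exp (\<rho> * t\<^sup>2 / 2))\<^sup>2" for t
    using power_mono[OF assms(2)[of t], of 2] by (simp add: power_mult_distrib)
  have f: "integrable H (\<lambda>t. (f t)\<^sup>2)"
    using le assms(1) by (intro Bochner_Integration.integrable_bound[OF int]) auto
  then show "f \<in> sq_integrable H"
    using assms(1) by (simp add: sq_integrable_def)
  have "(\<integral>t. (f t)\<^sup>2 \<partial>H) \<le> (\<integral>t. c\<^sup>2 * (exp (\<rho> * t\<^sup>2 / 2))\<^sup>2 \<partial>H)"
    using le by (intro integral_mono f int)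
  then show "(\<integral>t. (f t)\<^sup>2 \<partial>H) \<le> c\<^sup>2 * KH" by (simp add: KH_def)
qed

text \<open>The passage from pointwise estimates to the Hilbert space: the analysis below only has
  to produce multiples of one fixed envelope.\<close>

lemma L2_dist_bound:
  assumes "f \<in> sq_integrable H" "g \<in> sq_integrable H" "\<And>t. \<bar>f t - g t\<bar> \<le> c * exp (\<rho> * t\<^sup>2 / 2)"
  shows "L2_dist H (L2_class H f) (L2_class H g) \<le> c * sqrt KH"
proof -
  have [measurable]: "f \<in> borel_measurable borel" "g \<in> borel_measurable borel"
    using assms by (auto simp: sq_integrable_def)
  have "0 \<le> c" using assms(3)[of 0] by simp
  have "(\<integral>t. (f t - g t)\<^sup>2 \<partial>H) \<le> c\<^sup>2 * KH"
    by (rule sq_integrable_bound(2)) (use assms(3) in auto)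
  then have "sqrt (\<integral>t. (f t - g t)\<^sup>2 \<partial>H) \<le> sqrt (c\<^sup>2 * KH)" by (rule real_sqrt_le_mono)
  then show ?thesis using \<open>0 \<le> c\<close> by (simp add: L2_dist_class[OF assms(1,2)] real_sqrt_mult)
qed

lemma exp_square_le_exp_rho: "exp (t\<^sup>2) \<le> exp (\<rho> * t\<^sup>2 / 2)"
  using mult_right_mono[OF rho(1), of "t\<^sup>2"] by simp

lemma phi_bound: "\<bar>phi i t\<bar> \<le> exp (\<rho> * t\<^sup>2 / 2)"
proof -
  have "(phi i t)\<^sup>2 \<le> (\<Sum>j<Suc i. 1 ^ j * (phi j t)\<^sup>2)"
    by (simp add: sum_nonneg)
  also have "\<dots> \<le> exp (t\<^sup>2 + 1 * t\<^sup>2)" by (rule phi_square_partial_sum) simp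
  also have "\<dots> = (exp (t\<^sup>2))\<^sup>2" by (simp add: power2_eq_square flip: exp_add)
  finally have "\<bar>phi i t\<bar> \<le> exp (t\<^sup>2)" by (simp add: abs_le_square_iff[symmetric])
  then show ?thesis using exp_square_le_exp_rho order_trans by blast
qed

lemma phi_sq_integrable: "phi i \<in> sq_integrable H"
  by (rule sq_integrable_bound(1)[where c = 1]) (use phi_bound in auto)

text \<open>By Cauchy-Schwarz with weights \<open>lam ^ i\<close>, finiteness of this sum bounds Hermite series
  pointwise; its expectation is at most a geometric series when the coefficients have second
  moment at most \<open>1\<close>.\<close>

definition seq_norm :: "(nat \<Rightarrow> real) \<Rightarrow> ennreal" where
  "seq_norm x = (\<Sum>i. ennreal ((x i)\<^sup>2 / lam ^ i))"

lemma seq_norm_partial_sum: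
  assumes "seq_norm x \<le> ennreal M" "0 \<le> M"
  shows "(\<Sum>i<n. (x i)\<^sup>2 / lam ^ i) \<le> M"
proof -
  have "ennreal (\<Sum>i<n. (x i)\<^sup>2 / lam ^ i) = (\<Sum>i<n. ennreal ((x i)\<^sup>2 / lam ^ i))"
    using lam by (intro sum_ennreal[symmetric]) auto
  also have "\<dots> \<le> seq_norm x" unfolding seq_norm_def by (rule sum_le_suminf) auto
  also have "\<dots> \<le> ennreal M" by (rule assms)
  finally show ?thesis using assms(2) by (simp add: ennreal_le_iff)
qed

lemma weighted_series_bound:
  assumes x: "seq_norm x \<le> ennreal M" "0 \<le> M"
    and b: "\<And>n. (\<Sum>i<n. lam ^ i * (b i)\<^sup>2) \<le> B"
  shows "summable (\<lambda>i. x i * b i)" "\<bar>\<Sum>i. x i * b i\<bar> \<le> sqrt M * sqrt B"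
proof -
  have *: "(\<Sum>i<n. (x i / sqrt (lam ^ i))\<^sup>2) \<le> M" "(\<Sum>i<n. (sqrt (lam ^ i) * b i)\<^sup>2) \<le> B" for n
    using seq_norm_partial_sum[OF x, of n] b[of n] lam by (simp_all add: power_divide power_mult_distrib)
  have "x i / sqrt (lam ^ i) * (sqrt (lam ^ i) * b i) = x i * b i" for i using lam by simp
  then show "summable (\<lambda>i. x i * b i)" "\<bar>\<Sum>i. x i * b i\<bar> \<le> sqrt M * sqrt B"
    using bounded_partial_sums_mult[of "\<lambda>i. x i / sqrt (lam ^ i)" M "\<lambda>i. sqrt (lam ^ i) * b i" B, OF *]
    by simp_all
qed

definition herm_part :: "nat \<Rightarrow> (nat \<Rightarrow> real) \<Rightarrow> real \<Rightarrow> real" where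
  "herm_part m x t = (\<Sum>i\<in>{3..<m}. x i * phi i t)"

definition herm_series :: "(nat \<Rightarrow> real) \<Rightarrow> real \<Rightarrow> real" where
  "herm_series x t = (\<Sum>i. x i * (if i < 3 then 0 else phi i t))"

text \<open>For \<open>i \<ge> m\<close> one has
  \<open>lam ^ i \<le> (lam\<^sup>2) ^ i / lam ^ m\<close>: a second factor \<open>lam ^ i\<close>
  is spent to gain geometric decay in \<open>m\<close>.\<close>

lemma series_tail_bound:
  assumes x: "seq_norm x \<le> ennreal M" "0 \<le> M"
  shows "summable (\<lambda>i. x i * (if i < m then 0 else phi i t))"
    "\<bar>\<Sum>i. x i * (if i < m then 0 else phi i t)\<bar> \<le> sqrt (M / lam ^ m) * exp (\<rho> * t\<^sup>2 / 2)"
proof -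
  have b: "(\<Sum>i<n. lam ^ i * (if i < m then 0 else phi i t)\<^sup>2) \<le> (exp (\<rho> * t\<^sup>2 / 2))\<^sup>2 / lam ^ m" for n
  proof -
    have "(\<Sum>i<n. lam ^ i * (if i < m then 0 else phi i t)\<^sup>2) \<le> (\<Sum>i<n. (lam\<^sup>2) ^ i * (phi i t)\<^sup>2 / lam ^ m)"
    proof (rule sum_mono)
      fix i assume "i \<in> {..<n}"
      have "lam ^ i * (phi i t)\<^sup>2 \<le> (lam\<^sup>2) ^ i * (phi i t)\<^sup>2 / lam ^ m" if "m \<le> i"
      proof -
        have "lam ^ i * lam ^ m \<le> lam ^ i * lam ^ i"
          using lam that by (intro mult_left_mono power_increasing) auto
        then have "lam ^ i \<le> (lam\<^sup>2) ^ i / lam ^ m"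
          using lam by (simp add: field_simps power2_eq_square power_mult_distrib)
        from mult_right_mono[OF this, of "(phi i t)\<^sup>2"] show ?thesis by simp
      qed
      then show "lam ^ i * (if i < m then 0 else phi i t)\<^sup>2 \<le> (lam\<^sup>2) ^ i * (phi i t)\<^sup>2 / lam ^ m"
        using lam by auto
    qed
    also have "\<dots> \<le> exp (t\<^sup>2 + lam\<^sup>2 * t\<^sup>2) / lam ^ m"
      unfolding sum_divide_distrib[symmetric] using lam
      by (intro divide_right_mono phi_square_partial_sum) auto
    also have "\<dots> \<le> (exp (\<rho> * t\<^sup>2 / 2))\<^sup>2 / lam ^ m"
    proof -
      have "t\<^sup>2 + lam\<^sup>2 * t\<^sup>2 \<le> \<rho> * t\<^sup>2"
        using mult_right_mono[OF rho(3), of "t\<^sup>2"] by (simp add: distrib_right)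
      then have "exp (t\<^sup>2 + lam\<^sup>2 * t\<^sup>2) \<le> (exp (\<rho> * t\<^sup>2 / 2))\<^sup>2"
        by (simp flip: exp_of_nat_mult)
      then show ?thesis using lam by (intro divide_right_mono) auto
    qed
    finally show ?thesis .
  qed
  show "summable (\<lambda>i. x i * (if i < m then 0 else phi i t))"
    by (rule weighted_series_bound(1)[OF x b])
  have "\<bar>\<Sum>i. x i * (if i < m then 0 else phi i t)\<bar> \<le> sqrt M * sqrt ((exp (\<rho> * t\<^sup>2 / 2))\<^sup>2 / lam ^ m)"
    by (rule weighted_series_bound(2)[OF x b])
  then show "\<bar>\<Sum>i. x i * (if i < m then 0 else phi i t)\<bar> \<le> sqrt (M / lam ^ m) * exp (\<rho> * t\<^sup>2 / 2)"
    by (simp add: real_sqrt_divide)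
qed

lemma herm_series_minus_part:
  assumes x: "seq_norm x \<le> ennreal M" "0 \<le> M" and m: "3 \<le> m"
  shows "\<bar>herm_series x t - herm_part m x t\<bar> \<le> sqrt (M / lam ^ m) * exp (\<rho> * t\<^sup>2 / 2)"
proof -
  have "(\<lambda>i. if i \<in> {3..<m} then x i * phi i t else 0) sums herm_part m x t"
    unfolding herm_part_def by (rule sums_If_finite_set) simp
  from sums_diff[OF summable_sums[OF series_tail_bound(1)[OF x, of 3 t]] this]
  have "(\<lambda>i. x i * (if i < 3 then 0 else phi i t) - (if i \<in> {3..<m} then x i * phi i t else 0)) sums
      (herm_series x t - herm_part m x t)" unfolding herm_series_def .
  moreover have "x i * (if i < 3 then 0 else phi i t) - (if i \<in> {3..<m} then x i * phi i t else 0) =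
      x i * (if i < m then 0 else phi i t)" for i using m by auto
  ultimately have "herm_series x t - herm_part m x t = (\<Sum>i. x i * (if i < m then 0 else phi i t))"
    by (simp add: sums_iff)
  then show ?thesis using series_tail_bound(2)[OF x, of m t] by simp
qed

lemma herm_part_measurable [measurable]: "herm_part m x \<in> borel_measurable borel"
  unfolding herm_part_def by measurable

lemma herm_part_diff_bound:
  "\<bar>herm_part m x t - herm_part m y t\<bar> \<le> (\<Sum>i\<in>{3..<m}. \<bar>x i - y i\<bar>) * exp (\<rho> * t\<^sup>2 / 2)"
proof -
  have "\<bar>herm_part m x t - herm_part m y t\<bar> = \<bar>\<Sum>i\<in>{3..<m}. (x i - y i) * phi i t\<bar>"
    unfolding herm_part_def by (simp add: sum_subtractf left_diff_distrib)
  also have "\<dots> \<le> (\<Sum>i\<in>{3..<m}. \<bar>x i - y i\<bar> * exp (\<rho> * t\<^sup>2 / 2))"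
    by (rule order_trans[OF sum_abs]) (auto simp: abs_mult intro!: sum_mono mult_left_mono phi_bound)
  finally show ?thesis by (simp add: sum_distrib_right)
qed

lemma herm_part_sq_integrable: "herm_part m x \<in> sq_integrable H"
proof (rule sq_integrable_bound(1))
  show "\<bar>herm_part m x t\<bar> \<le> (\<Sum>i\<in>{3..<m}. \<bar>x i\<bar>) * exp (\<rho> * t\<^sup>2 / 2)" for t
    using herm_part_diff_bound[of m x t "\<lambda>_. 0"] by (simp add: herm_part_def)
qed measurable

lemma herm_series_measurable [measurable]: "herm_series x \<in> borel_measurable borel"
proof -
  have "(\<lambda>t. \<Sum>i. x i * (if i < 3 then 0 else phi i t)) \<in> borel_measurable borel" by measurable
  then show ?thesis by (simp add: herm_series_def[abs_def])
qed

lemma herm_series_sq_integrable: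
  assumes "seq_norm x < \<infinity>"
  shows "herm_series x \<in> sq_integrable H"
proof -
  obtain M where M: "seq_norm x = ennreal M" "0 \<le> M"
    using assms by (cases "seq_norm x") auto
  show ?thesis
  proof (rule sq_integrable_bound(1))
    show "\<bar>herm_series x t\<bar> \<le> sqrt (M / lam ^ 3) * exp (\<rho> * t\<^sup>2 / 2)" for t
      using herm_series_minus_part[of x M 3 t] M by (simp add: herm_part_def)
  qed measurable
qed

lemma Metric_space_H: "Metric_space (L2_space H) (L2_dist H)"
  by (rule Metric_space_L2)

text \<open>Only finitely many coordinates enter, so continuity holds for the product topology. A
  continuous functional of the truncation is therefore a test function for the finite-dimensional
  central limit theorem.\<close>

lemma continuous_herm_part:
  "continuous_map euclidean (L2_topology H) (\<lambda>x. L2_class H (herm_part m x))"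
  unfolding L2_topology_def Metric_space.continuous_map_to_metric[OF Metric_space_H]
proof (intro ballI allI impI)
  fix x :: "nat \<Rightarrow> real" and e :: real assume e: "e > 0"
  define U where "U = {y. (\<Sum>i\<in>{3..<m}. \<bar>x i - y i\<bar>) * sqrt KH < e}"
  have "open U" unfolding U_def
    by (intro open_Collect_less continuous_intros continuous_on_product_coordinates)
  moreover have "x \<in> U" using e by (simp add: U_def)
  moreover have "L2_class H (herm_part m y) \<in> Metric_space.mball (L2_space H) (L2_dist H) (L2_class H (herm_part m x)) e"
    if "y \<in> U" for y
  proof -
    have "L2_dist H (L2_class H (herm_part m x)) (L2_class H (herm_part m y)) \<le> (\<Sum>i\<in>{3..<m}. \<bar>x i - y i\<bar>) * sqrt KH"
      by (intro L2_dist_bound herm_part_sq_integrable herm_part_diff_bound)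
    then show ?thesis using that
      by (simp add: U_def Metric_space.in_mball[OF Metric_space_H] L2_class_in_space herm_part_sq_integrable)
  qed
  ultimately show "\<exists>U. openin euclidean U \<and> x \<in> U \<and> (\<forall>y\<in>U. L2_class H (herm_part m y) \<in>
      Metric_space.mball (L2_space H) (L2_dist H) (L2_class H (herm_part m x)) e)"
    by (intro exI[of _ U]) auto
qed

lemma seq_norm_measurable: "seq_norm \<in> borel_measurable borel"
proof -
  have [measurable]: "(\<lambda>x::nat \<Rightarrow> real. x i) \<in> borel_measurable borel" for i
    by (rule component_borel_measurable)
  show ?thesis unfolding seq_norm_def by measurable
qed

lemma seq_norm_expectation:
  fixes Q :: "'v measure"
  assumes [measurable]: "\<And>i. (\<lambda>\<omega>. V \<omega> i) \<in> borel_measurable Q"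
    and V2: "\<And>i. integrable Q (\<lambda>\<omega>. (V \<omega> i)\<^sup>2) \<and> (\<integral>\<omega>. (V \<omega> i)\<^sup>2 \<partial>Q) \<le> 1"
  shows "(\<integral>\<^sup>+\<omega>. seq_norm (V \<omega>) \<partial>Q) \<le> ennreal (lam / (lam - 1))"
proof -
  have "(\<integral>\<^sup>+\<omega>. seq_norm (V \<omega>) \<partial>Q) = (\<Sum>i. \<integral>\<^sup>+\<omega>. ennreal ((V \<omega> i)\<^sup>2 / lam ^ i) \<partial>Q)"
    unfolding seq_norm_def by (rule nn_integral_suminf) measurable
  also have "\<dots> \<le> (\<Sum>i. ennreal ((1 / lam) ^ i))"
  proof (rule suminf_le)
    fix i
    have "(\<integral>\<^sup>+\<omega>. ennreal ((V \<omega> i)\<^sup>2 / lam ^ i) \<partial>Q) = ennreal (\<integral>\<omega>. (V \<omega> i)\<^sup>2 / lam ^ i \<partial>Q)"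
      using V2[of i] lam by (intro nn_integral_eq_integral) auto
    also have "\<dots> \<le> ennreal ((1 / lam) ^ i)"
      using V2[of i] lam by (intro ennreal_leI) (simp add: power_one_over divide_simps)
    finally show "(\<integral>\<^sup>+\<omega>. ennreal ((V \<omega> i)\<^sup>2 / lam ^ i) \<partial>Q) \<le> ennreal ((1 / lam) ^ i)" .
  qed auto
  also have "\<dots> = ennreal (\<Sum>i. (1 / lam) ^ i)"
    using lam by (intro suminf_ennreal2) (auto intro: summable_geometric)
  also have "(\<Sum>i. (1 / lam) ^ i) = lam / (lam - 1)"
    using lam by (subst suminf_geometric) (auto simp: field_simps)
  finally show ?thesis .
qed

lemma gauss_seq_norm: "(\<integral>\<^sup>+x. seq_norm x \<partial>gauss_seq) \<le> ennreal (lam / (lam - 1))"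
  by (rule seq_norm_expectation) (auto simp: gauss_seq_second_moment)

lemma AE_gauss_seq_norm: "AE x in gauss_seq. seq_norm x < \<infinity>"
proof -
  have "AE x in gauss_seq. seq_norm x \<noteq> \<infinity>"
  proof (rule nn_integral_PInf_AE)
    show "seq_norm \<in> borel_measurable gauss_seq" unfolding measurable_gauss_seq by (rule seq_norm_measurable)
    show "(\<integral>\<^sup>+x. seq_norm x \<partial>gauss_seq) \<noteq> \<infinity>"
      using gauss_seq_norm by (auto simp: top_unique)
  qed
  then show ?thesis by eventually_elim (simp add: less_top)
qed

text \<open>Convergence of the series is known only for finite \<open>seq_norm\<close>. On the
  remaining null set the zero function keeps every value inside \<open>L2_space H\<close>.\<close>

definition gauss_limit :: "(nat \<Rightarrow> real) \<Rightarrow> (real \<Rightarrow> real) set" where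
  "gauss_limit x = L2_class H (if seq_norm x < \<infinity> then herm_series x else (\<lambda>_. 0))"

lemma zero_sq_integrable: "(\<lambda>_. 0) \<in> sq_integrable M"
  by (simp add: sq_integrable_def)

text \<open>The classes of the partial sums are continuous in the coefficients and approach the
  limit in distance; on the null set both are the zero class.\<close>

lemma gauss_limit_measurable: "gauss_limit \<in> gauss_seq \<rightarrow>\<^sub>M borel_of_topology (L2_topology H)"
  unfolding L2_topology_def
proof (rule Metric_space.measurable_limit[OF Metric_space_H])
  define f where "f m x = (if seq_norm x < \<infinity> then L2_class H (herm_part m x) else L2_class H (\<lambda>_. 0))" for m x
  have fin: "{x. seq_norm x < \<infinity>} \<in> sets gauss_seq"
  proof -
    have "{x \<in> space borel. seq_norm x < \<infinity>} \<in> sets borel"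
      using seq_norm_measurable by measurable
    then show ?thesis by (simp add: sets_gauss_seq)
  qed
  have "(\<lambda>x. L2_class H (herm_part m x)) \<in> gauss_seq \<rightarrow>\<^sub>M borel_of_topology (L2_topology H)" for m
    by (rule measurable_continuous_map_borel[OF _ continuous_herm_part]) (simp add: measurable_gauss_seq)
  moreover have "topspace (L2_topology H) = L2_space H"
    by (simp add: L2_topology_def Metric_space.topspace_mtopology[OF Metric_space_H])
  ultimately show "f m \<in> gauss_seq \<rightarrow>\<^sub>M borel_of_topology (Metric_space.mtopology (L2_space H) (L2_dist H))" for m
    unfolding f_def L2_topology_def using fin
    by (intro measurable_If) (auto simp: L2_class_in_space zero_sq_integrable L2_topology_def)
  show "gauss_limit x \<in> L2_space H" for x
    unfolding gauss_limit_def using herm_series_sq_integrable zero_sq_integrable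
    by (intro L2_class_in_space) auto
  show "(\<lambda>m. L2_dist H (f m x) (gauss_limit x)) \<longlonglongrightarrow> 0" for x
  proof (cases "seq_norm x < \<infinity>")
    case False
    then have "L2_dist H (f m x) (gauss_limit x) = 0" for m
      using L2_dist_class[OF zero_sq_integrable zero_sq_integrable] by (simp add: f_def gauss_limit_def)
    then show ?thesis by simp
  next
    case True
    then obtain M where M: "seq_norm x = ennreal M" "0 \<le> M"
      by (cases "seq_norm x") auto
    have "\<forall>\<^sub>F m in sequentially. norm (L2_dist H (f m x) (gauss_limit x)) \<le> sqrt (M * (1 / lam) ^ m) * sqrt KH"
      using eventually_ge_at_top[of 3]
    proof eventually_elim
      case (elim m)
      have "L2_dist H (L2_class H (herm_part m x)) (L2_class H (herm_series x)) \<le> sqrt (M / lam ^ m) * sqrt KH"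
        using herm_series_minus_part[of x M m] M elim
        by (intro L2_dist_bound herm_part_sq_integrable herm_series_sq_integrable True)
           (simp add: abs_minus_commute)
      moreover have "0 \<le> L2_dist H (L2_class H (herm_part m x)) (L2_class H (herm_series x))"
        by (rule Metric_space.nonneg[OF Metric_space_H])
      ultimately show ?case using True by (simp add: f_def gauss_limit_def power_one_over)
    qed
    moreover have "(\<lambda>m. sqrt (M * (1 / lam) ^ m) * sqrt KH) \<longlonglongrightarrow> sqrt (M * 0) * sqrt KH"
      using lam by (intro tendsto_intros LIMSEQ_power_zero) simp
    ultimately show ?thesis by (simp add: Lim_null_comparison)
  qed
qed

end

section \<open>The limit is a Gaussian element with the given covariance kernel\<close>

context growth begin

lemma sigma_finite_H: "sigma_finite_measure H"
  unfolding weighted_lborel_def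
  by (subst sigma_finite_measure.sigma_finite_iff_density_finite[OF sigma_finite_lborel]) auto

text \<open>The zeros at indices below 3 let sums over all indices replace sums starting at
  3.\<close>

definition phi_coeff :: "(real \<Rightarrow> real) \<Rightarrow> nat \<Rightarrow> real" where
  "phi_coeff f i = (if i < 3 then 0 else \<integral>t. phi i t * f t \<partial>H)"

lemma phi_coeff_sum: "(\<integral>t. herm_part m x t * f t \<partial>H) = (\<Sum>i<m. phi_coeff f i * x i)"
  if "f \<in> sq_integrable H"
proof -
  have "(\<integral>t. herm_part m x t * f t \<partial>H) = (\<integral>t. (\<Sum>i\<in>{3..<m}. x i * (phi i t * f t)) \<partial>H)"
    by (simp add: herm_part_def sum_distrib_right mult.assoc)
  also have "\<dots> = (\<Sum>i\<in>{3..<m}. x i * (\<integral>t. phi i t * f t \<partial>H))"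
    using sq_integrable_mult[OF phi_sq_integrable that]
    by (subst Bochner_Integration.integral_sum) auto
  also have "\<dots> = (\<Sum>i<m. phi_coeff f i * x i)"
    by (rule sum.mono_neutral_cong_left) (auto simp: phi_coeff_def)
  finally show ?thesis .
qed

lemma exp_square_mult_integrable:
  assumes "f \<in> sq_integrable H"
  shows "integrable H (\<lambda>t. exp (t\<^sup>2) * \<bar>f t\<bar>)"
proof -
  have "(\<lambda>t. exp (t\<^sup>2)) \<in> sq_integrable H"
    by (rule sq_integrable_bound(1)[where c = 1]) (use exp_square_le_exp_rho in auto)
  moreover have "(\<lambda>t. \<bar>f t\<bar>) \<in> sq_integrable H"
    using assms by (auto simp: sq_integrable_def)
  ultimately show ?thesis by (rule sq_integrable_mult)
qed

context
  fixes f g assumes f: "f \<in> sq_integrable H" and g: "g \<in> sq_integrable H"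
begin

text \<open>The majorant is a product of one function of \<open>s\<close> and one of
  \<open>t\<close>, each integrable because \<open>exp (t\<^sup>2)\<close> lies in the weighted
  space.\<close>

lemma kernel_dominant_integrable:
  "integrable (H \<Otimes>\<^sub>M H) (\<lambda>(s, t). (exp (s\<^sup>2) * \<bar>f s\<bar>) * (exp (t\<^sup>2) * \<bar>g t\<bar>))"
proof -
  interpret H: sigma_finite_measure H by (rule sigma_finite_H)
  interpret pair_sigma_finite H H ..
  have [measurable]: "f \<in> borel_measurable borel" "g \<in> borel_measurable borel"
    using f g by (auto simp: sq_integrable_def)
  show ?thesis
  proof (rule Fubini_integrable)
    show "(\<lambda>(s, t). (exp (s\<^sup>2) * \<bar>f s\<bar>) * (exp (t\<^sup>2) * \<bar>g t\<bar>)) \<in> borel_measurable (H \<Otimes>\<^sub>M H)"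
      by measurable
    have "(\<integral>t. norm ((exp (s\<^sup>2) * \<bar>f s\<bar>) * (exp (t\<^sup>2) * \<bar>g t\<bar>)) \<partial>H) =
        (exp (s\<^sup>2) * \<bar>f s\<bar>) * (\<integral>t. exp (t\<^sup>2) * \<bar>g t\<bar> \<partial>H)" for s
      by (simp add: abs_mult)
    then show "integrable H (\<lambda>s. \<integral>t. norm (case (s, t) of (s, t) \<Rightarrow> (exp (s\<^sup>2) * \<bar>f s\<bar>) * (exp (t\<^sup>2) * \<bar>g t\<bar>)) \<partial>H)"
      using integrable_mult_left[OF exp_square_mult_integrable[OF f]] by simp
  qed (use exp_square_mult_integrable[OF g] in auto)
qed

lemma kernel_bound: "\<bar>limit_kernel s t * f s * g t\<bar> \<le> (exp (s\<^sup>2) * \<bar>f s\<bar>) * (exp (t\<^sup>2) * \<bar>g t\<bar>)"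
proof -
  have "\<bar>limit_kernel s t\<bar> \<le> exp (s\<^sup>2) * exp (t\<^sup>2)"
  proof -
    let ?c = "\<lambda>i. if i < 3 then 0 else phi i s * phi i t"
    have s: "summable (\<lambda>i. \<bar>?c i\<bar>)"
      using limit_kernel_abs_partial_sum by (intro summableI_nonneg_bounded) auto
    have "\<bar>limit_kernel s t\<bar> = \<bar>\<Sum>i. ?c i\<bar>"
      using limit_kernel_sums[of s t] by (simp add: sums_iff)
    also have "\<dots> \<le> (\<Sum>i. \<bar>?c i\<bar>)" by (rule summable_rabs[OF s])
    also have "\<dots> \<le> exp (s\<^sup>2) * exp (t\<^sup>2)"
      by (rule suminf_le_const[OF s limit_kernel_abs_partial_sum])
    finally show ?thesis .
  qed
  from mult_right_mono[OF this, of "\<bar>f s\<bar> * \<bar>g t\<bar>"] show ?thesis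
    by (simp add: abs_mult mult_ac)
qed

lemma kernel_integrable: "integrable (H \<Otimes>\<^sub>M H) (\<lambda>(s, t). limit_kernel s t * f s * g t)"
proof (rule Bochner_Integration.integrable_bound[OF kernel_dominant_integrable])
  have [measurable]: "f \<in> borel_measurable borel" "g \<in> borel_measurable borel"
    using f g by (auto simp: sq_integrable_def)
  show "(\<lambda>(s, t). limit_kernel s t * f s * g t) \<in> borel_measurable (H \<Otimes>\<^sub>M H)"
    unfolding limit_kernel_def by measurable
  have "norm (limit_kernel s t * f s * g t) \<le> norm ((exp (s\<^sup>2) * \<bar>f s\<bar>) * (exp (t\<^sup>2) * \<bar>g t\<bar>))" for s t
    using kernel_bound[of s t] by simp
  then show "AE x in H \<Otimes>\<^sub>M H. norm (case x of (s, t) \<Rightarrow> limit_kernel s t * f s * g t)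
      \<le> norm (case x of (s, t) \<Rightarrow> (exp (s\<^sup>2) * \<bar>f s\<bar>) * (exp (t\<^sup>2) * \<bar>g t\<bar>))"
    by (auto simp only: split_beta intro!: AE_I2)
qed

text \<open>Fubini turns a partial sum of the kernel expansion into a partial sum of coefficient
  products; dominated convergence on the product space does the rest.\<close>

lemma kernel_coeff_sums:
  "(\<lambda>i. phi_coeff f i * phi_coeff g i) sums (\<integral>s. (\<integral>t. limit_kernel s t * f s * g t \<partial>H) \<partial>H)"
proof -
  interpret H: sigma_finite_measure H by (rule sigma_finite_H)
  interpret pair_sigma_finite H H ..
  have [measurable]: "f \<in> borel_measurable borel" "g \<in> borel_measurable borel"
    using f g by (auto simp: sq_integrable_def)
  define c where "c i s t = (if i < 3 then 0 else phi i s * phi i t)" for i :: nat and s t :: real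
  have dom: "\<bar>(\<Sum>i<n. c i s t) * f s * g t\<bar> \<le> (exp (s\<^sup>2) * \<bar>f s\<bar>) * (exp (t\<^sup>2) * \<bar>g t\<bar>)" for n s t
  proof -
    have "\<bar>\<Sum>i<n. c i s t\<bar> \<le> exp (s\<^sup>2) * exp (t\<^sup>2)"
      unfolding c_def by (rule order_trans[OF sum_abs limit_kernel_abs_partial_sum])
    from mult_right_mono[OF this, of "\<bar>f s\<bar> * \<bar>g t\<bar>"] show ?thesis
      by (simp add: abs_mult mult_ac)
  qed
  have cm [measurable]: "(\<lambda>(s, t). (\<Sum>i<n. c i s t) * f s * g t) \<in> borel_measurable (H \<Otimes>\<^sub>M H)" for n
    unfolding c_def by measurable
  have int: "integrable (H \<Otimes>\<^sub>M H) (\<lambda>(s, t). (\<Sum>i<n. c i s t) * f s * g t)" for n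
  proof (rule Bochner_Integration.integrable_bound[OF kernel_dominant_integrable cm])
    have "norm ((\<Sum>i<n. c i s t) * f s * g t) \<le> norm ((exp (s\<^sup>2) * \<bar>f s\<bar>) * (exp (t\<^sup>2) * \<bar>g t\<bar>))" for s t
      using dom[where n = n and s = s and t = t] by simp
    then show "AE x in H \<Otimes>\<^sub>M H. norm (case x of (s, t) \<Rightarrow> (\<Sum>i<n. c i s t) * f s * g t)
        \<le> norm (case x of (s, t) \<Rightarrow> (exp (s\<^sup>2) * \<bar>f s\<bar>) * (exp (t\<^sup>2) * \<bar>g t\<bar>))"
      by (auto simp only: split_beta intro!: AE_I2)
  qed
  have "(\<integral>x. (case x of (s, t) \<Rightarrow> (\<Sum>i<n. c i s t) * f s * g t) \<partial>(H \<Otimes>\<^sub>M H)) = (\<Sum>i<n. phi_coeff f i * phi_coeff g i)" for n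
  proof -
    have "(\<integral>x. (case x of (s, t) \<Rightarrow> (\<Sum>i<n. c i s t) * f s * g t) \<partial>(H \<Otimes>\<^sub>M H)) =
        (\<integral>s. (\<integral>t. (\<Sum>i<n. c i s t) * f s * g t \<partial>H) \<partial>H)"
      by (rule integral_fst[symmetric, OF int])
    also have "\<dots> = (\<integral>s. (\<Sum>i<n. phi_coeff g i * (phi i s * f s)) \<partial>H)"
    proof (rule Bochner_Integration.integral_cong[OF refl])
      fix s
      have "(\<integral>t. (\<Sum>i<n. c i s t) * f s * g t \<partial>H) = (\<integral>t. (\<Sum>i<n. (if i < 3 then 0 else phi i s * f s) * (phi i t * g t)) \<partial>H)"
        by (intro Bochner_Integration.integral_cong refl)
           (unfold c_def sum_distrib_right, rule sum.cong, auto)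
      also have "\<dots> = (\<Sum>i<n. (if i < 3 then 0 else phi i s * f s) * (\<integral>t. phi i t * g t \<partial>H))"
        using sq_integrable_mult[OF phi_sq_integrable g]
        by (subst Bochner_Integration.integral_sum) auto
      also have "\<dots> = (\<Sum>i<n. phi_coeff g i * (phi i s * f s))"
        by (rule sum.cong) (auto simp: phi_coeff_def)
      finally show "(\<integral>t. (\<Sum>i<n. c i s t) * f s * g t \<partial>H) = (\<Sum>i<n. phi_coeff g i * (phi i s * f s))" .
    qed
    also have "\<dots> = (\<Sum>i<n. phi_coeff g i * (\<integral>s. phi i s * f s \<partial>H))"
      using sq_integrable_mult[OF phi_sq_integrable f]
      by (subst Bochner_Integration.integral_sum) auto
    also have "\<dots> = (\<Sum>i<n. phi_coeff f i * phi_coeff g i)"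
      by (rule sum.cong) (auto simp: phi_coeff_def)
    finally show ?thesis .
  qed
  moreover have "(\<lambda>n. \<integral>x. (case x of (s, t) \<Rightarrow> (\<Sum>i<n. c i s t) * f s * g t) \<partial>(H \<Otimes>\<^sub>M H)) \<longlonglongrightarrow>
      (\<integral>x. (case x of (s, t) \<Rightarrow> limit_kernel s t * f s * g t) \<partial>(H \<Otimes>\<^sub>M H))"
  proof (rule integral_dominated_convergence[OF _ cm kernel_dominant_integrable])
    show "(\<lambda>(s, t). limit_kernel s t * f s * g t) \<in> borel_measurable (H \<Otimes>\<^sub>M H)"
      using kernel_integrable by simp
    have "(\<lambda>n. (\<Sum>i<n. c i s t) * f s * g t) \<longlonglongrightarrow> limit_kernel s t * f s * g t" for s t
      using limit_kernel_sums[of s t] unfolding sums_def c_def by (intro tendsto_mult tendsto_const)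
    then show "AE x in H \<Otimes>\<^sub>M H. (\<lambda>n. case x of (s, t) \<Rightarrow> (\<Sum>i<n. c i s t) * f s * g t) \<longlonglongrightarrow>
        (case x of (s, t) \<Rightarrow> limit_kernel s t * f s * g t)"
      by (auto simp only: split_beta intro!: AE_I2)
    show "AE x in H \<Otimes>\<^sub>M H. norm (case x of (s, t) \<Rightarrow> (\<Sum>i<n. c i s t) * f s * g t)
        \<le> (case x of (s, t) \<Rightarrow> (exp (s\<^sup>2) * \<bar>f s\<bar>) * (exp (t\<^sup>2) * \<bar>g t\<bar>))" for n
      using dom by (auto simp only: split_beta real_norm_def intro!: AE_I2)
  qed
  moreover have "(\<integral>x. (case x of (s, t) \<Rightarrow> limit_kernel s t * f s * g t) \<partial>(H \<Otimes>\<^sub>M H)) =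
      (\<integral>s. (\<integral>t. limit_kernel s t * f s * g t \<partial>H) \<partial>H)"
    by (rule integral_fst[symmetric, OF kernel_integrable])
  ultimately show ?thesis unfolding sums_def by simp
qed

end

text \<open>The pointwise tail bound is integrated against \<open>\<bar>f t\<bar>\<close>; the
  envelope times \<open>\<bar>f t\<bar>\<close> has the finite integral \<open>C\<close>, so the
  error decays geometrically.\<close>

lemma inner_gauss_limit:
  assumes f: "f \<in> sq_integrable H" and x: "seq_norm x < \<infinity>"
  shows "L2_inner H (gauss_limit x) (L2_class H f) = (\<integral>t. herm_series x t * f t \<partial>H)"
    and "(\<lambda>m. \<Sum>i<m. phi_coeff f i * x i) \<longlonglongrightarrow> L2_inner H (gauss_limit x) (L2_class H f)"
proof -
  show eq: "L2_inner H (gauss_limit x) (L2_class H f) = (\<integral>t. herm_series x t * f t \<partial>H)"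
    unfolding gauss_limit_def using x by (simp add: L2_inner_class herm_series_sq_integrable f)
  obtain M where M: "seq_norm x = ennreal M" "0 \<le> M"
    using x by (cases "seq_norm x") auto
  have ints: "integrable H (\<lambda>t. herm_series x t * f t)" "integrable H (\<lambda>t. herm_part m x t * f t)" for m
    by (intro sq_integrable_mult herm_series_sq_integrable x f herm_part_sq_integrable)+
  have absf: "(\<lambda>t. \<bar>f t\<bar>) \<in> sq_integrable H"
    using f by (auto simp: sq_integrable_def)
  define C where "C = (\<integral>t. exp (\<rho> * t\<^sup>2 / 2) * \<bar>f t\<bar> \<partial>H)"
  have intC: "integrable H (\<lambda>t. exp (\<rho> * t\<^sup>2 / 2) * \<bar>f t\<bar>)"
    by (rule sq_integrable_mult[OF exp_rho_sq_integrable absf])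
  have "\<forall>\<^sub>F m in sequentially. norm ((\<integral>t. herm_part m x t * f t \<partial>H) - (\<integral>t. herm_series x t * f t \<partial>H)) \<le> sqrt (M * (1 / lam) ^ m) * C"
    using eventually_ge_at_top[of 3]
  proof eventually_elim
    case (elim m)
    have "norm ((\<integral>t. herm_part m x t * f t \<partial>H) - (\<integral>t. herm_series x t * f t \<partial>H)) =
        \<bar>\<integral>t. herm_part m x t * f t - herm_series x t * f t \<partial>H\<bar>"
      using ints by simp
    also have "\<dots> \<le> (\<integral>t. \<bar>herm_part m x t * f t - herm_series x t * f t\<bar> \<partial>H)"
      by (rule integral_abs_bound)
    also have "\<dots> \<le> (\<integral>t. sqrt (M * (1 / lam) ^ m) * (exp (\<rho> * t\<^sup>2 / 2) * \<bar>f t\<bar>) \<partial>H)"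
    proof (rule integral_mono)
      show "integrable H (\<lambda>t. \<bar>herm_part m x t * f t - herm_series x t * f t\<bar>)" using ints by simp
      show "integrable H (\<lambda>t. sqrt (M * (1 / lam) ^ m) * (exp (\<rho> * t\<^sup>2 / 2) * \<bar>f t\<bar>))" using intC by simp
      fix t
      have "\<bar>herm_part m x t - herm_series x t\<bar> \<le> sqrt (M * (1 / lam) ^ m) * exp (\<rho> * t\<^sup>2 / 2)"
        using herm_series_minus_part[of x M m t] M elim by (simp add: power_one_over abs_minus_commute)
      from mult_right_mono[OF this, of "\<bar>f t\<bar>"]
      show "\<bar>herm_part m x t * f t - herm_series x t * f t\<bar> \<le> sqrt (M * (1 / lam) ^ m) * (exp (\<rho> * t\<^sup>2 / 2) * \<bar>f t\<bar>)"
        by (simp add: mult.assoc flip: abs_mult left_diff_distrib)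
    qed
    finally show ?case by (simp add: C_def)
  qed
  moreover have "(\<lambda>m. sqrt (M * (1 / lam) ^ m) * C) \<longlonglongrightarrow> sqrt (M * 0) * C"
    using lam by (intro tendsto_intros LIMSEQ_power_zero) simp
  ultimately have "(\<lambda>m. (\<integral>t. herm_part m x t * f t \<partial>H) - (\<integral>t. herm_series x t * f t \<partial>H)) \<longlonglongrightarrow> 0"
    by (simp add: Lim_null_comparison)
  from LIM_zero_cancel[OF this]
  show "(\<lambda>m. \<Sum>i<m. phi_coeff f i * x i) \<longlonglongrightarrow> L2_inner H (gauss_limit x) (L2_class H f)"
    unfolding phi_coeff_sum[OF f] eq .
qed

section \<open>Law and covariance of the inner products\<close>

definition kform :: "(real \<Rightarrow> real) \<Rightarrow> (real \<Rightarrow> real) \<Rightarrow> real" where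
  "kform f g = (\<integral>s. (\<integral>t. limit_kernel s t * f s * g t \<partial>H) \<partial>H)"

lemma inner_measurable:
  assumes f: "f \<in> sq_integrable H"
  shows "(\<lambda>x. L2_inner H (gauss_limit x) (L2_class H f)) \<in> borel_measurable gauss_seq"
proof -
  have [measurable]: "{x. seq_norm x < \<infinity>} \<in> sets gauss_seq"
  proof -
    have "{x \<in> space borel. seq_norm x < \<infinity>} \<in> sets borel"
      using seq_norm_measurable by measurable
    then show ?thesis by (simp add: sets_gauss_seq)
  qed
  \<comment> \<open>The value of the inner product on the null set, where \<open>gauss_limit\<close>
    is the zero class.\<close>
  define c where "c = L2_inner H (L2_class H (\<lambda>_. 0)) (L2_class H f)"
  show ?thesis
  proof (rule borel_measurable_LIMSEQ_real)
    show "(\<lambda>x. if x \<in> {x. seq_norm x < \<infinity>} then \<Sum>i<m. phi_coeff f i * x i else c) \<in> borel_measurable gauss_seq" for m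
      by measurable
    show "(\<lambda>m. if x \<in> {x. seq_norm x < \<infinity>} then \<Sum>i<m. phi_coeff f i * x i else c) \<longlonglongrightarrow> L2_inner H (gauss_limit x) (L2_class H f)" for x
      using inner_gauss_limit(2)[OF f, of x] by (auto simp: c_def gauss_limit_def)
  qed
qed

text \<open>Partial sums are centred normal with variances increasing to \<open>kform f f\<close>.
  Their characteristic functions converge on both sides, and uniqueness identifies the law.\<close>

lemma distr_inner_gauss_limit:
  assumes f: "f \<in> sq_integrable H"
  shows "distr gauss_seq borel (\<lambda>x. L2_inner H (gauss_limit x) (L2_class H f)) =
    distr std_normal_distribution borel (\<lambda>y. sqrt (kform f f) * y)"
proof (rule Levy_uniqueness)
  interpret Q: prob_space gauss_seq by (rule prob_space_gauss_seq)
  interpret N: prob_space std_normal_distribution by (rule prob_space_normal_density) simp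
  let ?Y = "\<lambda>x. L2_inner H (gauss_limit x) (L2_class H f)"
  note Ym [measurable] = inner_measurable[OF f]
  show "real_distribution (distr gauss_seq borel ?Y)"
    by (rule Q.real_distribution_distr) simp
  show "real_distribution (distr std_normal_distribution borel (\<lambda>y. sqrt (kform f f) * y))"
    by (rule N.real_distribution_distr) simp
  show "char (distr gauss_seq borel ?Y) = char (distr std_normal_distribution borel (\<lambda>y. sqrt (kform f f) * y))"
  proof
    fix t
    define v where "v m = (\<Sum>i<m. (phi_coeff f i)\<^sup>2)" for m
    have v: "v \<longlonglongrightarrow> kform f f"
      using kernel_coeff_sums[OF f f] by (simp add: v_def[abs_def] kform_def sums_def power2_eq_square)
    have "(\<lambda>m. \<integral>x. iexp (t * (\<Sum>i<m. phi_coeff f i * x i)) \<partial>gauss_seq) \<longlonglongrightarrow> (\<integral>x. iexp (t * ?Y x) \<partial>gauss_seq)"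
    proof (rule integral_dominated_convergence[where w = "\<lambda>_. 1"])
      show "AE x in gauss_seq. (\<lambda>m. iexp (t * (\<Sum>i<m. phi_coeff f i * x i))) \<longlonglongrightarrow> iexp (t * ?Y x)"
        using AE_gauss_seq_norm
      proof eventually_elim
        case (elim x)
        show ?case by (intro tendsto_intros inner_gauss_limit(2) f elim)
      qed
    qed auto
    moreover have "(\<integral>x. iexp (t * (\<Sum>i<m. phi_coeff f i * x i)) \<partial>gauss_seq) = (\<integral>y. iexp (t * (sqrt (v m) * y)) \<partial>std_normal_distribution)" for m
      unfolding v_def by (rule gauss_seq_expectation_linear) auto
    moreover have "(\<lambda>m. \<integral>y. iexp (t * (sqrt (v m) * y)) \<partial>std_normal_distribution) \<longlonglongrightarrow> (\<integral>y. iexp (t * (sqrt (kform f f) * y)) \<partial>std_normal_distribution)"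
    proof (rule integral_dominated_convergence[where w = "\<lambda>_. 1"])
      show "AE y in std_normal_distribution. (\<lambda>m. iexp (t * (sqrt (v m) * y))) \<longlonglongrightarrow> iexp (t * (sqrt (kform f f) * y))"
        by (intro AE_I2 tendsto_intros v)
    qed auto
    ultimately have "(\<integral>x. iexp (t * ?Y x) \<partial>gauss_seq) = (\<integral>y. iexp (t * (sqrt (kform f f) * y)) \<partial>std_normal_distribution)"
      using LIMSEQ_unique by fastforce
    then show "char (distr gauss_seq borel ?Y) t = char (distr std_normal_distribution borel (\<lambda>y. sqrt (kform f f) * y)) t"
      unfolding char_def by (simp add: integral_distr)
  qed
qed

lemma kform_nonneg:
  assumes "f \<in> sq_integrable H"
  shows "0 \<le> kform f f"
proof -
  have "summable (\<lambda>i. phi_coeff f i * phi_coeff f i)" "kform f f = (\<Sum>i. phi_coeff f i * phi_coeff f i)"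
    using kernel_coeff_sums[OF assms assms] by (auto simp: sums_iff kform_def)
  then show ?thesis by (simp add: suminf_nonneg)
qed

text \<open>Transferred from the identified normal law, which avoids exchanging the limit of the
  series with the expectation of a square.\<close>

lemma inner_second_moment:
  assumes f: "f \<in> sq_integrable H"
  shows "integrable gauss_seq (\<lambda>x. (L2_inner H (gauss_limit x) (L2_class H f))\<^sup>2)"
    and "(\<integral>x. (L2_inner H (gauss_limit x) (L2_class H f))\<^sup>2 \<partial>gauss_seq) = kform f f"
proof -
  let ?Y = "\<lambda>x. L2_inner H (gauss_limit x) (L2_class H f)"
  note Ym [measurable] = inner_measurable[OF f]
  have b: "has_bochner_integral lborel (\<lambda>x. std_normal_density x * x\<^sup>2) 1"
    using std_normal_moment_even[of 1] by simp
  have int: "integrable std_normal_distribution (\<lambda>y. (sqrt (kform f f) * y)\<^sup>2)"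
  proof (subst integrable_real_density)
    have "std_normal_density y * (sqrt (kform f f) * y)\<^sup>2 = (sqrt (kform f f))\<^sup>2 * (std_normal_density y * y\<^sup>2)" for y
      by (simp only: power_mult_distrib mult_ac)
    then show "integrable lborel (\<lambda>y. std_normal_density y * (sqrt (kform f f) * y)\<^sup>2)"
      using b by (simp only:) (auto simp: has_bochner_integral_iff)
  qed auto
  have "integrable (distr std_normal_distribution borel (\<lambda>y. sqrt (kform f f) * y)) (\<lambda>y. y\<^sup>2)"
    by (subst integrable_distr_eq) (use int in auto)
  then have "integrable (distr gauss_seq borel ?Y) (\<lambda>y. y\<^sup>2)"
    unfolding distr_inner_gauss_limit[OF f] .
  then show "integrable gauss_seq (\<lambda>x. (?Y x)\<^sup>2)"
    by (subst (asm) integrable_distr_eq) auto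
  have "(\<integral>x. (?Y x)\<^sup>2 \<partial>gauss_seq) = (\<integral>y. y\<^sup>2 \<partial>distr gauss_seq borel ?Y)"
    by (subst integral_distr) auto
  also have "\<dots> = (\<integral>y. (sqrt (kform f f) * y)\<^sup>2 \<partial>std_normal_distribution)"
    unfolding distr_inner_gauss_limit[OF f] by (subst integral_distr) auto
  also have "\<dots> = kform f f * (\<integral>y. y\<^sup>2 \<partial>std_normal_distribution)"
    using kform_nonneg[OF f] by (simp add: power_mult_distrib)
  also have "(\<integral>y. y\<^sup>2 \<partial>std_normal_distribution) = 1"
    using b by (subst integral_real_density) (auto simp: has_bochner_integral_iff)
  finally show "(\<integral>x. (?Y x)\<^sup>2 \<partial>gauss_seq) = kform f f" by simp
qed

lemma centred_normal_inner:
  assumes f: "f \<in> sq_integrable H"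
  shows "centred_normal gauss_seq (\<lambda>x. L2_inner H (gauss_limit x) (L2_class H f))"
proof -
  let ?Y = "\<lambda>x. L2_inner H (gauss_limit x) (L2_class H f)"
  note Ym [measurable] = inner_measurable[OF f]
  consider "kform f f > 0" | "kform f f = 0" using kform_nonneg[OF f] by linarith
  then show ?thesis
  proof cases
    case 1
    have "distr gauss_seq lborel ?Y = distr gauss_seq borel ?Y"
      by (rule distr_cong) auto
    also have "\<dots> = distr std_normal_distribution lborel (\<lambda>y. sqrt (kform f f) * y)"
      unfolding distr_inner_gauss_limit[OF f] by (rule distr_cong) auto
    also have "\<dots> = density lborel (\<lambda>y. ennreal (normal_density 0 (sqrt (kform f f)) y))"
      using 1 by (intro distributed_scaled_std_normal) simp
    finally have "distributed gauss_seq lborel ?Y (\<lambda>y. ennreal (normal_density 0 (sqrt (kform f f)) y))"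
      by (simp add: distributed_def)
    then show ?thesis unfolding centred_normal_def using 1 by (auto intro!: exI[of _ "sqrt (kform f f)"])
  next
    case 2
    have "AE x in gauss_seq. (?Y x)\<^sup>2 = 0"
      using inner_second_moment[OF f] 2
      by (subst integral_nonneg_eq_0_iff_AE[symmetric]) auto
    then show ?thesis unfolding centred_normal_def by auto
  qed
qed

lemma gaussian_gauss_limit: "centred_gaussian_element gauss_seq H gauss_limit"
  unfolding centred_gaussian_element_def
proof (intro conjI ballI gauss_limit_measurable)
  fix A assume "A \<in> L2_space H"
  then show "centred_normal gauss_seq (\<lambda>\<omega>. L2_inner H (gauss_limit \<omega>) A)"
    using centred_normal_inner[of "L2_rep A"] L2_rep_space[of A H] by simp
qed

lemma sq_integrable_add:
  assumes "f \<in> sq_integrable H" "g \<in> sq_integrable H"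
  shows "(\<lambda>t. f t + g t) \<in> sq_integrable H"
proof -
  have "(\<lambda>t. 0 - g t) \<in> sq_integrable H" by (intro sq_integrable_diff zero_sq_integrable assms)
  from sq_integrable_diff[OF assms(1) this] show ?thesis by simp
qed

text \<open>Polarization: the second moments for \<open>f\<close>, \<open>g\<close> and their sum
  determine the mixed moment, and the same identity holds term by term for the products of
  coefficients. Additivity of the inner product is only needed almost surely.\<close>

lemma covariance_gauss_limit: "has_covariance_kernel gauss_seq H gauss_limit limit_kernel"
  unfolding has_covariance_kernel_def
proof (intro ballI conjI)
  fix f g assume f: "f \<in> sq_integrable H" and g: "g \<in> sq_integrable H"
  show "integrable (H \<Otimes>\<^sub>M H) (\<lambda>(s, t). limit_kernel s t * f s * g t)"
    by (rule kernel_integrable[OF f g])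
  define Y where "Y f x = L2_inner H (gauss_limit x) (L2_class H f)" for f x
  let ?h = "\<lambda>t. f t + g t"
  have h: "?h \<in> sq_integrable H" by (rule sq_integrable_add[OF f g])
  have add: "AE x in gauss_seq. Y ?h x = Y f x + Y g x"
    using AE_gauss_seq_norm
  proof eventually_elim
    case (elim x)
    show ?case unfolding Y_def inner_gauss_limit(1)[OF f elim] inner_gauss_limit(1)[OF g elim] inner_gauss_limit(1)[OF h elim]
      using sq_integrable_mult[OF herm_series_sq_integrable[OF elim] f] sq_integrable_mult[OF herm_series_sq_integrable[OF elim] g]
      by (simp add: distrib_left)
  qed
  have Ym [measurable]: "Y f \<in> borel_measurable gauss_seq" if "f \<in> sq_integrable H" for f
    unfolding Y_def[abs_def] by (rule inner_measurable[OF that])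
  have Y2: "integrable gauss_seq (\<lambda>x. (Y f x)\<^sup>2)" "(\<integral>x. (Y f x)\<^sup>2 \<partial>gauss_seq) = kform f f" if "f \<in> sq_integrable H" for f
    unfolding Y_def by (rule inner_second_moment[OF that])+
  have "(\<integral>x. Y f x * Y g x \<partial>gauss_seq) = (\<integral>x. ((Y ?h x)\<^sup>2 - (Y f x)\<^sup>2 - (Y g x)\<^sup>2) / 2 \<partial>gauss_seq)"
  proof (rule integral_cong_AE)
    show "AE x in gauss_seq. Y f x * Y g x = ((Y ?h x)\<^sup>2 - (Y f x)\<^sup>2 - (Y g x)\<^sup>2) / 2"
      using add by eventually_elim (simp add: power2_eq_square algebra_simps)
  qed (use Ym[OF f] Ym[OF g] Ym[OF h] in auto)
  also have "\<dots> = (kform ?h ?h - kform f f - kform g g) / 2"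
    using Y2(1)[OF f] Y2(1)[OF g] Y2(1)[OF h] by (simp add: Y2(2)[OF f] Y2(2)[OF g] Y2(2)[OF h])
  also have "\<dots> = kform f g"
  proof -
    have co: "phi_coeff ?h i = phi_coeff f i + phi_coeff g i" for i
      using sq_integrable_mult[OF phi_sq_integrable f] sq_integrable_mult[OF phi_sq_integrable g]
      by (simp add: phi_coeff_def distrib_left)
    have "(\<lambda>i. (phi_coeff ?h i * phi_coeff ?h i - phi_coeff f i * phi_coeff f i - phi_coeff g i * phi_coeff g i) / 2) sums
        ((kform ?h ?h - kform f f - kform g g) / 2)"
      unfolding kform_def by (intro sums_divide sums_diff kernel_coeff_sums f g h)
    moreover have "(phi_coeff ?h i * phi_coeff ?h i - phi_coeff f i * phi_coeff f i - phi_coeff g i * phi_coeff g i) / 2 =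
        phi_coeff f i * phi_coeff g i" for i
      unfolding co by (simp add: algebra_simps)
    ultimately have "(\<lambda>i. phi_coeff f i * phi_coeff g i) sums ((kform ?h ?h - kform f f - kform g g) / 2)"
      by (simp only:)
    then show ?thesis
      using kernel_coeff_sums[OF f g] unfolding kform_def[of f g] by (rule sums_unique2)
  qed
  finally show "(\<integral>x. L2_inner H (gauss_limit x) (L2_class H f) * L2_inner H (gauss_limit x) (L2_class H g) \<partial>gauss_seq) =
      (\<integral>s. (\<integral>t. limit_kernel s t * f s * g t \<partial>H) \<partial>H)"
    by (simp add: Y_def kform_def)
qed

end

section \<open>The effect of estimating mean and variance\<close>

lemma abs_exp_minus_one: "\<bar>exp u - 1\<bar> \<le> \<bar>u\<bar> * exp \<bar>u\<bar>" for u :: real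
proof (cases "u \<ge> 0")
  case True
  have "(1 - u) * exp u \<le> exp (- u) * exp u"
    using exp_ge_add_one_self[of "- u"] by (intro mult_right_mono) auto
  then have "exp u - 1 \<le> u * exp u" by (simp add: algebra_simps flip: exp_add)
  then show ?thesis using True by simp
next
  case False
  have "1 - exp u \<le> - u" using exp_ge_add_one_self[of u] by linarith
  also have "\<dots> \<le> - u * exp (- u)" using False by (simp add: mult_le_cancel_left1)
  finally show ?thesis using False by simp
qed

lemma abs_exp_minus_one_minus: "\<bar>exp u - 1 - u\<bar> \<le> u\<^sup>2 * exp \<bar>u\<bar>" for u :: real
proof -
  have "(1 - u) * exp u \<le> exp (- u) * exp u"
    using exp_ge_add_one_self[of "- u"] by (intro mult_right_mono) auto
  then have "exp u - 1 - u \<le> u * (exp u - 1)" by (simp add: algebra_simps flip: exp_add)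
  also have "\<dots> \<le> \<bar>u\<bar> * \<bar>exp u - 1\<bar>" by (metis abs_ge_self abs_mult)
  also have "\<dots> \<le> \<bar>u\<bar> * (\<bar>u\<bar> * exp \<bar>u\<bar>)" by (intro mult_left_mono abs_exp_minus_one) auto
  also have "\<dots> = u\<^sup>2 * exp \<bar>u\<bar>" by (simp add: power2_eq_square flip: mult.assoc)
  finally show ?thesis using exp_ge_add_one_self[of u] by linarith
qed

section \<open>Empirical process of fixed data under affine change\<close>

definition herm_coeff :: "nat \<Rightarrow> (nat \<Rightarrow> real) \<Rightarrow> nat \<Rightarrow> real" where
  "herm_coeff n z i = (\<Sum>j<n. hfun i (z j)) / sqrt (real n)"

definition smean :: "nat \<Rightarrow> (nat \<Rightarrow> real) \<Rightarrow> real" where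
  "smean n z = (\<Sum>j<n. z j) / real n"

text \<open>Written as second moment minus squared mean, the form \<open>q - a\<^sup>2\<close> in
  which the estimates use it.\<close>

definition ssd :: "nat \<Rightarrow> (nat \<Rightarrow> real) \<Rightarrow> real" where
  "ssd n z = sqrt ((\<Sum>j<n. (z j)\<^sup>2) / real n - (smean n z)\<^sup>2)"

text \<open>The data are an argument, so that the same function describes the independent sample and
  the residuals.\<close>

definition raw_process :: "nat \<Rightarrow> (nat \<Rightarrow> real) \<Rightarrow> real \<Rightarrow> real" where
  "raw_process n z t = sqrt (real n) * ((\<Sum>j<n. exp (t * z j)) / real n - exp (t\<^sup>2 / 2))"

lemma raw_process_sums:
  assumes "n > 0"
  shows "(\<lambda>i. herm_coeff n z i * phi i t) sums raw_process n z t"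
proof -
  have "(\<lambda>i. (\<Sum>j<n. hfun i (z j) * phi i t) / sqrt (real n)) sums
      ((\<Sum>j<n. exp (t * z j) - exp (t\<^sup>2 / 2)) / sqrt (real n))"
    by (intro sums_divide sums_sum hfun_generating)
  moreover have "(\<Sum>j<n. exp (t * z j) - exp (t\<^sup>2 / 2)) / sqrt (real n) = raw_process n z t"
  proof -
    have "raw_process n z t = ((\<Sum>j<n. exp (t * z j)) - real n * exp (t\<^sup>2 / 2)) * (sqrt (real n) / real n)"
      using assms by (simp add: raw_process_def field_simps)
    also have "sqrt (real n) / real n = 1 / sqrt (real n)"
      by (subst sqrt_divide_self_eq) (simp_all add: inverse_eq_divide)
    finally show ?thesis by (simp add: sum_subtractf)
  qed
  ultimately show ?thesis by (simp add: herm_coeff_def sum_distrib_right)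
qed

text \<open>Shift and scale are collected in a single exponent, so the perturbation of the series is
  multiplicative, term by term.\<close>

lemma phi_scale:
  assumes "b > 0"
  shows "exp (- t * a * b) * phi i (t * b) = phi i t * exp (- t * a * b + t\<^sup>2 * (b\<^sup>2 - 1) / 2 + real i * ln b)"
proof -
  have "exp (real i * ln b) = b ^ i" using assms by (simp add: exp_of_nat_mult)
  then have "exp (- t * a * b + t\<^sup>2 * (b\<^sup>2 - 1) / 2 + real i * ln b) =
      exp (- t * a * b) * exp (t\<^sup>2 * (b\<^sup>2 - 1) / 2) * b ^ i"
    by (simp only: exp_add)
  moreover have "exp ((t * b)\<^sup>2 / 2) = exp (t\<^sup>2 / 2) * exp (t\<^sup>2 * (b\<^sup>2 - 1) / 2)"
    by (simp add: algebra_simps power_mult_distrib diff_divide_distrib flip: exp_add)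
  ultimately show ?thesis
    by (simp only: phi_def power_mult_distrib[of t b i] power_mult_distrib[of b t i] times_divide_eq_left times_divide_eq_right mult_ac)
qed

text \<open>Affine data move the argument to \<open>t * b\<close>, but the subtracted
  \<open>exp (t\<^sup>2 / 2)\<close> does not move with them; the last summand is this
  mismatch.\<close>

lemma residual_process_eq:
  assumes n: "n > 0" and b: "b > 0"
  shows "raw_process n (\<lambda>j. (z j - a) * b) t = exp (- t * a * b) * raw_process n z (t * b) +
      exp (t\<^sup>2 / 2) * (sqrt (real n) * (exp (- t * a * b + t\<^sup>2 * (b\<^sup>2 - 1) / 2) - 1))"
proof -
  have 1: "exp (t * ((z j - a) * b)) = exp (- t * a * b) * exp (t * b * z j)" for j
    by (simp add: algebra_simps flip: exp_add)
  have 2: "exp (t\<^sup>2 / 2) * exp (- t * a * b + t\<^sup>2 * (b\<^sup>2 - 1) / 2) = exp (- t * a * b) * exp ((t * b)\<^sup>2 / 2)"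
    by (simp add: algebra_simps power_mult_distrib diff_divide_distrib flip: exp_add)
  have "raw_process n (\<lambda>j. (z j - a) * b) t =
      sqrt (real n) * (exp (- t * a * b) * (\<Sum>j<n. exp (t * b * z j)) / real n - exp (t\<^sup>2 / 2))"
    unfolding raw_process_def 1 by (simp add: sum_distrib_left)
  also have "\<dots> = exp (- t * a * b) * raw_process n z (t * b) +
      sqrt (real n) * (exp (- t * a * b) * exp ((t * b)\<^sup>2 / 2) - exp (t\<^sup>2 / 2))"
    unfolding raw_process_def by (simp add: algebra_simps)
  also have "\<dots> = exp (- t * a * b) * raw_process n z (t * b) +
      exp (t\<^sup>2 / 2) * (sqrt (real n) * (exp (- t * a * b + t\<^sup>2 * (b\<^sup>2 - 1) / 2) - 1))"
    unfolding 2[symmetric] by (simp add: algebra_simps)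
  finally show ?thesis .
qed

text \<open>Here \<open>a\<close> and \<open>q\<close> stand for sample mean and second moment,
  \<open>b\<close> for the reciprocal standard deviation, \<open>e\<close> for the size of the
  errors. The exponents are of first order in \<open>e\<close>; the last bound says that
  \<open>- t * a - t\<^sup>2 * (q - 1) / 2\<close> is the first-order part of
  \<open>u 0 t\<close>.\<close>

lemma scale_bounds:
  fixes a q e :: real
  assumes e: "0 \<le> e" "e \<le> 1/8" and a: "\<bar>a\<bar> \<le> e" and q: "\<bar>q - 1\<bar> \<le> 2 * e"
  defines "b \<equiv> 1 / sqrt (q - a\<^sup>2)"
  defines "u i t \<equiv> - t * a * b + t\<^sup>2 * (b\<^sup>2 - 1) / 2 + real i * ln b"
  shows "b > 0" "\<bar>u i t\<bar> \<le> 6 * e * (\<bar>t\<bar> + t\<^sup>2 + real i)"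
    "\<bar>u 0 t + t * a + t\<^sup>2 * (q - 1) / 2\<bar> \<le> 10 * e\<^sup>2 * (\<bar>t\<bar> + t\<^sup>2)"
proof -
  define s where "s = sqrt (q - a\<^sup>2)"
  have ee: "e\<^sup>2 \<le> e" using e mult_right_mono[of e 1 e] by (simp add: power2_eq_square)
  have aa: "a\<^sup>2 \<le> e\<^sup>2" using power_mono[OF a, of 2] by simp
  have aa0: "0 \<le> a\<^sup>2" by simp
  have v: "\<bar>q - a\<^sup>2 - 1\<bar> \<le> 3 * e" using q aa ee aa0 by linarith
  \<comment> \<open>As \<open>e \<le> 1/8\<close>, the variance is at least 5/8; hence
    \<open>b\<^sup>2 \<le> 2\<close> below.\<close>
  then have v2: "1/2 \<le> q - a\<^sup>2" using e by linarith
  then have s: "s > 0" "s\<^sup>2 = q - a\<^sup>2" by (simp_all add: s_def)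
  have bs: "b = 1 / s" by (simp add: b_def s_def)
  show b0: "b > 0" using s by (simp add: bs)
  have bb: "b\<^sup>2 = 1 / (q - a\<^sup>2)" using s by (simp add: bs power_divide)
  have bb2: "b\<^sup>2 \<le> 2" using v2 by (simp add: bb field_simps)
  have b2: "b \<le> 2"
  proof (rule power2_le_imp_le)
    show "b\<^sup>2 \<le> 2\<^sup>2" using bb2 by simp
  qed simp
  have bb1: "b\<^sup>2 - 1 = (1 - s\<^sup>2) * b\<^sup>2" using s by (simp add: bs field_simps)
  have dbb: "\<bar>b\<^sup>2 - 1\<bar> \<le> 6 * e"
  proof -
    have "\<bar>b\<^sup>2 - 1\<bar> = \<bar>1 - s\<^sup>2\<bar> * b\<^sup>2" unfolding bb1 by (simp add: abs_mult)
    also have "\<dots> \<le> (3 * e) * 2" using v bb2 s e by (intro mult_mono) auto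
    finally show ?thesis by simp
  qed
  have sub: "\<bar>x - 1\<bar> \<le> \<bar>x\<^sup>2 - 1\<bar>" if "x > 0" for x :: real
  proof -
    have "\<bar>x\<^sup>2 - 1\<bar> = \<bar>x - 1\<bar> * (x + 1)"
      using that by (simp add: power2_eq_square square_diff_one_factored abs_mult)
    moreover have "\<bar>x - 1\<bar> * 1 \<le> \<bar>x - 1\<bar> * (x + 1)" using that by (intro mult_left_mono) auto
    ultimately show ?thesis by simp
  qed
  have db: "\<bar>b - 1\<bar> \<le> 6 * e" using sub[OF b0] dbb by linarith
  have ds: "\<bar>s - 1\<bar> \<le> 3 * e" using sub[OF s(1)] v s(2) by linarith
  have lb: "\<bar>ln b\<bar> \<le> 6 * e"
  proof -
    \<comment> \<open>The upper bound on \<open>ln b\<close> comes from \<open>b\<close>, the lower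
      one from \<open>ln b = - ln s\<close>.\<close>
    have "ln b \<le> b - 1" using b0 by (rule ln_le_minus_one)
    moreover have "ln s \<le> s - 1" using s(1) by (rule ln_le_minus_one)
    moreover have "ln b = - ln s" using s by (simp add: bs ln_div)
    ultimately show ?thesis using db ds e by linarith
  qed
  have ab: "\<bar>a * b\<bar> \<le> 2 * e"
  proof -
    have "\<bar>a * b\<bar> \<le> e * 2" using a b2 b0 e by (simp only: abs_mult, intro mult_mono) auto
    then show ?thesis by simp
  qed
  show "\<bar>u i t\<bar> \<le> 6 * e * (\<bar>t\<bar> + t\<^sup>2 + real i)"
  proof -
    have "\<bar>t * (a * b)\<bar> \<le> \<bar>t\<bar> * (6 * e)"
      unfolding abs_mult[of t] using ab e by (intro mult_left_mono) auto
    moreover have "\<bar>t\<^sup>2 * (b\<^sup>2 - 1)\<bar> \<le> t\<^sup>2 * (6 * e)"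
      unfolding abs_mult[of "t\<^sup>2"] using dbb by (simp add: mult_left_mono)
    moreover have "\<bar>real i * ln b\<bar> \<le> real i * (6 * e)"
      unfolding abs_mult[of "real i"] using lb by (simp add: mult_left_mono)
    moreover have "\<bar>u i t\<bar> \<le> \<bar>t * (a * b)\<bar> + \<bar>t\<^sup>2 * (b\<^sup>2 - 1)\<bar> + \<bar>real i * ln b\<bar>"
      unfolding u_def by (simp add: mult.assoc)
    moreover have "6 * e * (\<bar>t\<bar> + t\<^sup>2 + real i) = \<bar>t\<bar> * (6 * e) + t\<^sup>2 * (6 * e) + real i * (6 * e)"
      by (simp add: algebra_simps)
    ultimately show ?thesis by linarith
  qed
  show "\<bar>u 0 t + t * a + t\<^sup>2 * (q - 1) / 2\<bar> \<le> 10 * e\<^sup>2 * (\<bar>t\<bar> + t\<^sup>2)"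
  proof -
    have eq: "u 0 t + t * a + t\<^sup>2 * (q - 1) / 2 = t * (a * (1 - b)) + t\<^sup>2 * (((b\<^sup>2 - 1) + (q - 1)) / 2)"
      unfolding u_def by (simp add: algebra_simps add_divide_distrib diff_divide_distrib)
    \<comment> \<open>The first-order parts of \<open>b\<^sup>2 - 1\<close> and \<open>q - 1\<close>
      cancel, leaving a product of two small factors and \<open>a\<^sup>2\<close>.\<close>
    have q1: "(b\<^sup>2 - 1) + (q - 1) = (1 - s\<^sup>2) * (b\<^sup>2 - 1) + a\<^sup>2"
    proof -
      have "(1 - s\<^sup>2) * (b\<^sup>2 - 1) = (1 - s\<^sup>2) * b\<^sup>2 - (1 - s\<^sup>2)" by (simp add: algebra_simps)
      then show ?thesis using bb1 s(2) by simp
    qed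
    have "\<bar>a * (1 - b)\<bar> \<le> e * (6 * e)"
      unfolding abs_mult using a db e by (intro mult_mono) auto
    then have x: "\<bar>t * (a * (1 - b))\<bar> \<le> \<bar>t\<bar> * (10 * e\<^sup>2)"
      unfolding abs_mult[of t] by (intro mult_left_mono) (auto simp: power2_eq_square)
    have "\<bar>(1 - s\<^sup>2) * (b\<^sup>2 - 1)\<bar> \<le> (3 * e) * (6 * e)"
      unfolding abs_mult using v s dbb e by (intro mult_mono) auto
    then have "\<bar>((b\<^sup>2 - 1) + (q - 1)) / 2\<bar> \<le> 10 * e\<^sup>2"
    proof -
      assume "\<bar>(1 - s\<^sup>2) * (b\<^sup>2 - 1)\<bar> \<le> (3 * e) * (6 * e)"
      then have "\<bar>(1 - s\<^sup>2) * (b\<^sup>2 - 1)\<bar> \<le> 18 * e\<^sup>2" by (simp add: power2_eq_square)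
      \<comment> \<open>The constant 10 is (18 + 1) / 2 rounded up.\<close>
      moreover have "\<bar>(x + z) / 2\<bar> \<le> 10 * y" if "\<bar>x\<bar> \<le> 18 * y" "z \<le> y" "0 \<le> z" for x y z :: real
        using that by (auto simp: abs_le_iff field_simps)
      ultimately show ?thesis unfolding q1 using aa aa0 by blast
    qed
    then have "\<bar>t\<^sup>2\<bar> * \<bar>((b\<^sup>2 - 1) + (q - 1)) / 2\<bar> \<le> \<bar>t\<^sup>2\<bar> * (10 * e\<^sup>2)"
      by (rule mult_left_mono) simp
    then have y: "\<bar>t\<^sup>2 * (((b\<^sup>2 - 1) + (q - 1)) / 2)\<bar> \<le> t\<^sup>2 * (10 * e\<^sup>2)"
      unfolding abs_mult[of "t\<^sup>2"] by simp
    have "\<bar>t\<bar> * (10 * e\<^sup>2) + t\<^sup>2 * (10 * e\<^sup>2) = 10 * e\<^sup>2 * (\<bar>t\<bar> + t\<^sup>2)"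
      by (simp add: algebra_simps)
    then show ?thesis
      using order_trans[OF abs_triangle_ineq add_mono[OF x y]] unfolding eq by simp
  qed
qed

section \<open>Perturbation bounds paid for by the geometric weights\<close>

context growth begin

text \<open>Chosen so that the square of \<open>exp (2 * \<gamma> * X)\<close> is \<open>lam\<close>
  to the power \<open>X\<close>.\<close>

definition "\<gamma> = ln lam / 4"

lemma gamma: "0 < \<gamma>"
  using lam by (simp add: \<gamma>_def)

text \<open>The factor \<open>X\<close> is absorbed by
  \<open>\<gamma> * X \<le> exp (\<gamma> * X)\<close>, which leaves the small factor
  \<open>d / \<gamma>\<close> in front.\<close>

lemma mult_exp_gamma_bound:
  assumes "0 \<le> d" "d \<le> \<gamma>" "0 \<le> X"
  shows "d * X * exp (d * X) \<le> (d / \<gamma>) * exp (2 * \<gamma> * X)"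
proof -
  have "\<gamma> * X \<le> exp (\<gamma> * X)" using exp_ge_add_one_self[of "\<gamma> * X"] by linarith
  moreover have "exp (d * X) \<le> exp (\<gamma> * X)" using assms by (simp add: mult_right_mono)
  ultimately have "\<gamma> * X * exp (d * X) \<le> exp (\<gamma> * X) * exp (\<gamma> * X)"
    using assms by (intro mult_mono) auto
  then have "(d / \<gamma>) * (\<gamma> * X * exp (d * X)) \<le> (d / \<gamma>) * (exp (\<gamma> * X) * exp (\<gamma> * X))"
    using assms gamma by (intro mult_left_mono) auto
  then show ?thesis using gamma by (simp add: mult_ac flip: exp_add)
qed

text \<open>Replacing \<open>\<bar>t\<bar>\<close> by \<open>1 + t\<^sup>2\<close> costs the
  constant factor \<open>lam\<close> and doubles the coefficient of \<open>t\<^sup>2\<close>; this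
  is the \<open>2 * ln lam\<close> in \<rho>.\<close>

lemma exp_gamma_le:
  "exp (2 * \<gamma> * (\<bar>t\<bar> + t\<^sup>2 + real i)) ^ 2 \<le> lam * exp (2 * ln lam * t\<^sup>2) * lam ^ i"
proof -
  have "0 \<le> (\<bar>t\<bar> - 1)\<^sup>2" by simp
  then have t: "\<bar>t\<bar> \<le> 1 + t\<^sup>2" by (simp add: power2_diff)
  have "exp (2 * \<gamma> * (\<bar>t\<bar> + t\<^sup>2 + real i)) ^ 2 = exp (ln lam * (\<bar>t\<bar> + t\<^sup>2 + real i))"
    by (simp add: \<gamma>_def flip: exp_of_nat_mult)
  also have "\<dots> \<le> exp (ln lam * (1 + 2 * t\<^sup>2 + real i))"
    using t lam by (intro exp_le_cancel_iff[THEN iffD2] mult_left_mono) auto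
  also have "\<dots> = exp (ln lam) * exp (2 * ln lam * t\<^sup>2) * exp (real i * ln lam)"
    by (simp add: algebra_simps flip: exp_add)
  also have "\<dots> = lam * exp (2 * ln lam * t\<^sup>2) * lam ^ i"
    using lam by (simp add: exp_of_nat_mult)
  finally show ?thesis .
qed

text \<open>One factor \<open>lam ^ i\<close> is the Cauchy-Schwarz weight, a second one pays for
  the growth of \<open>exp (u i)\<close> in \<open>i\<close>, and \<open>(lam\<^sup>2) ^ i\<close>
  still sums against \<open>(phi i t)\<^sup>2\<close>. The exponents add up to exactly
  \<rho>.\<close>

lemma perturbed_series_bound:
  assumes x: "seq_norm x \<le> ennreal M" "0 \<le> M"
    and d: "0 \<le> d" "d \<le> \<gamma>" and u: "\<And>i. \<bar>u i\<bar> \<le> d * (\<bar>t\<bar> + t\<^sup>2 + real i)"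
  shows "\<bar>\<Sum>i. x i * (phi i t * (exp (u i) - 1))\<bar> \<le> d * (sqrt M * sqrt lam / \<gamma>) * exp (\<rho> * t\<^sup>2 / 2)"
proof -
  let ?B = "((d / \<gamma>) * sqrt lam * exp (\<rho> * t\<^sup>2 / 2))\<^sup>2"
  have "(\<Sum>i<n. lam ^ i * (phi i t * (exp (u i) - 1))\<^sup>2) \<le> ?B" for n
  proof -
    have "(exp (u i) - 1)\<^sup>2 \<le> (d / \<gamma>)\<^sup>2 * (lam * exp (2 * ln lam * t\<^sup>2) * lam ^ i)" for i
    proof -
      let ?X = "\<bar>t\<bar> + t\<^sup>2 + real i"
      have "\<bar>exp (u i) - 1\<bar> \<le> \<bar>u i\<bar> * exp \<bar>u i\<bar>" by (rule abs_exp_minus_one)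
      also have "\<dots> \<le> (d * ?X) * exp (d * ?X)" using u[of i] d by (intro mult_mono) auto
      also have "\<dots> \<le> (d / \<gamma>) * exp (2 * \<gamma> * ?X)" using d by (intro mult_exp_gamma_bound) auto
      finally have "\<bar>exp (u i) - 1\<bar>\<^sup>2 \<le> ((d / \<gamma>) * exp (2 * \<gamma> * ?X))\<^sup>2"
        by (intro power_mono) auto
      also have "\<dots> \<le> (d / \<gamma>)\<^sup>2 * (lam * exp (2 * ln lam * t\<^sup>2) * lam ^ i)"
        unfolding power_mult_distrib by (intro mult_left_mono exp_gamma_le) auto
      finally show ?thesis by simp
    qed
    then have "lam ^ i * (phi i t * (exp (u i) - 1))\<^sup>2 \<le>
        lam ^ i * ((phi i t)\<^sup>2 * ((d / \<gamma>)\<^sup>2 * (lam * exp (2 * ln lam * t\<^sup>2) * lam ^ i)))" for i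
      unfolding power_mult_distrib using lam by (intro mult_left_mono) auto
    then have "(\<Sum>i<n. lam ^ i * (phi i t * (exp (u i) - 1))\<^sup>2) \<le>
        (\<Sum>i<n. (d / \<gamma>)\<^sup>2 * lam * exp (2 * ln lam * t\<^sup>2) * ((lam\<^sup>2) ^ i * (phi i t)\<^sup>2))"
      by (intro sum_mono) (simp add: power2_eq_square power_mult_distrib mult_ac)
    also have "\<dots> \<le> (d / \<gamma>)\<^sup>2 * lam * exp (2 * ln lam * t\<^sup>2) * exp (t\<^sup>2 + lam\<^sup>2 * t\<^sup>2)"
      unfolding sum_distrib_left[symmetric] using lam
      by (intro mult_left_mono phi_square_partial_sum) auto
    also have "\<dots> = (d / \<gamma>)\<^sup>2 * lam * exp (\<rho> * t\<^sup>2)"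
      by (simp add: \<rho>_def algebra_simps flip: exp_add)
    also have "\<dots> = ?B"
    proof -
      have "(exp (\<rho> * t\<^sup>2 / 2))\<^sup>2 = exp (\<rho> * t\<^sup>2)" by (simp flip: exp_of_nat_mult)
      then show ?thesis using lam by (simp only: power_mult_distrib) simp
    qed
    finally show ?thesis .
  qed
  from weighted_series_bound(2)[OF x this]
  have "\<bar>\<Sum>i. x i * (phi i t * (exp (u i) - 1))\<bar> \<le> sqrt M * sqrt ?B" .
  also have "sqrt ?B = (d / \<gamma>) * sqrt lam * exp (\<rho> * t\<^sup>2 / 2)"
    using d gamma lam by (simp only: real_sqrt_abs) simp
  finally show ?thesis by (simp add: mult_ac)
qed

text \<open>With \<open>- r\<close> as the linear part of \<open>u\<close>, both
  \<open>exp u - 1 - u\<close> and \<open>u + r\<close> are of second order in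
  \<open>d\<close>.\<close>

lemma quadratic_remainder_bound:
  assumes d: "0 \<le> d" "d \<le> \<gamma>" and u: "\<bar>u\<bar> \<le> d * (\<bar>t\<bar> + t\<^sup>2)"
    and r: "\<bar>u + r\<bar> \<le> d\<^sup>2 * (\<bar>t\<bar> + t\<^sup>2)"
  shows "exp (t\<^sup>2 / 2) * \<bar>exp u - 1 + r\<bar> \<le> d\<^sup>2 * ((1 / \<gamma>\<^sup>2 + 1 / \<gamma>) * lam) * exp (\<rho> * t\<^sup>2 / 2)"
proof -
  let ?X = "\<bar>t\<bar> + t\<^sup>2"
  \<comment> \<open>Its fourth power is what \<open>exp_gamma_le\<close> controls with
    \<open>i = 0\<close>, so the powers 3 and 1 that occur are raised to 4.\<close>
  define E where "E = exp (\<gamma> * ?X)"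
  have X: "0 \<le> ?X" by simp
  have E1: "1 \<le> E" using gamma by (simp add: E_def)
  have XE: "?X \<le> E / \<gamma>"
  proof -
    have "\<gamma> * ?X \<le> E" using exp_ge_add_one_self[of "\<gamma> * ?X"] unfolding E_def by linarith
    then show ?thesis using gamma by (simp add: pos_le_divide_eq mult.commute)
  qed
  have E4: "E ^ 4 \<le> lam * exp (2 * ln lam * t\<^sup>2)"
  proof -
    have "E ^ 4 = exp (2 * \<gamma> * (\<bar>t\<bar> + t\<^sup>2 + real 0)) ^ 2"
      by (simp add: E_def flip: exp_of_nat_mult)
    also have "\<dots> \<le> lam * exp (2 * ln lam * t\<^sup>2) * lam ^ 0" by (rule exp_gamma_le)
    finally show ?thesis by simp
  qed
  have "\<bar>exp u - 1 - u\<bar> \<le> d\<^sup>2 * (1 / \<gamma>\<^sup>2) * E ^ 4"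
  proof -
    have "\<bar>exp u - 1 - u\<bar> \<le> u\<^sup>2 * exp \<bar>u\<bar>" by (rule abs_exp_minus_one_minus)
    also have "\<dots> \<le> (d * (E / \<gamma>))\<^sup>2 * E"
    proof (rule mult_mono)
      have "\<bar>u\<bar> \<le> d * (E / \<gamma>)" using u mult_left_mono[OF XE d(1)] by linarith
      then show "u\<^sup>2 \<le> (d * (E / \<gamma>))\<^sup>2" using power_mono[of "\<bar>u\<bar>" "d * (E / \<gamma>)" 2] by simp
      have "\<bar>u\<bar> \<le> \<gamma> * ?X" using u mult_right_mono[OF d(2) X] by linarith
      then show "exp \<bar>u\<bar> \<le> E" by (simp add: E_def)
    qed (use E1 in auto)
    also have "\<dots> = d\<^sup>2 * (1 / \<gamma>\<^sup>2) * E ^ 3"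
      by (simp add: power_mult_distrib power_divide power3_eq_cube power2_eq_square)
    also have "\<dots> \<le> d\<^sup>2 * (1 / \<gamma>\<^sup>2) * E ^ 4"
      using E1 by (intro mult_left_mono power_increasing) auto
    finally show ?thesis .
  qed
  moreover have "\<bar>u + r\<bar> \<le> d\<^sup>2 * (1 / \<gamma>) * E ^ 4"
  proof -
    have "\<bar>u + r\<bar> \<le> d\<^sup>2 * (E / \<gamma>)" using r mult_left_mono[OF XE, of "d\<^sup>2"] by simp
    also have "\<dots> = d\<^sup>2 * (1 / \<gamma>) * E ^ 1" by simp
    also have "\<dots> \<le> d\<^sup>2 * (1 / \<gamma>) * E ^ 4"
      using E1 gamma by (intro mult_left_mono power_increasing) auto
    finally show ?thesis .
  qed
  moreover have "\<bar>exp u - 1 + r\<bar> \<le> \<bar>exp u - 1 - u\<bar> + \<bar>u + r\<bar>" by linarith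
  moreover have "d\<^sup>2 * (1 / \<gamma>\<^sup>2 + 1 / \<gamma>) * E ^ 4 = d\<^sup>2 * (1 / \<gamma>\<^sup>2) * E ^ 4 + d\<^sup>2 * (1 / \<gamma>) * E ^ 4"
    by (simp add: algebra_simps)
  ultimately have "\<bar>exp u - 1 + r\<bar> \<le> d\<^sup>2 * (1 / \<gamma>\<^sup>2 + 1 / \<gamma>) * E ^ 4" by linarith
  also have "\<dots> \<le> d\<^sup>2 * (1 / \<gamma>\<^sup>2 + 1 / \<gamma>) * (lam * exp (2 * ln lam * t\<^sup>2))"
    using E4 gamma by (intro mult_left_mono) auto
  finally have "exp (t\<^sup>2 / 2) * \<bar>exp u - 1 + r\<bar> \<le> exp (t\<^sup>2 / 2) * (d\<^sup>2 * (1 / \<gamma>\<^sup>2 + 1 / \<gamma>) * (lam * exp (2 * ln lam * t\<^sup>2)))"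
    by (intro mult_left_mono) auto
  also have "\<dots> = d\<^sup>2 * ((1 / \<gamma>\<^sup>2 + 1 / \<gamma>) * lam) * exp (t\<^sup>2 / 2 + 2 * ln lam * t\<^sup>2)"
    by (simp add: exp_add mult_ac)
  also have "\<dots> \<le> d\<^sup>2 * ((1 / \<gamma>\<^sup>2 + 1 / \<gamma>) * lam) * exp (\<rho> * t\<^sup>2 / 2)"
  proof (intro mult_left_mono)
    have "2 * ln lam = ln (lam\<^sup>2)" using lam by (simp add: ln_realpow)
    also have "\<dots> \<le> lam\<^sup>2" using lam ln_le_minus_one[of "lam\<^sup>2"] by simp
    finally have "1 / 2 + 2 * ln lam \<le> \<rho> / 2" by (simp add: \<rho>_def)
    from mult_right_mono[OF this, of "t\<^sup>2"]
    show "exp (t\<^sup>2 / 2 + 2 * ln lam * t\<^sup>2) \<le> exp (\<rho> * t\<^sup>2 / 2)"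
      by (simp add: algebra_simps)
  qed (use gamma lam in auto)
  finally show ?thesis .
qed

end

section \<open>Residual process against Hermite series\<close>

context growth begin

text \<open>The bounds for the perturbed series and for the quadratic remainder, taken at
  \<open>d = 6 * lam * sqrt M / sqrt n\<close>, the latter times \<open>sqrt n\<close>; the common
  factor \<open>1 / sqrt n\<close> is taken out.\<close>

definition remainder_const :: "real \<Rightarrow> real" where
  "remainder_const M = 6 * (lam * sqrt M) * (sqrt M * sqrt lam / \<gamma>) +
     36 * (lam * sqrt M)\<^sup>2 * ((1 / \<gamma>\<^sup>2 + 1 / \<gamma>) * lam)"

lemma raw_process_herm_series:
  assumes n: "n > 0"
  shows "herm_series (herm_coeff n z) t = raw_process n z t -
    exp (t\<^sup>2 / 2) * (herm_coeff n z 1 * t + herm_coeff n z 2 * t\<^sup>2 / sqrt 2)"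
proof -
  let ?x = "herm_coeff n z"
  have "(\<lambda>i. ?x i * phi i t - (if i \<in> {..<3} then ?x i * phi i t else 0)) sums
      (raw_process n z t - (\<Sum>i<3. ?x i * phi i t))"
    by (intro sums_diff raw_process_sums n sums_If_finite_set) simp
  moreover have "?x i * phi i t - (if i \<in> {..<3} then ?x i * phi i t else 0) =
      ?x i * (if i < 3 then 0 else phi i t)" for i by simp
  ultimately have "herm_series ?x t = raw_process n z t - (\<Sum>i<3. ?x i * phi i t)"
    unfolding herm_series_def by (simp add: sums_iff)
  also have "(\<Sum>i<3. ?x i * phi i t) = exp (t\<^sup>2 / 2) * (?x 1 * t + ?x 2 * t\<^sup>2 / sqrt 2)"
  proof -
    have "?x 0 = 0" by (simp add: herm_coeff_def hfun_def)
    then show ?thesis by (simp add: eval_nat_numeral phi_def algebra_simps)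
  qed
  finally show ?thesis .
qed

text \<open>The difference splits into \<open>?D\<close>, the change of the random series under
  rescaling, and \<open>rn * ?Q\<close>, a linearization error: the linear part of the mean mismatch
  cancels the terms of index 1 and 2. The smallness assumptions admit \<open>scale_bounds\<close>
  and make the first-order exponents at most \<gamma> times
  \<open>\<bar>t\<bar> + t\<^sup>2 + real i\<close>.\<close>

lemma residual_process_approx:
  assumes n: "n > 0" and x: "seq_norm (herm_coeff n z) \<le> ennreal M" "0 \<le> M"
    and small: "lam * sqrt M / sqrt (real n) \<le> 1 / 8" "6 * (lam * sqrt M / sqrt (real n)) \<le> \<gamma>"
  shows "\<bar>raw_process n (\<lambda>j. (z j - smean n z) / ssd n z) t - herm_series (herm_coeff n z) t\<bar> \<le>
    remainder_const M / sqrt (real n) * exp (\<rho> * t\<^sup>2 / 2)"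
proof -
  define x where "x = herm_coeff n z"
  define R where "R = lam * sqrt M"
  define e where "e = R / sqrt (real n)"
  define a where "a = smean n z"
  define q where "q = (\<Sum>j<n. (z j)\<^sup>2) / real n"
  define b where "b = 1 / sqrt (q - a\<^sup>2)"
  define u where "u i = - t * a * b + t\<^sup>2 * (b\<^sup>2 - 1) / 2 + real i * ln b" for i
  define r where "r = t * a + t\<^sup>2 * (q - 1) / 2"
  define rn where "rn = sqrt (real n)"
  have rn: "rn > 0" "real n = rn * rn" using n by (simp_all add: rn_def)
  have R0: "0 \<le> R" using lam x(2) by (simp add: R_def)
  have e: "0 \<le> e" "e \<le> 1/8" "6 * e \<le> \<gamma>" using R0 small by (simp_all add: e_def R_def)
  \<comment> \<open>The bound on the weighted norm controls a single coefficient up to the weight,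
    at most \<open>lam\<^sup>2\<close> here.\<close>
  have xR: "\<bar>x i\<bar> \<le> R" if "i = 1 \<or> i = 2" for i
  proof -
    have "(x i)\<^sup>2 / lam ^ i \<le> (\<Sum>k<3. (x k)\<^sup>2 / lam ^ k)"
      using that lam by (intro member_le_sum) auto
    also have "\<dots> \<le> M" unfolding x_def by (rule seq_norm_partial_sum[OF x])
    finally have "(x i)\<^sup>2 \<le> M * lam ^ i" using lam by (simp add: field_simps)
    also have "\<dots> \<le> M * lam ^ 2" using that lam x(2) by (intro mult_left_mono power_increasing) auto
    also have "\<dots> = R\<^sup>2" using x(2) by (simp add: R_def power_mult_distrib)
    finally show ?thesis using R0 abs_le_square_iff[of "x i" R] by simp
  qed
  \<comment> \<open>Up to a factor \<open>sqrt 2\<close> for the second, the coefficients 1 and 2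
    are the errors of sample mean and second moment times \<open>sqrt n\<close>. Thus
    \<open>xR\<close> makes \<open>a\<close> and \<open>q - 1\<close> of order
    \<open>1 / sqrt n\<close>.\<close>
  have x1: "x 1 = rn * a"
  proof -
    have "(\<Sum>j<n. z j) = real n * a" using n by (simp add: a_def smean_def)
    then show ?thesis using rn by (simp add: x_def herm_coeff_def hfun_1 rn_def[symmetric])
  qed
  have x2: "x 2 = rn * (q - 1) / sqrt 2"
  proof -
    have "(\<Sum>j<n. (z j)\<^sup>2) = real n * q" using n by (simp add: q_def)
    then have "(\<Sum>j<n. (z j)\<^sup>2 - 1) = rn * rn * (q - 1)" using rn by (simp add: sum_subtractf algebra_simps)
    then have "(\<Sum>j<n. hfun 2 (z j)) = rn * rn * (q - 1) / sqrt 2"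
      by (simp only: hfun_2 sum_divide_distrib[symmetric])
    then show ?thesis using rn by (simp add: x_def herm_coeff_def rn_def[symmetric])
  qed
  have a: "\<bar>a\<bar> \<le> e"
    using xR[of 1] rn(1) unfolding x1 by (simp add: abs_mult e_def rn_def[symmetric] pos_le_divide_eq mult.commute)
  have q: "\<bar>q - 1\<bar> \<le> 2 * e"
  proof -
    have "rn * \<bar>q - 1\<bar> \<le> R * sqrt 2"
      using xR[of 2] rn(1) unfolding x2 by (simp add: abs_mult pos_divide_le_eq)
    also have "\<dots> \<le> R * 2" using R0 sqrt2_less_2 by (intro mult_left_mono) auto
    finally show ?thesis using rn(1) by (simp add: e_def rn_def[symmetric] pos_le_divide_eq mult.commute)
  qed
  note sc = scale_bounds[OF e(1,2) a q, folded b_def]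
  have b: "b > 0" by (rule sc(1))
  have u: "\<bar>u i\<bar> \<le> 6 * e * (\<bar>t\<bar> + t\<^sup>2 + real i)" for i
    unfolding u_def by (rule sc(2))
  have ur: "\<bar>u 0 + r\<bar> \<le> (6 * e)\<^sup>2 * (\<bar>t\<bar> + t\<^sup>2)"
  proof -
    have "\<bar>u 0 + r\<bar> \<le> 10 * e\<^sup>2 * (\<bar>t\<bar> + t\<^sup>2)"
      using sc(3)[of t] by (simp add: u_def r_def add.assoc)
    also have "\<dots> \<le> (6 * e)\<^sup>2 * (\<bar>t\<bar> + t\<^sup>2)"
      by (intro mult_right_mono) (auto simp: power_mult_distrib)
    finally show ?thesis .
  qed
  let ?D = "exp (- t * a * b) * raw_process n z (t * b) - raw_process n z t"
  have "(\<lambda>i. exp (- t * a * b) * (x i * phi i (t * b)) - x i * phi i t) sums ?D"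
    unfolding x_def by (intro sums_diff sums_mult raw_process_sums n)
  moreover have "exp (- t * a * b) * (x i * phi i (t * b)) - x i * phi i t = x i * (phi i t * (exp (u i) - 1))" for i
    using phi_scale[OF b, of t a i] unfolding u_def by (simp add: algebra_simps)
  ultimately have D: "?D = (\<Sum>i. x i * (phi i t * (exp (u i) - 1)))"
    by (simp add: sums_iff)
  have D_bound: "\<bar>?D\<bar> \<le> 6 * e * (sqrt M * sqrt lam / \<gamma>) * exp (\<rho> * t\<^sup>2 / 2)"
    unfolding D x_def using e u by (intro perturbed_series_bound x) auto
  \<comment> \<open>Of second order in \<open>e\<close>, so that multiplication by \<open>rn\<close>
    still leaves order \<open>1 / sqrt n\<close>.\<close>
  let ?Q = "exp (t\<^sup>2 / 2) * (exp (u 0) - 1 + r)"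
  have Q_bound: "\<bar>?Q\<bar> \<le> (6 * e)\<^sup>2 * ((1 / \<gamma>\<^sup>2 + 1 / \<gamma>) * lam) * exp (\<rho> * t\<^sup>2 / 2)"
    using quadratic_remainder_bound[of "6 * e" "u 0" t r] e u[of 0] ur by (simp add: abs_mult)
  have "(\<lambda>j. (z j - smean n z) / ssd n z) = (\<lambda>j. (z j - a) * b)"
    by (simp add: a_def b_def ssd_def q_def)
  then have "raw_process n (\<lambda>j. (z j - smean n z) / ssd n z) t =
      exp (- t * a * b) * raw_process n z (t * b) + exp (t\<^sup>2 / 2) * (rn * (exp (u 0) - 1))"
    using residual_process_eq[OF n b, of z a t] by (simp add: u_def rn_def)
  moreover have "herm_series x t = raw_process n z t - exp (t\<^sup>2 / 2) * (rn * r)"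
  proof -
    have "x 2 * t\<^sup>2 / sqrt 2 = rn * (t\<^sup>2 * (q - 1) / 2)"
      unfolding x2 by (simp add: field_simps)
    then have "x 1 * t + x 2 * t\<^sup>2 / sqrt 2 = rn * r" unfolding x1 r_def by (simp add: algebra_simps)
    then show ?thesis unfolding x_def raw_process_herm_series[OF n] by simp
  qed
  ultimately have "raw_process n (\<lambda>j. (z j - smean n z) / ssd n z) t - herm_series x t = ?D + rn * ?Q"
    by (simp add: algebra_simps)
  also have "\<bar>?D + rn * ?Q\<bar> \<le> \<bar>?D\<bar> + rn * \<bar>?Q\<bar>"
    using rn(1) abs_triangle_ineq[of ?D "rn * ?Q"] by (simp add: abs_mult)
  also have "\<dots> \<le> 6 * e * (sqrt M * sqrt lam / \<gamma>) * exp (\<rho> * t\<^sup>2 / 2) +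
      rn * ((6 * e)\<^sup>2 * ((1 / \<gamma>\<^sup>2 + 1 / \<gamma>) * lam) * exp (\<rho> * t\<^sup>2 / 2))"
    using D_bound Q_bound rn(1) by (intro add_mono mult_left_mono) auto
  also have "\<dots> = remainder_const M / rn * exp (\<rho> * t\<^sup>2 / 2)"
  proof -
    have "rn * (6 * e)\<^sup>2 = 36 * R\<^sup>2 / rn" "6 * e = 6 * R / rn"
      using rn(1) by (simp_all add: e_def rn_def[symmetric] power2_eq_square)
    then have "6 * e * (sqrt M * sqrt lam / \<gamma>) + rn * (6 * e)\<^sup>2 * ((1 / \<gamma>\<^sup>2 + 1 / \<gamma>) * lam) = remainder_const M / rn"
      unfolding remainder_const_def R_def[symmetric] by (simp add: add_divide_distrib)
    moreover have "6 * e * (sqrt M * sqrt lam / \<gamma>) * exp (\<rho> * t\<^sup>2 / 2) +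
        rn * ((6 * e)\<^sup>2 * ((1 / \<gamma>\<^sup>2 + 1 / \<gamma>) * lam) * exp (\<rho> * t\<^sup>2 / 2)) =
        (6 * e * (sqrt M * sqrt lam / \<gamma>) + rn * (6 * e)\<^sup>2 * ((1 / \<gamma>\<^sup>2 + 1 / \<gamma>) * lam)) * exp (\<rho> * t\<^sup>2 / 2)"
      by (simp only: distrib_right mult.assoc)
    ultimately show ?thesis by (simp only:)
  qed
  finally show ?thesis by (simp add: x_def rn_def)
qed

text \<open>A crude bound from \<open>t * y \<le> y\<^sup>2 / 2 + t\<^sup>2 / 2\<close>, not uniform
  in the data; it only serves membership in the weighted space for each outcome.\<close>

lemma raw_process_bound:
  assumes "n > 0"
  shows "\<bar>raw_process n y t\<bar> \<le> sqrt (real n) * ((\<Sum>j<n. exp ((y j)\<^sup>2 / 2)) + 1) * exp (\<rho> * t\<^sup>2 / 2)"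
proof -
  let ?E = "exp (\<rho> * t\<^sup>2 / 2)"
  have t2: "exp (t\<^sup>2 / 2) \<le> ?E" using mult_right_mono[of 1 \<rho> "t\<^sup>2"] rho(1) by simp
  have "exp (t * y j) \<le> exp ((y j)\<^sup>2 / 2) * ?E" for j
  proof -
    have "0 \<le> (t - y j)\<^sup>2" by simp
    then have "t * y j \<le> (y j)\<^sup>2 / 2 + t\<^sup>2 / 2" by (simp add: power2_diff)
    then have "exp (t * y j) \<le> exp ((y j)\<^sup>2 / 2) * exp (t\<^sup>2 / 2)" by (simp flip: exp_add)
    also have "\<dots> \<le> exp ((y j)\<^sup>2 / 2) * ?E" using t2 by (intro mult_left_mono) auto
    finally show ?thesis .
  qed
  then have "(\<Sum>j<n. exp (t * y j)) \<le> (\<Sum>j<n. exp ((y j)\<^sup>2 / 2)) * ?E"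
    by (simp add: sum_distrib_right sum_mono)
  moreover have "(\<Sum>j<n. exp (t * y j)) / real n \<le> (\<Sum>j<n. exp (t * y j))"
    using assms by (intro divide_le_eq_1_pos[THEN iffD2] order_trans[OF divide_left_mono[of 1 "real n"]])
      (auto intro: sum_nonneg)
  moreover have "0 \<le> (\<Sum>j<n. exp (t * y j)) / real n" by (intro divide_nonneg_nonneg sum_nonneg) auto
  ultimately have "\<bar>(\<Sum>j<n. exp (t * y j)) / real n - exp (t\<^sup>2 / 2)\<bar> \<le> (\<Sum>j<n. exp ((y j)\<^sup>2 / 2)) * ?E + ?E"
    using t2 exp_ge_zero[of "t\<^sup>2 / 2"] by linarith
  from mult_left_mono[OF this, of "sqrt (real n)"] show ?thesis
    unfolding raw_process_def abs_mult by (simp add: algebra_simps)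
qed

lemma raw_process_measurable [measurable]: "raw_process n y \<in> borel_measurable borel"
  unfolding raw_process_def by measurable

lemma raw_process_sq_integrable: "n > 0 \<Longrightarrow> raw_process n y \<in> sq_integrable H"
  by (rule sq_integrable_bound(1)[OF _ raw_process_bound]) measurable

text \<open>A local Lipschitz bound in the data. The \<open>+ 2\<close> collects two factors
  \<open>exp \<bar>t\<bar>\<close>: one bounds \<open>\<bar>t\<bar>\<close> itself, the other the
  exponential of the increment.\<close>

lemma raw_process_diff_bound:
  assumes n: "n > 0" and y: "\<And>j. j < n \<Longrightarrow> \<bar>y j - y' j\<bar> \<le> 1"
  shows "\<bar>raw_process n y t - raw_process n y' t\<bar> \<le>
    sqrt (real n) * (\<Sum>j<n. exp ((\<bar>y j\<bar> + 2)\<^sup>2 / 2) * \<bar>y j - y' j\<bar>) * exp (\<rho> * t\<^sup>2 / 2)"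
proof -
  let ?E = "exp (\<rho> * t\<^sup>2 / 2)"
  have d: "\<bar>exp (t * y j) - exp (t * y' j)\<bar> \<le> exp ((\<bar>y j\<bar> + 2)\<^sup>2 / 2) * \<bar>y j - y' j\<bar> * ?E" if "j < n" for j
  proof -
    let ?d = "\<bar>y j - y' j\<bar>"
    have "exp (t * y j) - exp (t * y' j) = exp (t * y j) * (1 - exp (t * (y' j - y j)))"
      by (simp add: algebra_simps flip: exp_add)
    then have "\<bar>exp (t * y j) - exp (t * y' j)\<bar> = exp (t * y j) * \<bar>exp (t * (y' j - y j)) - 1\<bar>"
      by (simp add: abs_mult abs_minus_commute)
    also have "\<dots> \<le> exp (\<bar>t\<bar> * \<bar>y j\<bar>) * (\<bar>t * (y' j - y j)\<bar> * exp \<bar>t * (y' j - y j)\<bar>)"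
    proof (intro mult_mono abs_exp_minus_one)
      show "exp (t * y j) \<le> exp (\<bar>t\<bar> * \<bar>y j\<bar>)"
        unfolding exp_le_cancel_iff abs_mult[symmetric] by (rule abs_ge_self)
    qed auto
    also have "\<dots> \<le> exp (\<bar>t\<bar> * \<bar>y j\<bar>) * ((?d * exp \<bar>t\<bar>) * exp \<bar>t\<bar>)"
    proof (intro mult_left_mono mult_mono)
      have "\<bar>t\<bar> \<le> exp \<bar>t\<bar>" using exp_ge_add_one_self[of "\<bar>t\<bar>"] by linarith
      then show "\<bar>t * (y' j - y j)\<bar> \<le> ?d * exp \<bar>t\<bar>"
        unfolding abs_mult abs_minus_commute[of "y' j"] mult.commute[of "\<bar>t\<bar>"] by (rule mult_left_mono) simp
      show "exp \<bar>t * (y' j - y j)\<bar> \<le> exp \<bar>t\<bar>"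
        using y[OF that] by (simp add: abs_mult abs_minus_commute mult_left_le)
    qed auto
    also have "\<dots> = ?d * exp (\<bar>t\<bar> * (\<bar>y j\<bar> + 2))"
      by (simp add: algebra_simps flip: exp_add)
    also have "\<dots> \<le> ?d * (exp ((\<bar>y j\<bar> + 2)\<^sup>2 / 2) * ?E)"
    proof (intro mult_left_mono)
      have "0 \<le> (\<bar>t\<bar> - (\<bar>y j\<bar> + 2))\<^sup>2" by simp
      then have "\<bar>t\<bar> * (\<bar>y j\<bar> + 2) \<le> (\<bar>y j\<bar> + 2)\<^sup>2 / 2 + t\<^sup>2 / 2"
        unfolding power2_diff[of "\<bar>t\<bar>"] by simp
      moreover have "t\<^sup>2 \<le> \<rho> * t\<^sup>2" using mult_right_mono[of 1 \<rho> "t\<^sup>2"] rho(1) by simp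
      ultimately show "exp (\<bar>t\<bar> * (\<bar>y j\<bar> + 2)) \<le> exp ((\<bar>y j\<bar> + 2)\<^sup>2 / 2) * ?E"
        unfolding exp_add[symmetric] exp_le_cancel_iff by linarith
    qed auto
    finally show ?thesis by (simp add: mult_ac)
  qed
  have "raw_process n y t - raw_process n y' t = sqrt (real n) * ((\<Sum>j<n. exp (t * y j) - exp (t * y' j)) / real n)"
    unfolding raw_process_def by (simp add: algebra_simps sum_subtractf diff_divide_distrib)
  then have "\<bar>raw_process n y t - raw_process n y' t\<bar> = sqrt (real n) * (\<bar>\<Sum>j<n. exp (t * y j) - exp (t * y' j)\<bar> / real n)"
    by (simp add: abs_mult)
  also have "\<dots> \<le> sqrt (real n) * (\<Sum>j<n. exp ((\<bar>y j\<bar> + 2)\<^sup>2 / 2) * \<bar>y j - y' j\<bar> * ?E)"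
  proof (intro mult_left_mono)
    let ?S = "\<bar>\<Sum>j<n. exp (t * y j) - exp (t * y' j)\<bar>"
    have "?S / real n \<le> ?S / 1" using n by (intro divide_left_mono) auto
    also have "\<dots> \<le> (\<Sum>j<n. exp ((\<bar>y j\<bar> + 2)\<^sup>2 / 2) * \<bar>y j - y' j\<bar> * ?E)"
      unfolding div_by_1 using d by (intro order_trans[OF sum_abs] sum_mono) auto
    finally show "?S / real n \<le> (\<Sum>j<n. exp ((\<bar>y j\<bar> + 2)\<^sup>2 / 2) * \<bar>y j - y' j\<bar> * ?E)" .
  qed simp
  finally show ?thesis by (simp add: sum_distrib_right mult.assoc)
qed

text \<open>Makes the residual element measurable as a continuous function of the measurable
  sequence of residuals.\<close>

lemma continuous_raw_process:
  assumes n: "n > 0"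
  shows "continuous_map euclidean (L2_topology H) (\<lambda>y. L2_class H (raw_process n y))"
  unfolding L2_topology_def Metric_space.continuous_map_to_metric[OF Metric_space_H]
proof (intro ballI allI impI)
  fix y :: "nat \<Rightarrow> real" and e :: real assume e: "e > 0"
  let ?S = "\<lambda>y'. \<Sum>j<n. exp ((\<bar>y j\<bar> + 2)\<^sup>2 / 2) * \<bar>y j - y' j\<bar>"
  \<comment> \<open>The second set forces \<open>\<bar>y j - y' j\<bar> \<le> 1\<close>, since every
    exponential weight is at least 1.\<close>
  define U where "U = {y'. sqrt (real n) * ?S y' * sqrt KH < e} \<inter> {y'. ?S y' < 1}"
  have "open U" unfolding U_def
    by (intro open_Int open_Collect_less continuous_intros continuous_on_product_coordinates)
  moreover have "y \<in> U" using e by (simp add: U_def)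
  moreover have "L2_class H (raw_process n y') \<in> Metric_space.mball (L2_space H) (L2_dist H) (L2_class H (raw_process n y)) e"
    if y': "y' \<in> U" for y'
  proof -
    have "\<bar>y j - y' j\<bar> \<le> 1" if "j < n" for j
    proof -
      have "1 * \<bar>y j - y' j\<bar> \<le> exp ((\<bar>y j\<bar> + 2)\<^sup>2 / 2) * \<bar>y j - y' j\<bar>"
        by (intro mult_right_mono) auto
      also have "\<dots> \<le> ?S y'" using that by (intro member_le_sum) auto
      finally show ?thesis using y' by (simp add: U_def)
    qed
    then have "L2_dist H (L2_class H (raw_process n y)) (L2_class H (raw_process n y')) \<le> sqrt (real n) * ?S y' * sqrt KH"
      by (intro L2_dist_bound raw_process_sq_integrable raw_process_diff_bound n)
    then show ?thesis using y'
      by (simp add: U_def Metric_space.in_mball[OF Metric_space_H] L2_class_in_space raw_process_sq_integrable n)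
  qed
  ultimately show "\<exists>U. openin euclidean U \<and> y \<in> U \<and> (\<forall>y'\<in>U. L2_class H (raw_process n y') \<in>
      Metric_space.mball (L2_space H) (L2_dist H) (L2_class H (raw_process n y)) e)"
    by (intro exI[of _ U]) auto
qed

lemma seq_norm_tail_probability:
  fixes Q :: "'v measure"
  assumes Q: "prob_space Q" and V: "V \<in> borel_measurable Q"
    and E: "(\<integral>\<^sup>+\<omega>. seq_norm (V \<omega>) \<partial>Q) \<le> ennreal C" and M: "0 < M" and C: "0 \<le> C"
  shows "{\<omega> \<in> space Q. \<not> seq_norm (V \<omega>) \<le> ennreal M} \<in> sets Q"
    "measure Q {\<omega> \<in> space Q. \<not> seq_norm (V \<omega>) \<le> ennreal M} \<le> C / M"
proof -
  interpret prob_space Q by fact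
  have [measurable]: "(\<lambda>\<omega>. seq_norm (V \<omega>)) \<in> borel_measurable Q"
    using measurable_compose[OF V seq_norm_measurable] .
  let ?A = "{\<omega> \<in> space Q. \<not> seq_norm (V \<omega>) \<le> ennreal M}"
  show "?A \<in> sets Q" by measurable
  have "emeasure Q ?A \<le> emeasure Q {\<omega> \<in> space Q. 1 \<le> ennreal (1 / M) * seq_norm (V \<omega>)}"
  proof (rule emeasure_mono)
    have "1 \<le> ennreal (1 / M) * s" if "ennreal M \<le> s" for s
    proof -
      have "1 = ennreal (1 / M) * ennreal M" using M by (simp flip: ennreal_mult)
      also have "\<dots> \<le> ennreal (1 / M) * s" using that by (intro mult_left_mono) auto
      finally show ?thesis .
    qed
    then show "?A \<subseteq> {\<omega> \<in> space Q. 1 \<le> ennreal (1 / M) * seq_norm (V \<omega>)}" by auto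
  qed measurable
  also have "\<dots> \<le> ennreal (1 / M) * (\<integral>\<^sup>+\<omega>. seq_norm (V \<omega>) * indicator (space Q) \<omega> \<partial>Q)"
    by (rule nn_integral_Markov_inequality) measurable
  also have "(\<integral>\<^sup>+\<omega>. seq_norm (V \<omega>) * indicator (space Q) \<omega> \<partial>Q) = (\<integral>\<^sup>+\<omega>. seq_norm (V \<omega>) \<partial>Q)"
    by (intro nn_integral_cong) simp
  also have "ennreal (1 / M) * (\<integral>\<^sup>+\<omega>. seq_norm (V \<omega>) \<partial>Q) \<le> ennreal (1 / M) * ennreal C"
    by (intro mult_left_mono E) simp
  also have "\<dots> = ennreal (C / M)" using M C by (simp flip: ennreal_mult)
  finally show "measure Q ?A \<le> C / M"
    using M C by (simp add: emeasure_eq_measure)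
qed

end

lemma expectation_diff_le:
  fixes U V :: "'v \<Rightarrow> real"
  assumes "prob_space Q" and [measurable]: "U \<in> borel_measurable Q" "V \<in> borel_measurable Q" "A \<in> sets Q"
    and U: "\<And>\<omega>. \<omega> \<in> space Q \<Longrightarrow> 0 \<le> U \<omega> \<and> U \<omega> \<le> B"
    and V: "\<And>\<omega>. \<omega> \<in> space Q \<Longrightarrow> 0 \<le> V \<omega> \<and> V \<omega> \<le> B"
    and close: "\<And>\<omega>. \<omega> \<in> space Q \<Longrightarrow> \<omega> \<notin> A \<Longrightarrow> \<bar>U \<omega> - V \<omega>\<bar> \<le> e" and "0 \<le> e"
  shows "\<bar>(\<integral>\<omega>. U \<omega> \<partial>Q) - (\<integral>\<omega>. V \<omega> \<partial>Q)\<bar> \<le> e + B * measure Q A"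
proof -
  interpret prob_space Q by fact
  have int: "integrable Q U" "integrable Q V"
    using U V by (auto intro!: integrable_const_bound[where B = B])
  have intA: "integrable Q (\<lambda>\<omega>. e + B * indicator A \<omega>)"
    by (intro Bochner_Integration.integrable_add integrable_mult_right) (auto simp: less_top[symmetric])
  have "\<bar>(\<integral>\<omega>. U \<omega> \<partial>Q) - (\<integral>\<omega>. V \<omega> \<partial>Q)\<bar> = \<bar>\<integral>\<omega>. U \<omega> - V \<omega> \<partial>Q\<bar>"
    using int by simp
  also have "\<dots> \<le> (\<integral>\<omega>. \<bar>U \<omega> - V \<omega>\<bar> \<partial>Q)" by (rule integral_abs_bound)
  also have "\<dots> \<le> (\<integral>\<omega>. e + B * indicator A \<omega> \<partial>Q)"
  proof (rule integral_mono)
    fix \<omega> assume \<omega>: "\<omega> \<in> space Q"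
    have "\<bar>U \<omega> - V \<omega>\<bar> \<le> B" using U[OF \<omega>] V[OF \<omega>] by linarith
    then show "\<bar>U \<omega> - V \<omega>\<bar> \<le> e + B * indicator A \<omega>"
      using close[OF \<omega>] \<open>0 \<le> e\<close> by (cases "\<omega> \<in> A") auto
  qed (use int intA in auto)
  also have "\<dots> = e + B * measure Q A"
  proof -
    have "integrable Q (\<lambda>\<omega>. B * indicator A \<omega>)"
      by (intro integrable_mult_right) (auto simp: less_top[symmetric])
    then show ?thesis
      using sets.sets_into_space[OF \<open>A \<in> sets Q\<close>] by (simp add: prob_space Int_absorb2)
  qed
  finally show ?thesis .
qed

section \<open>Convergence of the residual process\<close>

text \<open>The left side of the growth condition is continuous with value 2 at 1, so any
  \<open>lam\<close> slightly above 1 works.\<close>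

lemma exists_growth: "\<beta> > 2 \<Longrightarrow> \<exists>lam. growth \<beta> lam"
proof -
  assume \<beta>: "\<beta> > 2"
  have "((\<lambda>l::real. 1 + 2 * ln l + l\<^sup>2) \<longlongrightarrow> 1 + 2 * ln 1 + 1\<^sup>2) (at_right 1)"
    by (intro tendsto_intros) auto
  then have "\<forall>\<^sub>F l in at_right 1. 1 + 2 * ln l + l\<^sup>2 < \<beta>"
    using \<beta> by (intro order_tendstoD(2)) auto
  moreover have "\<forall>\<^sub>F l in at_right 1. (1::real) < l" by (rule eventually_at_right_less)
  ultimately have "\<forall>\<^sub>F l in at_right 1. growth \<beta> l" by eventually_elim (simp add: growth_def)
  then show ?thesis using eventually_happens trivial_limit_at_right_real by blast
qed

section \<open>The residual process as a random element\<close>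

locale growth_sample = growth \<beta> lam + normal_sample P Z
  for \<beta> lam :: real and P :: "'w measure" and Z :: "nat \<Rightarrow> 'w \<Rightarrow> real"
begin

definition residual_element :: "nat \<Rightarrow> 'w \<Rightarrow> (real \<Rightarrow> real) set" where
  "residual_element n \<omega> = L2_class H (raw_process n (\<lambda>j. (Z j \<omega> - smean n (\<lambda>j. Z j \<omega>)) / ssd n (\<lambda>j. Z j \<omega>)))"

lemma residual_element_measurable:
  assumes "n > 0"
  shows "residual_element n \<in> P \<rightarrow>\<^sub>M borel_of_topology (L2_topology H)"
proof -
  have "(\<lambda>\<omega> j. (Z j \<omega> - smean n (\<lambda>j. Z j \<omega>)) / ssd n (\<lambda>j. Z j \<omega>)) \<in> P \<rightarrow>\<^sub>M Pi\<^sub>M UNIV (\<lambda>_. borel)"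
    unfolding smean_def ssd_def by (rule measurable_PiM_single') auto
  then have "(\<lambda>\<omega> j. (Z j \<omega> - smean n (\<lambda>j. Z j \<omega>)) / ssd n (\<lambda>j. Z j \<omega>)) \<in> borel_measurable P"
    using measurable_cong_sets[OF refl sets_PiM_equal_borel] by blast
  from measurable_continuous_map_borel[OF this continuous_raw_process[OF assms]]
  show ?thesis unfolding residual_element_def[abs_def] .
qed

lemma xi_eq_herm_coeff: "xi n \<omega> = herm_coeff n (\<lambda>j. Z j \<omega>)"
  by (simp add: fun_eq_iff xi_def herm_coeff_def)

lemma xi_seq_norm:
  assumes "n > 0"
  shows "(\<integral>\<^sup>+\<omega>. seq_norm (xi n \<omega>) \<partial>P) \<le> ennreal (lam / (lam - 1))"
proof (rule seq_norm_expectation)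
  show "integrable P (\<lambda>\<omega>. (xi n \<omega> i)\<^sup>2) \<and> (\<integral>\<omega>. (xi n \<omega> i)\<^sup>2 \<partial>P) \<le> 1" for i
    using xi_second_moment[of i n] assms by (cases "i = 0") (auto simp: xi_0)
qed measurable

lemma residual_element_dist:
  assumes "n > 0" "seq_norm (xi n \<omega>) \<le> ennreal M" "0 \<le> M" "3 \<le> m"
    and "lam * sqrt M / sqrt (real n) \<le> 1 / 8" "6 * (lam * sqrt M / sqrt (real n)) \<le> \<gamma>"
  shows "L2_dist H (residual_element n \<omega>) (L2_class H (herm_part m (xi n \<omega>))) \<le>
    (remainder_const M / sqrt (real n) + sqrt (M / lam ^ m)) * sqrt KH"
  unfolding residual_element_def
proof (intro L2_dist_bound raw_process_sq_integrable herm_part_sq_integrable assms)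
  fix t
  let ?r = "raw_process n (\<lambda>j. (Z j \<omega> - smean n (\<lambda>j. Z j \<omega>)) / ssd n (\<lambda>j. Z j \<omega>)) t"
  have "\<bar>?r - herm_series (xi n \<omega>) t\<bar> \<le> remainder_const M / sqrt (real n) * exp (\<rho> * t\<^sup>2 / 2)"
    unfolding xi_eq_herm_coeff
    by (rule residual_process_approx) (use assms in \<open>simp_all add: xi_eq_herm_coeff\<close>)
  moreover have "\<bar>herm_series (xi n \<omega>) t - herm_part m (xi n \<omega>) t\<bar> \<le> sqrt (M / lam ^ m) * exp (\<rho> * t\<^sup>2 / 2)"
    by (rule herm_series_minus_part) (use assms in auto)
  ultimately show "\<bar>?r - herm_part m (xi n \<omega>) t\<bar> \<le>
      (remainder_const M / sqrt (real n) + sqrt (M / lam ^ m)) * exp (\<rho> * t\<^sup>2 / 2)"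
    unfolding distrib_right by linarith
qed

text \<open>Three comparisons: residual element with the truncated series of its coefficients, these
  coefficients with Gaussian ones, and the truncated Gaussian series with the limit. The outer two
  are deterministic where the weighted norm is at most \<open>M\<close>.\<close>

lemma residual_element_converges:
  "converges_in_distribution (L2_topology H) P residual_element gauss_seq gauss_limit"
proof (rule Metric_space.converges_in_distribution_lipschitz[OF Metric_space_H prob_space_axioms prob_space_gauss_seq,
      folded L2_topology_def, where ?n0.0 = 1])
  show "residual_element n \<in> P \<rightarrow>\<^sub>M borel_of_topology (L2_topology H)" if "n \<ge> 1" for n
    using that by (intro residual_element_measurable) simp
  show "gauss_limit \<in> gauss_seq \<rightarrow>\<^sub>M borel_of_topology (L2_topology H)"
    by (rule gauss_limit_measurable)
  fix F :: "(real \<Rightarrow> real) set \<Rightarrow> real" and L B :: real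
  assume F: "\<And>x. x \<in> L2_space H \<Longrightarrow> 0 \<le> F x \<and> F x \<le> B"
    and lip: "\<And>x y. x \<in> L2_space H \<Longrightarrow> y \<in> L2_space H \<Longrightarrow> \<bar>F x - F y\<bar> \<le> L * L2_dist H x y"
    and L: "0 \<le> L"
  define C where "C = lam / (lam - 1)"
  have C: "0 < C" using lam by (simp add: C_def)
  have B: "0 \<le> B" using F[OF L2_class_in_space[OF zero_sq_integrable]] by linarith
  have Fc: "continuous_map (L2_topology H) euclideanreal F"
    unfolding L2_topology_def by (rule Metric_space.continuous_map_lipschitz[OF Metric_space_H lip])
  define G where "G m x = F (L2_class H (herm_part m x))" for m x
  have Gc: "continuous_on UNIV (G m)" for m
    using continuous_map_compose[OF continuous_herm_part[of m] Fc]
    by (simp add: G_def[abs_def] comp_def)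
  have GB: "0 \<le> G m x \<and> G m x \<le> B" for m x
    unfolding G_def by (intro F L2_class_in_space herm_part_sq_integrable)
  have Gm [measurable]: "G m \<in> borel_measurable borel" for m
    using Gc by (rule borel_measurable_continuous_onI)
  show "(\<lambda>n. \<integral>\<omega>. F (residual_element n \<omega>) \<partial>P) \<longlonglongrightarrow> (\<integral>x. F (gauss_limit x) \<partial>gauss_seq)"
  proof (rule LIMSEQ_I)
    fix r :: real assume r: "r > 0"
    \<comment> \<open>Makes \<open>B\<close> times the tail probability at most
      \<open>r / 8\<close>; the summand 1 keeps \<open>M\<close> positive when
      \<open>B = 0\<close>.\<close>
    define M where "M = 8 * B * C / r + 1"
    have M: "0 < M" "B * (C / M) \<le> r / 8"
    proof -
      have "0 \<le> 8 * B * C / r" using B C r by simp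
      then show "0 < M" by (simp add: M_def)
      moreover have "8 * B * C \<le> r * M" using r by (simp add: M_def field_simps)
      ultimately show "B * (C / M) \<le> r / 8" by (simp add: field_simps)
    qed
    \<comment> \<open>The order of choice matters: \<open>m\<close> depends on \<open>M\<close>, and
      \<open>n\<close> comes last because the remainder constant grows with
      \<open>M\<close>.\<close>
    have "(\<lambda>m. L * (sqrt (M * (1 / lam) ^ m) * sqrt KH)) \<longlonglongrightarrow> L * (sqrt (M * 0) * sqrt KH)"
      using lam by (intro tendsto_intros LIMSEQ_power_zero) simp
    then have "\<forall>\<^sub>F m in sequentially. L * (sqrt (M * (1 / lam) ^ m) * sqrt KH) < r / 16"
      using r by (intro order_tendstoD(2)) auto
    then obtain m where m: "3 \<le> m" "L * (sqrt (M / lam ^ m) * sqrt KH) < r / 16"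
      using eventually_ge_at_top[of 3] eventually_happens'[OF sequentially_bot] eventually_conj
      by (metis (no_types, lifting) divide_inverse mult_1 power_inverse)
    have small: "(\<lambda>n. c / sqrt (real n)) \<longlonglongrightarrow> 0" for c :: real
      by real_asymp
    have "\<forall>\<^sub>F n in sequentially. lam * sqrt M / sqrt (real n) < 1 / 8"
      by (rule order_tendstoD(2)[OF small]) simp
    moreover have "\<forall>\<^sub>F n in sequentially. lam * sqrt M / sqrt (real n) < \<gamma> / 6"
      by (rule order_tendstoD(2)[OF small]) (use gamma in simp)
    moreover have "\<forall>\<^sub>F n in sequentially. (L * remainder_const M * sqrt KH) / sqrt (real n) < r / 16"
      by (rule order_tendstoD(2)[OF small]) (use r in simp)
    moreover have "\<forall>\<^sub>F n in sequentially. norm ((\<integral>\<omega>. G m (xi n \<omega>) \<partial>P) - (\<integral>x. G m x \<partial>gauss_seq)) < r / 8"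
    proof -
      have "(\<lambda>n. \<integral>\<omega>. G m (xi n \<omega>) \<partial>P) \<longlonglongrightarrow> (\<integral>x. G m x \<partial>gauss_seq)"
      proof (rule xi_convergence[where I = "{3..<m}"])
        show "\<bar>G m x\<bar> \<le> B" for x using GB[of m x] by simp
        show "G m x = G m y" if "\<forall>i\<in>{3..<m}. x i = y i" for x y
        proof -
          have "herm_part m x = herm_part m y" unfolding herm_part_def fun_eq_iff using that by auto
          then show ?thesis by (simp add: G_def)
        qed
      qed (use Gc in auto)
      from LIMSEQ_D[OF this, of "r / 8"] show ?thesis
        using r unfolding eventually_sequentially by simp
    qed
    ultimately have "\<forall>\<^sub>F n in sequentially. norm ((\<integral>\<omega>. F (residual_element n \<omega>) \<partial>P) - (\<integral>x. F (gauss_limit x) \<partial>gauss_seq)) < r"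
      using eventually_gt_at_top[of 0]
    proof eventually_elim
      case (elim n)
      have Wm: "residual_element n \<in> P \<rightarrow>\<^sub>M borel_of_topology (L2_topology H)"
        using elim by (intro residual_element_measurable)
      have Ws: "residual_element n \<omega> \<in> L2_space H" for \<omega>
        unfolding residual_element_def using elim by (intro L2_class_in_space raw_process_sq_integrable)
      have gs: "gauss_limit x \<in> L2_space H" for x
        unfolding gauss_limit_def using herm_series_sq_integrable zero_sq_integrable
        by (intro L2_class_in_space) auto
      have ps: "L2_class H (herm_part m x) \<in> L2_space H" for x
        by (intro L2_class_in_space herm_part_sq_integrable)
      have id: "(\<lambda>x. x) \<in> borel_measurable gauss_seq" by (simp add: measurable_gauss_seq)
      note tail1 = seq_norm_tail_probability[OF prob_space_axioms xi_measurable_seq xi_seq_norm[OF elim(5)] M(1),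
          folded C_def, OF less_imp_le[OF C]]
      note tail2 = seq_norm_tail_probability[OF prob_space_gauss_seq id gauss_seq_norm M(1),
          folded C_def, OF less_imp_le[OF C]]
      have "\<bar>(\<integral>\<omega>. F (residual_element n \<omega>) \<partial>P) - (\<integral>\<omega>. G m (xi n \<omega>) \<partial>P)\<bar> \<le>
          r / 8 + B * measure P {\<omega> \<in> space P. \<not> seq_norm (xi n \<omega>) \<le> ennreal M}"
      proof (rule expectation_diff_le[OF prob_space_axioms _ _ tail1(1)])
        show "(\<lambda>\<omega>. F (residual_element n \<omega>)) \<in> borel_measurable P"
          by (rule borel_measurable_continuous_map[OF Wm Fc])
        show "(\<lambda>\<omega>. G m (xi n \<omega>)) \<in> borel_measurable P"
          by (rule measurable_compose[OF xi_measurable_seq Gm])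
        show "\<bar>F (residual_element n \<omega>) - G m (xi n \<omega>)\<bar> \<le> r / 8"
          if "\<omega> \<in> space P" "\<omega> \<notin> {\<omega> \<in> space P. \<not> seq_norm (xi n \<omega>) \<le> ennreal M}" for \<omega>
        proof -
          have "\<bar>F (residual_element n \<omega>) - G m (xi n \<omega>)\<bar> \<le> L * L2_dist H (residual_element n \<omega>) (L2_class H (herm_part m (xi n \<omega>)))"
            unfolding G_def by (intro lip Ws ps)
          also have "\<dots> \<le> L * ((remainder_const M / sqrt (real n) + sqrt (M / lam ^ m)) * sqrt KH)"
          proof (rule mult_left_mono[OF _ L], rule residual_element_dist[OF elim(5) _ less_imp_le[OF M(1)] m(1)])
            show "seq_norm (xi n \<omega>) \<le> ennreal M" using that by simp
            show "lam * sqrt M / sqrt (real n) \<le> 1 / 8" using elim(1) by (rule less_imp_le)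
            show "6 * (lam * sqrt M / sqrt (real n)) \<le> \<gamma>" using elim(2) by linarith
          qed
          also have "\<dots> = (L * remainder_const M * sqrt KH) / sqrt (real n) + L * (sqrt (M / lam ^ m) * sqrt KH)"
            by (simp add: algebra_simps)
          also have "\<dots> \<le> r / 8" using elim(3) m(2) by linarith
          finally show ?thesis .
        qed
      qed (use F Ws GB r in auto)
      moreover have "\<bar>(\<integral>x. F (gauss_limit x) \<partial>gauss_seq) - (\<integral>x. G m x \<partial>gauss_seq)\<bar> \<le>
          r / 8 + B * measure gauss_seq {x \<in> space gauss_seq. \<not> seq_norm x \<le> ennreal M}"
      proof (rule expectation_diff_le[OF prob_space_gauss_seq _ _ tail2(1)])
        show "(\<lambda>x. F (gauss_limit x)) \<in> borel_measurable gauss_seq"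
          by (rule borel_measurable_continuous_map[OF gauss_limit_measurable Fc])
        show "G m \<in> borel_measurable gauss_seq" unfolding measurable_gauss_seq by (rule Gm)
        show "\<bar>F (gauss_limit x) - G m x\<bar> \<le> r / 8"
          if "x \<in> space gauss_seq" "x \<notin> {x \<in> space gauss_seq. \<not> seq_norm x \<le> ennreal M}" for x
        proof -
          have x: "seq_norm x \<le> ennreal M" using that by simp
          then have fin: "seq_norm x < \<infinity>" by (rule order_le_less_trans) simp
          have "\<bar>F (gauss_limit x) - G m x\<bar> \<le> L * L2_dist H (gauss_limit x) (L2_class H (herm_part m x))"
            unfolding G_def by (intro lip gs ps)
          also have "\<dots> \<le> L * (sqrt (M / lam ^ m) * sqrt KH)"
          proof (rule mult_left_mono[OF _ L])
            have "gauss_limit x = L2_class H (herm_series x)" using fin by (simp add: gauss_limit_def)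
            then show "L2_dist H (gauss_limit x) (L2_class H (herm_part m x)) \<le> sqrt (M / lam ^ m) * sqrt KH"
              using L2_dist_bound[OF herm_series_sq_integrable[OF fin] herm_part_sq_integrable
                  herm_series_minus_part[OF x less_imp_le[OF M(1)] m(1)]] by simp
          qed
          also have "\<dots> \<le> r / 8" using m(2) r by linarith
          finally show ?thesis .
        qed
      qed (use F gs GB r in auto)
      moreover have "B * measure P {\<omega> \<in> space P. \<not> seq_norm (xi n \<omega>) \<le> ennreal M} \<le> r / 8"
        "B * measure gauss_seq {x \<in> space gauss_seq. \<not> seq_norm x \<le> ennreal M} \<le> r / 8"
        using mult_left_mono[OF tail1(2) B] mult_left_mono[OF tail2(2) B] M(2) by linarith+
      \<comment> \<open>Five errors of size \<open>r / 8\<close>: approximation and exceptional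
        event on either side, and the central limit theorem in between.\<close>
      ultimately show ?case using elim(4) r unfolding real_norm_def by linarith
    qed
    then show "\<exists>no. \<forall>n\<ge>no. norm ((\<integral>\<omega>. F (residual_element n \<omega>) \<partial>P) - (\<integral>x. F (gauss_limit x) \<partial>gauss_seq)) < r"
      by (simp add: eventually_sequentially)
  qed
qed

end

section \<open>Reduction to the standardized sample\<close>

lemma (in prob_space) indep_vars_reindex_Suc:
  assumes "indep_vars (\<lambda>_. N) X {1..}"
  shows "indep_vars (\<lambda>_. N) (\<lambda>j. X (Suc j)) UNIV"
proof -
  let ?F = "\<lambda>i. {X i -` A \<inter> space M |A. A \<in> sets N}"
  have rv: "\<And>i. i \<ge> 1 \<Longrightarrow> random_variable N (X i)" and ind: "indep_sets ?F {1..}"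
    using assms by (auto simp: indep_vars_def2)
  have "indep_sets (\<lambda>j. ?F (Suc j)) UNIV"
  proof (rule indep_setsI)
    show "?F (Suc i) \<subseteq> events" for i
      using rv[of "Suc i"] by (auto intro: measurable_sets)
    fix A J assume J: "J \<noteq> {}" "J \<subseteq> (UNIV :: nat set)" "finite J" "\<forall>j\<in>J. A j \<in> ?F (Suc j)"
    have "prob (\<Inter>i\<in>Suc ` J. A (i - 1)) = (\<Prod>i\<in>Suc ` J. prob (A (i - 1)))"
      by (rule indep_setsD[OF ind]) (use J in auto)
    then show "prob (\<Inter>j\<in>J. A j) = (\<Prod>j\<in>J. prob (A j))"
      by (simp add: prod.reindex)
  qed
  then show ?thesis using rv by (auto simp: indep_vars_def2)
qed

text \<open>Residuals are invariant under increasing affine maps of the data. No exceptional set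
  arises: if the standard deviation vanishes, both sides are 0 by the convention for
  division.\<close>

lemma scaled_residual_standardize:
  fixes X :: "nat \<Rightarrow> 'w \<Rightarrow> real" and \<mu> \<sigma> :: real
  assumes n: "n > 0" and \<sigma>: "\<sigma> > 0"
  defines "Z \<equiv> \<lambda>j \<omega>. (X (Suc j) \<omega> - \<mu>) / \<sigma>"
  shows "scaled_residual X n (Suc j) \<omega> = (Z j \<omega> - smean n (\<lambda>j. Z j \<omega>)) / ssd n (\<lambda>j. Z j \<omega>)"
proof -
  define z where "z j = Z j \<omega>" for j
  have X: "X (Suc j) \<omega> = \<mu> + \<sigma> * z j" for j using \<sigma> by (simp add: z_def Z_def)
  have shift: "(\<Sum>j=1..n. g j) = (\<Sum>j<n. g (Suc j))" for g :: "nat \<Rightarrow> real"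
    using sum.shift_bounds_cl_Suc_ivl[of g 0 "n - 1"] n by (simp add: lessThan_Suc_atMost[symmetric] atLeast0AtMost)
  have S: "(\<Sum>j<n. z j) = real n * smean n z" using n by (simp add: smean_def)
  have mean: "sample_mean X n \<omega> = \<mu> + \<sigma> * smean n z"
  proof -
    have "(\<Sum>j<n. \<mu> + \<sigma> * z j) = real n * (\<mu> + \<sigma> * smean n z)"
      using S by (simp add: sum.distrib sum_distrib_left[symmetric] algebra_simps)
    then show ?thesis using n by (simp add: sample_mean_def shift[unfolded One_nat_def] X)
  qed
  have "(\<Sum>j<n. (z j - smean n z)\<^sup>2) = (\<Sum>j<n. (z j)\<^sup>2) - 2 * smean n z * (\<Sum>j<n. z j) + real n * (smean n z)\<^sup>2"
    by (simp add: power2_diff sum.distrib sum_subtractf sum_distrib_left sum_distrib_right mult_ac)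
  also have "\<dots> = (\<Sum>j<n. (z j)\<^sup>2) - real n * (smean n z)\<^sup>2"
    unfolding S by (simp add: power2_eq_square)
  finally have V: "(\<Sum>j<n. (z j - smean n z)\<^sup>2) / real n = (\<Sum>j<n. (z j)\<^sup>2) / real n - (smean n z)\<^sup>2"
    using n by (simp add: diff_divide_distrib)
  have sd: "sample_sd X n \<omega> = \<sigma> * ssd n z"
  proof -
    have "(\<Sum>j=1..n. (X j \<omega> - sample_mean X n \<omega>)\<^sup>2) = \<sigma>\<^sup>2 * (\<Sum>j<n. (z j - smean n z)\<^sup>2)"
      unfolding shift X mean by (simp add: power_mult_distrib sum_distrib_left flip: right_diff_distrib)
    then have "sample_sd X n \<omega> = sqrt (\<sigma>\<^sup>2 * ((\<Sum>j<n. (z j - smean n z)\<^sup>2) / real n))"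
      by (simp add: sample_sd_def)
    then show ?thesis unfolding V ssd_def using \<sigma> by (simp add: real_sqrt_mult)
  qed
  have "scaled_residual X n (Suc j) \<omega> = (\<sigma> * (z j - smean n z)) / (\<sigma> * ssd n z)"
    unfolding scaled_residual_def X mean sd by (simp add: right_diff_distrib)
  then have "scaled_residual X n (Suc j) \<omega> = (z j - smean n z) / ssd n z" using \<sigma> by simp
  then show ?thesis unfolding z_def by (simp add: Z_def)
qed

lemma mgf_process_eq_raw_process:
  assumes n: "n > 0"
  shows "mgf_process X n \<omega> = raw_process n (\<lambda>j. scaled_residual X n (Suc j) \<omega>)"
proof -
  have shift: "(\<Sum>j=1..n. g j) = (\<Sum>j<n. g (Suc j))" for g :: "nat \<Rightarrow> real"
    using sum.shift_bounds_cl_Suc_ivl[of g 0 "n - 1"] n by (simp add: lessThan_Suc_atMost[symmetric] atLeast0AtMost)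
  show ?thesis by (simp add: fun_eq_iff mgf_process_def empirical_mgf_def raw_process_def shift[unfolded One_nat_def])
qed

theorem theorem1:
  fixes P :: "'w measure" and X :: "nat \<Rightarrow> 'w \<Rightarrow> real" and \<beta> \<mu> \<sigma> :: real
  assumes "\<beta> > 2"
    and "prob_space P"
    and "\<sigma> > 0"
    and "prob_space.indep_vars P (\<lambda>_. borel) X {1..}"
    and "\<And>j. j \<ge> 1 \<Longrightarrow> distributed P lborel (X j) (\<lambda>x. ennreal (normal_density \<mu> \<sigma> x))"
  defines "H \<equiv> weighted_lborel \<beta>"
  defines "W_seq \<equiv> (\<lambda>n \<omega>. L2_class H (mgf_process X n \<omega>))"
  shows "(\<forall>n\<ge>2. (\<forall>\<omega>\<in>space P. mgf_process X n \<omega> \<in> sq_integrable H) \<and>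
                 W_seq n \<in> P \<rightarrow>\<^sub>M borel_of_topology (L2_topology H)) \<and>
         (\<exists>(Q :: (nat \<Rightarrow> real) measure) W.
            prob_space Q \<and>
            centred_gaussian_element Q H W \<and>
            has_covariance_kernel Q H W limit_kernel \<and>
            converges_in_distribution (L2_topology H) P W_seq Q W)"
proof -
  interpret prob_space P by fact
  define Z where "Z j \<omega> = (X (Suc j) \<omega> - \<mu>) / \<sigma>" for j \<omega>
  obtain lam where "growth \<beta> lam" using exists_growth[OF assms(1)] by blast
  moreover have "normal_sample P Z"
  proof unfold_locales
    show "indep_vars (\<lambda>_. borel) Z UNIV"
      unfolding Z_def[abs_def]
      by (rule indep_vars_compose2[OF indep_vars_reindex_Suc[OF assms(4)]]) measurable
    show "distributed P lborel (Z j) (\<lambda>x. ennreal (std_normal_density x))" for j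
      using assms(5)[of "Suc j"] normal_standard_normal_convert[OF assms(3), of "X (Suc j)" \<mu>]
      by (simp add: Z_def[abs_def])
  qed
  ultimately interpret growth_sample \<beta> lam P Z by (rule growth_sample.intro)
  have eq: "mgf_process X n \<omega> =
      raw_process n (\<lambda>j. (Z j \<omega> - smean n (\<lambda>j. Z j \<omega>)) / ssd n (\<lambda>j. Z j \<omega>))" if "n > 0" for n \<omega>
    unfolding mgf_process_eq_raw_process[OF that]
    by (simp add: scaled_residual_standardize[OF that assms(3), of X _ _ \<mu>] Z_def)
  have W: "W_seq n = residual_element n" if "n > 0" for n
    unfolding W_seq_def H_def residual_element_def[abs_def] eq[OF that] ..
  have conv: "converges_in_distribution (L2_topology H) P W_seq gauss_seq gauss_limit"
    unfolding converges_in_distribution_def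
  proof (intro allI impI)
    fix F assume "continuous_map (L2_topology H) euclideanreal F \<and> bounded (F ` topspace (L2_topology H))"
    then have "(\<lambda>n. \<integral>\<omega>. F (residual_element n \<omega>) \<partial>P) \<longlonglongrightarrow> (\<integral>x. F (gauss_limit x) \<partial>gauss_seq)"
      using residual_element_converges unfolding converges_in_distribution_def H_def by blast
    \<comment> \<open>The two sequences are identified only for \<open>n > 0\<close>, which is
      enough for the limit.\<close>
    then show "(\<lambda>n. \<integral>\<omega>. F (W_seq n \<omega>) \<partial>P) \<longlonglongrightarrow> (\<integral>x. F (gauss_limit x) \<partial>gauss_seq)"
      by (rule Lim_transform_eventually)
        (use W in \<open>auto intro: eventually_mono[OF eventually_gt_at_top[of 0]]\<close>)
  qed
  show ?thesis
  proof (intro conjI allI impI ballI exI[of _ gauss_seq] exI[of _ gauss_limit])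
    show "mgf_process X n \<omega> \<in> sq_integrable H" if "2 \<le> n" for n \<omega>
      using raw_process_sq_integrable[of n] that unfolding H_def by (simp add: eq)
    show "W_seq n \<in> P \<rightarrow>\<^sub>M borel_of_topology (L2_topology H)" if "2 \<le> n" for n
      using residual_element_measurable[of n] W[of n] that unfolding H_def by simp
    show "prob_space gauss_seq" by (rule prob_space_gauss_seq)
    show "centred_gaussian_element gauss_seq H gauss_limit"
      unfolding H_def by (rule gaussian_gauss_limit)
    show "has_covariance_kernel gauss_seq H gauss_limit limit_kernel"
      unfolding H_def by (rule covariance_gauss_limit)
    show "converges_in_distribution (L2_topology H) P W_seq gauss_seq gauss_limit"
      by (rule conv)
  qed
qed

end
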